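(* Let $d,d',s$ be fixed, let $K$ be a homogeneous $s$-dimensional Calderón–Zygmund kernel with Hölder parameter $\alpha$, and let $\Lambda>0$. For each $\varepsilon>0$ there exists $\lambda=\lambda(\varepsilon)>0$, depending only on $\varepsilon,d,s,\alpha,\|K\|_*,\Lambda$, such that for every non-trivial $\Lambda$-nice reflectionless measure $\mu$, every $x\in\mathbb R^d$ and $r>0$: if $$\int_{B(x,r)}|\overline T_\mu(1)(y)|\,dm_d(y)>\varepsilon\, m_d(B(x,r)),$$ then there is a ball $B'\subset B(x,r)$ of radius $\lambda r$ with $\mu(B')=0$.
   Context: Fix integers $d\ge2$, $d'\ge1$ and $s\in(0,d)$. $B(x,r)$ is the open ball in $\mathbb R^d$; $m_d$ is Lebesgue measure; a measure is a non-negative locally finite Borel measure on $\mathbb R^d$; $\mathrm{supp}(\mu)$ is its closed support. $\mathrm{Lip}_0(\mathbb R^d)$ is the set of compactly supported (complex-valued) Lipschitz functions, $\mathrm{Lip}_B(\mathbb R^d)$ the set of bounded Lipschitz functions. Kernel. A homogeneous $s$-dimensional Calderón–Zygmund kernel is $K:\mathbb R^d\setminus\{0\}\to\mathbb C^{d'}$ with (i) $|K(x)|\le|x|^{-s}$; (ii) $K(-x)=-K(x)$; (iii) for some $\alpha\in(0,1]$ the $\alpha$-Hölder seminorm on $\mathbb R^d$, denoted $\|K\|_*$, of $x\mapsto K(x)|x|^{s+\alpha}$ (set to $0$ at $0$) is finite; (iv) $K(\lambda x)=\lambda^{-s}K(x)$ for $\lambda>0$, $x\ne0$. For $\delta>0$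 let $K_\delta(x)=K(x)\big(\tfrac{|x|}{\max(\delta,|x|)}\big)^{s+\alpha}$, $K_\delta(0)=0$, and $K^\delta=K-K_\delta$ on $\mathbb R^d\setminus\{0\}$ (supported in $\overline{B(0,\delta)}$). Measures. $\mu$ is diffuse if $(x,y)\mapsto|x-y|^{1-s}$ is locally integrable with respect to $\mu\times\mu$; $\mu$ has restricted growth at infinity if $\int_{|x|\ge1}|x|^{-s-\alpha}d\mu(x)<\infty$; $\mu$ is $\Lambda$-nice if $\mu(B(x,r))\le\Lambda r^s$ for all $x\in\mathbb R^d$, $r>0$ (nice measures are diffuse with restricted growth). Forms. Let $H_{f,\varphi}(x,y)=\tfrac12[f(y)\varphi(x)-f(x)\varphi(y)]$. For $\mu$ diffuse and $f,\varphi\in\mathrm{Lip}_0(\mathbb R^d)$, $\langle T(f\mu),\varphi\rangle_\mu=\iint K(x-y)H_{f,\varphi}(x,y)\,d\mu(x)d\mu(y)$ (integrand read as $0$ on the diagonal). For $f\in\mathrm{Lip}_0$, $\varphi\in\mathrm{Lip}_B$, $\langle T^\delta(f\mu),\varphi\rangle_\mu=\iint K^\delta(x-y)H_{f,\varphi}(x,y)\,d\mu(x)d\mu(y)$. If $\mu$ also has restricted growth, $f\in\mathrm{Lip}_0$, $\int f\,d\mu=0$ and $\varphi\in\mathrm{Lip}_B$, then $\langle T(f\mu),\varphi\rangle_\mu=\langle T(f\mu),\psi\varphi\rangle_\mu+\int T(f\mu)(x)[1-\psi(x)]\varphi(x)d\mu(x)$, where $\psi\in\mathrm{Lip}_0$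 equals $1$ on a neighbourhood of $\mathrm{supp} f$ and $T(f\mu)(x)=\int K(x-y)f(y)d\mu(y)$; this does not depend on $\psi$. Reflectionless. A diffuse measure $\mu$ with restricted growth at infinity is reflectionless if $\langle T(f\mu),1\rangle_\mu=0$ for all $f\in\mathrm{Lip}_0(\mathbb R^d)$ with $\int f\,d\mu=0$. Potentials. For non-trivial diffuse $\mu$ with restricted growth, fix $\eta\in\mathrm{Lip}_0(\mathbb R^d)$, $\eta\ge0$, $\int\eta\,d\mu=1$. For $\varphi\in\mathrm{Lip}_B$ and $x\in\mathbb R^d$ with $\int_{B(x,1)}|x-y|^{-s}d\mu(y)<\infty$ (true for $m_d$-a.e. $x$), $\overline T_\mu(\varphi)(x)$ is defined as $$\overline T_\mu(\varphi)(x)=\lim_{k\to\infty}\Big[\int K(y-x)\psi_k(y)\varphi(y)d\mu(y)-\langle T(\eta\mu),\psi_k\varphi\rangle_\mu\Big],$$ for any $\psi_k\in\mathrm{Lip}_0$, $0\le\psi_k\le1$, $\psi_k\equiv1$ on $B(0,k)$. Equivalently, for any $\delta>0$, $\overline T_\mu(\varphi)(x)=\overline T_{\mu,\delta}(\varphi)(x)+\int K^\delta(y-x)\varphi(y)d\mu(y)$, where $\overline T_{\mu,\delta}(\varphi)(x)=\iint[K_\delta(y-x)-K_\delta(y-z)]\varphi(y)\eta(z)\,d\mu(y)d\mu(z)-\langle T^\delta(\eta\mu),\varphi\rangle_\mu$. For reflectionless $\mu$ and $\varphi\equiv1$ these values do not depend on $\eta$. *)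

theory Defs
  imports "HOL-Analysis.Analysis"
begin

text \<open>
  The target space \<open>\<complex>\<^sup>n\<close> of a kernel is represented by functions \<open>v :: nat \<Rightarrow> complex\<close> of which only
  the components \<open>v i\<close> with \<open>i < n\<close> count.  This keeps the target dimension an ordinary natural
  number, so that constants can be chosen before it.  Vector-valued integrals are taken
  componentwise.
\<close>

definition cnorm :: "nat \<Rightarrow> (nat \<Rightarrow> complex) \<Rightarrow> real" where
  "cnorm n v = L2_set (\<lambda>i. cmod (v i)) {..<n}"

definition holder_seminorm ::
  "nat \<Rightarrow> real \<Rightarrow> ('a::metric_space \<Rightarrow> nat \<Rightarrow> complex) \<Rightarrow> ennreal" where
  "holder_seminorm n \<alpha> F =
     (SUP (x, y) \<in> {(x, y). x \<noteq> y}. ennreal (cnorm n (\<lambda>i. F x i - F y i) / dist x y powr \<alpha>))"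

text \<open>
  Kernels are total functions; their value at the origin is arbitrary and never matters.
\<close>

definition kernel_seminorm ::
  "nat \<Rightarrow> real \<Rightarrow> real \<Rightarrow> ('a::euclidean_space \<Rightarrow> nat \<Rightarrow> complex) \<Rightarrow> ennreal" where
  "kernel_seminorm n s \<alpha> K =
     holder_seminorm n \<alpha> (\<lambda>x i. if x = 0 then 0 else K x i * of_real (norm x powr (s + \<alpha>)))"

definition cz_kernel ::
  "nat \<Rightarrow> real \<Rightarrow> real \<Rightarrow> ('a::euclidean_space \<Rightarrow> nat \<Rightarrow> complex) \<Rightarrow> bool" where
  "cz_kernel n s \<alpha> K \<longleftrightarrow>
     0 < \<alpha> \<and> \<alpha> \<le> 1 \<and>
     (\<forall>x. x \<noteq> 0 \<longrightarrow> cnorm n (K x) \<le> norm x powr (- s)) \<and>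
     (\<forall>x. x \<noteq> 0 \<longrightarrow> (\<forall>i<n. K (- x) i = - K x i)) \<and>
     kernel_seminorm n s \<alpha> K < \<infinity> \<and>
     (\<forall>x l. x \<noteq> 0 \<longrightarrow> 0 < l \<longrightarrow> (\<forall>i<n. K (l *\<^sub>R x) i = of_real (l powr (- s)) * K x i))"

text \<open>
  The power \<open>t\<^sup>p\<close> for \<open>t \<ge> 0\<close> with the value \<open>\<infinity>\<close> for \<open>t = 0\<close>, \<open>p < 0\<close>; the library function
  \<open>powr\<close> would give \<open>0\<close> there, which would hide atoms of a measure.
\<close>

definition epow :: "real \<Rightarrow> real \<Rightarrow> ennreal" where
  "epow t p = (if t = 0 then (if p < 0 then \<infinity> else if p = 0 then 1 else 0)
               else ennreal (t powr p))"

definition loc_finite_borel :: "'a::euclidean_space measure \<Rightarrow> bool" where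
  "loc_finite_borel \<mu> \<longleftrightarrow> sets \<mu> = sets borel \<and> (\<forall>C. compact C \<longrightarrow> emeasure \<mu> C < \<infinity>)"

definition nontrivial :: "'a::euclidean_space measure \<Rightarrow> bool" where
  "nontrivial \<mu> \<longleftrightarrow> emeasure \<mu> UNIV \<noteq> 0"

definition diffuse :: "real \<Rightarrow> 'a::euclidean_space measure \<Rightarrow> bool" where
  "diffuse s \<mu> \<longleftrightarrow>
     (\<forall>C :: ('a \<times> 'a) set. compact C \<longrightarrow>
        (\<integral>\<^sup>+p\<in>C. epow (dist (fst p) (snd p)) (1 - s) \<partial>(\<mu> \<Otimes>\<^sub>M \<mu>)) < \<infinity>)"

definition restricted_growth :: "real \<Rightarrow> real \<Rightarrow> 'a::euclidean_space measure \<Rightarrow> bool" where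
  "restricted_growth s \<alpha> \<mu> \<longleftrightarrow>
     (\<integral>\<^sup>+x\<in>{x. 1 \<le> norm x}. ennreal (norm x powr (- s - \<alpha>)) \<partial>\<mu>) < \<infinity>"

definition nice :: "real \<Rightarrow> real \<Rightarrow> 'a::euclidean_space measure \<Rightarrow> bool" where
  "nice s \<Lambda> \<mu> \<longleftrightarrow> (\<forall>x r. 0 < r \<longrightarrow> emeasure \<mu> (ball x r) \<le> ennreal (\<Lambda> * r powr s))"

definition csupp :: "('a::topological_space \<Rightarrow> 'b::zero) \<Rightarrow> 'a set" where
  "csupp f = closure {x. f x \<noteq> 0}"

definition Lip0 :: "('a::euclidean_space \<Rightarrow> 'b::real_normed_vector) set" where
  "Lip0 = {f. (\<exists>L. L-lipschitz_on UNIV f) \<and> compact (csupp f)}"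

text \<open>
  The forms are defined for a scalar kernel \<open>k\<close>, to be instantiated with the components of a
  vector-valued one.  The factor \<open>H_form f \<phi>\<close> vanishes on the diagonal, hence so does the integrand
  of \<open>T_form\<close>.
\<close>

definition H_form :: "('a \<Rightarrow> complex) \<Rightarrow> ('a \<Rightarrow> complex) \<Rightarrow> 'a \<Rightarrow> 'a \<Rightarrow> complex" where
  "H_form f \<phi> x y = (f y * \<phi> x - f x * \<phi> y) / 2"

definition T_form :: "('a::euclidean_space \<Rightarrow> complex) \<Rightarrow> 'a measure \<Rightarrow>
    ('a \<Rightarrow> complex) \<Rightarrow> ('a \<Rightarrow> complex) \<Rightarrow> complex" where
  "T_form k \<mu> f \<phi> =
     (\<integral>p. k (fst p - snd p) * H_form f \<phi> (fst p) (snd p) \<partial>(\<mu> \<Otimes>\<^sub>M \<mu>))"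

definition T_fun :: "('a::euclidean_space \<Rightarrow> complex) \<Rightarrow> 'a measure \<Rightarrow>
    ('a \<Rightarrow> complex) \<Rightarrow> 'a \<Rightarrow> complex" where
  "T_fun k \<mu> f x = (\<integral>y. k (x - y) * f y \<partial>\<mu>)"

text \<open>
  The extension of the form to bounded Lipschitz \<open>\<phi>\<close>, meaningful for \<open>f \<in> Lip0\<close> of mean zero: the
  common value over all admissible cut-offs \<open>\<psi>\<close>.
\<close>

definition T_form_ext :: "('a::euclidean_space \<Rightarrow> complex) \<Rightarrow> 'a measure \<Rightarrow>
    ('a \<Rightarrow> complex) \<Rightarrow> ('a \<Rightarrow> complex) \<Rightarrow> complex" where
  "T_form_ext k \<mu> f \<phi> =
     (THE L. \<forall>\<psi>\<in>Lip0. (\<exists>U. open U \<and> csupp f \<subseteq> U \<and> (\<forall>x\<in>U. \<psi> x = 1)) \<longrightarrow>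
        L = T_form k \<mu> f (\<lambda>x. \<psi> x * \<phi> x)
            + (\<integral>x. T_fun k \<mu> f x * (1 - \<psi> x) * \<phi> x \<partial>\<mu>))"

definition reflectionless :: "nat \<Rightarrow> real \<Rightarrow> real \<Rightarrow>
    ('a::euclidean_space \<Rightarrow> nat \<Rightarrow> complex) \<Rightarrow> 'a measure \<Rightarrow> bool" where
  "reflectionless n s \<alpha> K \<mu> \<longleftrightarrow>
     diffuse s \<mu> \<and> restricted_growth s \<alpha> \<mu> \<and>
     (\<forall>f\<in>Lip0. (\<integral>x. f x \<partial>\<mu>) = 0 \<longrightarrow>
        (\<forall>i<n. T_form_ext (\<lambda>x. K x i) \<mu> f (\<lambda>_. 1) = 0))"

definition normalizer :: "'a::euclidean_space measure \<Rightarrow> ('a \<Rightarrow> real) \<Rightarrow> bool" where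
  "normalizer \<mu> \<eta> \<longleftrightarrow> \<eta> \<in> Lip0 \<and> (\<forall>x. 0 \<le> \<eta> x) \<and> (\<integral>x. \<eta> x \<partial>\<mu>) = 1"

definition cutoff_seq :: "(nat \<Rightarrow> 'a::euclidean_space \<Rightarrow> real) \<Rightarrow> bool" where
  "cutoff_seq \<psi> \<longleftrightarrow>
     (\<forall>k. \<psi> k \<in> Lip0 \<and> (\<forall>x. 0 \<le> \<psi> k x \<and> \<psi> k x \<le> 1) \<and> (\<forall>x\<in>ball 0 (real k). \<psi> k x = 1))"

text \<open>
  The potential \<open>\<^bold>T\<^sub>\<mu>(\<phi>)(x)\<close>, in components: the common limit over all cut-off sequences.  It is
  only meaningful where the truncated Riesz potential is finite, which is almost everywhere with
  respect to Lebesgue measure; elsewhere it is set to \<open>0\<close>.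
\<close>

definition T_bar :: "('a::euclidean_space \<Rightarrow> nat \<Rightarrow> complex) \<Rightarrow> real \<Rightarrow> 'a measure \<Rightarrow> ('a \<Rightarrow> real) \<Rightarrow>
    ('a \<Rightarrow> complex) \<Rightarrow> 'a \<Rightarrow> nat \<Rightarrow> complex" where
  "T_bar K s \<mu> \<eta> \<phi> x i =
     (if (\<integral>\<^sup>+y\<in>ball x 1. epow (dist x y) (- s) \<partial>\<mu>) < \<infinity>
      then THE L. \<forall>\<psi>. cutoff_seq \<psi> \<longrightarrow>
        (\<lambda>k. (\<integral>y. K (y - x) i * of_real (\<psi> k y) * \<phi> y \<partial>\<mu>)
              - T_form (\<lambda>z. K z i) \<mu> (\<lambda>y. of_real (\<eta> y)) (\<lambda>y. of_real (\<psi> k y) * \<phi> y))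
          \<longlonglongrightarrow> L
      else 0)"

end

theory Submission
  imports Defs
begin

text \<open>
  For a reflectionless \<open>\<mu>\<close> the normalising function \<open>\<eta>\<close> in the definition of the potential may be
  replaced by any probability density \<open>f \<in> Lip0\<close>.  Splitting the kernel at scale \<open>\<delta>\<close>, the value of the
  potential at \<open>x\<close> is then bounded by the Riesz potential \<open>P\<^sub>\<delta>(x) = \<integral>\<^bsub>B(x,\<delta>)\<^esub> |x - y|\<^sup>-\<^sup>s d\<mu>(y)\<close>, plus a
  far part that is small once \<open>f\<close> lives within distance \<open>c\<delta>\<close> of \<open>x\<close> (Hoelder continuity), plus the energy
  \<open>\<integral>\<integral>\<^bsub>|y - z| < \<delta>\<^esub> |y - z|\<^sup>-\<^sup>s |f(y) - f(z)| d\<mu> d\<mu>\<close>.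

  If \<open>\<mu>\<close> charges a ball of radius \<open>c\<delta>\<close> near \<open>x\<close>, then \<open>f\<close> can be chosen with energy at most
  \<open>small + C P\<^bsub>5\<delta>\<^esub>(x)\<close>: among the balls whose density \<open>\<mu>(B(z,t))/t\<^sup>s\<close> exceeds \<open>A t/\<delta>\<close>, with \<open>A\<close>
  comparable to \<open>P\<^bsub>5\<delta>\<^esub>(x)\<close>, take one of nearly maximal radius \<open>T\<close>.  Maximality makes \<open>B(z,T)\<close> doubling and
  the densities above scale \<open>T\<close> summable, and a bump at scale \<open>T\<close> is constant enough to
  cancel what happens below.  If there is no such ball, any bump works.

  So if every ball of radius \<open>\<lambda>r = c\<delta>\<close> in \<open>B(x,r)\<close> is charged, the mean of the potential over \<open>B(x,r)\<close> is at most
  \<open>\<epsilon>/2\<close> plus \<open>C\<close> times the mean of \<open>P\<^bsub>5\<delta>\<^esub>\<close>, and the latter is of order \<open>(\<delta>/r)\<^bsup>d-s\<^esup>\<close>.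
\<close>

section \<open>Dyadic estimates for powers of the distance\<close>

lemma borel_ball [measurable]: "ball (x :: 'a::metric_space) r \<in> sets borel"
  by simp

lemma le_suminf_ennreal: "(f j :: ennreal) \<le> (\<Sum>j. f j)"
  using sum_le_suminf[OF summableI, of "{j}" f] by simp

text \<open>Dyadic annuli \<open>R / 2 ^ (j + 1) \<le> dist y x < R / 2 ^ j\<close>: on each the
  integrand is comparable to a constant and the mass is controlled by the ball hypothesis, so the
  sum is geometric with ratio \<open>2 powr (p - q) < 1\<close>. The measure is arbitrary because
  the bound serves \<mu>, a restriction of \<mu> and Lebesgue measure.\<close>

lemma nn_integral_dist_powr_ball_le:
  fixes y :: "'a::euclidean_space"
  assumes N: "sets N = sets borel" and R: "0 < R" and pq: "p < q" and A: "0 \<le> A"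
    and ball: "\<And>t. 0 < t \<Longrightarrow> t \<le> R \<Longrightarrow> emeasure N (ball y t) \<le> ennreal (A * t powr q)"
  shows "(\<integral>\<^sup>+x. ennreal (dist y x powr (- p)) * indicator (ball y R) x \<partial>N)
      \<le> ennreal (2 powr \<bar>p\<bar> / (1 - 2 powr (p - q)) * A * R powr (q - p))"
proof -
  note [measurable_cong] = N
  have [simp, measurable]: "ball y t \<in> sets N" for t by (simp add: N)
  \<comment> \<open>Bounds the integrand on the j-th annulus; the factor
    \<open>2 powr \<bar>p\<bar>\<close> covers decreasing and increasing powers alike.\<close>
  define c where "c j = 2 powr \<bar>p\<bar> * (R / 2 ^ j) powr (- p)" for j :: nat
  define \<rho> where "\<rho> = 2 powr (p - q)"
  have \<rho>: "0 < \<rho>" "\<rho> < 1" using pq powr_less_mono[of "p - q" 0 "2::real"] by (auto simp: \<rho>_def)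
  have pw: "ennreal (dist y x powr (- p)) * indicator (ball y R) x
      \<le> (\<Sum>j. ennreal (c j) * indicator (ball y (R / 2 ^ j)) x)" for x
  \<comment> \<open>Otherwise the left side is \<open>0\<close>: beyond radius \<open>R\<close> by
    the indicator, at the centre because \<open>0 powr (- p) = 0\<close>.\<close>
  proof (cases "0 < dist y x \<and> dist y x < R")
    case True
    obtain n where "(1 / 2) ^ n < dist y x / R"
      using real_arch_pow_inv[of "dist y x / R" "1 / 2"] True R by auto
    then have "R / 2 ^ n \<le> dist y x"
      using R by (simp add: pos_less_divide_eq power_divide)
    moreover have "R / 2 ^ Suc n \<le> R / 2 ^ n" using R by (intro divide_left_mono) auto
    ultimately have n: "R / 2 ^ Suc n \<le> dist y x" by (rule order_trans[rotated])
    \<comment> \<open>The annulus containing \<open>x\<close>: minimality gives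
      \<open>dist y x < R / 2 ^ j\<close>, and for \<open>j = 0\<close> this is the case
      assumption.\<close>
    define j where "j = (LEAST n. R / 2 ^ Suc n \<le> dist y x)"
    have "R / 2 ^ Suc j \<le> dist y x" unfolding j_def using n by (rule LeastI)
    moreover have "dist y x < R / 2 ^ j"
    proof (cases j)
      case (Suc i)
      then show ?thesis using not_less_Least[of i "\<lambda>n. R / 2 ^ Suc n \<le> dist y x"] by (auto simp: j_def)
    qed (use True in auto)
    ultimately have j: "R / 2 ^ j / 2 \<le> dist y x" "dist y x < R / 2 ^ j" by (simp_all add: mult.commute)
    have Rj: "0 < R / 2 ^ j" using R by simp
    have "dist y x powr (- p) \<le> c j"
    proof (cases "0 \<le> p")
      case True
      have "dist y x powr (- p) \<le> (R / 2 ^ j / 2) powr (- p)"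
        by (rule powr_mono2'[OF _ half_gt_zero[OF Rj] j(1)]) (use True in simp)
      also have "\<dots> = (R / 2 ^ j) powr (- p) / 2 powr (- p)"
        using Rj by (subst powr_divide) auto
      also have "\<dots> = c j" using True by (simp add: c_def powr_minus_divide)
      finally show ?thesis .
    next
      case False
      have "dist y x powr (- p) \<le> (R / 2 ^ j) powr (- p)"
        by (rule powr_mono2[OF _ _ less_imp_le[OF j(2)]]) (use False in auto)
      also have "\<dots> \<le> c j"
        unfolding c_def using mult_right_mono[of 1 "2 powr \<bar>p\<bar>" "(R / 2 ^ j) powr (- p)"]
        by (simp add: ge_one_powr_ge_zero)
      finally show ?thesis .
    qed
    then have "ennreal (dist y x powr (- p)) * indicator (ball y R) x
        \<le> ennreal (c j) * indicator (ball y (R / 2 ^ j)) x"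
      using j True by (simp add: ennreal_leI)
    also have "\<dots> \<le> (\<Sum>j. ennreal (c j) * indicator (ball y (R / 2 ^ j)) x)"
      by (rule le_suminf_ennreal)
    finally show ?thesis .
  qed (auto simp: indicator_def)
  have trm: "ennreal (c j) * emeasure N (ball y (R / 2 ^ j))
      \<le> ennreal (2 powr \<bar>p\<bar> * A * R powr (q - p) * \<rho> ^ j)" for j
  proof -
    have Rj: "0 < R / 2 ^ j" "R / 2 ^ j \<le> R" using R by (auto simp: field_simps)
    have e: "\<rho> ^ j = (2 ^ j) powr (p - q)"
      by (simp add: \<rho>_def powr_powr flip: powr_realpow) (simp add: mult.commute)
    have "ennreal (c j) * emeasure N (ball y (R / 2 ^ j))
        \<le> ennreal (c j) * ennreal (A * (R / 2 ^ j) powr q)"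
      using ball[OF Rj] by (intro mult_left_mono) auto
    also have "\<dots> = ennreal (c j * (A * (R / 2 ^ j) powr q))"
      using A by (subst ennreal_mult) (auto simp: c_def)
    also have "c j * (A * (R / 2 ^ j) powr q) = 2 powr \<bar>p\<bar> * A * (R / 2 ^ j) powr (q - p)"
      using Rj by (simp add: c_def powr_diff powr_minus field_simps)
    also have "(R / 2 ^ j) powr (q - p) = R powr (q - p) * \<rho> ^ j"
      unfolding e using R powr_minus[of "2 ^ j" "q - p"] by (subst powr_divide) (auto simp: divide_inverse)
    finally show ?thesis by (simp add: mult.assoc)
  qed
  have "(\<integral>\<^sup>+x. ennreal (dist y x powr (- p)) * indicator (ball y R) x \<partial>N)
      \<le> (\<integral>\<^sup>+x. (\<Sum>j. ennreal (c j) * indicator (ball y (R / 2 ^ j)) x) \<partial>N)"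
    by (intro nn_integral_mono pw)
  also have "\<dots> = (\<Sum>j. ennreal (c j) * emeasure N (ball y (R / 2 ^ j)))"
    by (subst nn_integral_suminf, measurable) (simp add: nn_integral_cmult_indicator del: power_Suc)
  also have "\<dots> \<le> (\<Sum>j. ennreal (2 powr \<bar>p\<bar> * A * R powr (q - p) * \<rho> ^ j))"
    by (intro suminf_le trm) auto
  also have "\<dots> = ennreal (2 powr \<bar>p\<bar> * A * R powr (q - p) * (1 / (1 - \<rho>)))"
    using \<rho> A by (intro suminf_ennreal_eq sums_mult geometric_sums) auto
  finally show ?thesis by (simp add: \<rho>_def field_simps)
qed

text \<open>The counterpart at infinity: in the shell between \<open>\<delta> * 2 ^ j\<close> and
  \<open>\<delta> * 2 ^ (j + 1)\<close> the integrand is at most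
  \<open>(\<delta> * 2 ^ j) powr (- s - \<alpha>)\<close>, and growth of order \<open>s\<close>
  leaves a geometric series of ratio \<open>2 powr (- \<alpha>)\<close>.\<close>

lemma nn_integral_max_powr_le:
  fixes y :: "'a::euclidean_space"
  assumes N: "sets N = sets borel" and \<delta>: "0 < \<delta>" and sa: "0 < s" "0 < \<alpha>" and A: "0 \<le> A"
    and ball: "\<And>t. 0 < t \<Longrightarrow> emeasure N (ball y t) \<le> ennreal (A * t powr s)"
  shows "(\<integral>\<^sup>+x. ennreal (max \<delta> (dist y x) powr (- s - \<alpha>)) \<partial>N)
      \<le> ennreal (2 powr s / (1 - 2 powr (- \<alpha>)) * A * \<delta> powr (- \<alpha>))"
proof -
  note [measurable_cong] = N
  have [simp, measurable]: "ball y t \<in> sets N" for t by (simp add: N)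
  define c where "c j = (\<delta> * 2 ^ j) powr (- s - \<alpha>)" for j :: nat
  define \<rho> where "\<rho> = 2 powr (- \<alpha>)"
  have \<rho>: "0 < \<rho>" "\<rho> < 1" using sa powr_less_mono[of "- \<alpha>" 0 "2::real"] by (auto simp: \<rho>_def)
  have pw: "ennreal (max \<delta> (dist y x) powr (- s - \<alpha>))
      \<le> (\<Sum>j. ennreal (c j) * indicator (ball y (\<delta> * 2 ^ Suc j)) x)" for x
  proof -
    have "\<exists>n. dist y x / \<delta> < 2 ^ n" using real_arch_pow[of 2 "dist y x / \<delta>"] by auto
    then obtain n where n: "dist y x < \<delta> * 2 ^ Suc n" using \<delta>
      by (auto simp: field_simps) (smt (verit) mult_less_cancel_left_pos zero_less_power mult_pos_pos)
    define j where "j = (LEAST n. dist y x < \<delta> * 2 ^ Suc n)"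
    have j1: "dist y x < \<delta> * 2 ^ Suc j" unfolding j_def using n by (rule LeastI)
    have j2: "\<delta> * 2 ^ j \<le> max \<delta> (dist y x)"
    proof (cases j)
      case (Suc i)
      then show ?thesis using not_less_Least[of i "\<lambda>n. dist y x < \<delta> * 2 ^ Suc n"] by (auto simp: j_def)
    qed auto
    have "max \<delta> (dist y x) powr (- s - \<alpha>) \<le> c j"
      unfolding c_def using j2 \<delta> sa by (intro powr_mono2') auto
    then have "ennreal (max \<delta> (dist y x) powr (- s - \<alpha>))
        \<le> ennreal (c j) * indicator (ball y (\<delta> * 2 ^ Suc j)) x"
      using j1 by (simp add: ennreal_leI)
    also have "\<dots> \<le> (\<Sum>j. ennreal (c j) * indicator (ball y (\<delta> * 2 ^ Suc j)) x)"
      by (rule le_suminf_ennreal)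
    finally show ?thesis .
  qed
  have trm: "ennreal (c j) * emeasure N (ball y (\<delta> * 2 ^ Suc j))
      \<le> ennreal (2 powr s * A * \<delta> powr (- \<alpha>) * \<rho> ^ j)" for j
  proof -
    have e: "\<rho> ^ j = (2 ^ j) powr (- \<alpha>)"
      by (simp add: \<rho>_def powr_powr flip: powr_realpow) (simp add: mult.commute)
    have "ennreal (c j) * emeasure N (ball y (\<delta> * 2 ^ Suc j))
        \<le> ennreal (c j) * ennreal (A * (\<delta> * 2 ^ Suc j) powr s)"
      using \<delta> by (intro mult_left_mono ball) auto
    also have "\<dots> = ennreal (c j * (A * (\<delta> * 2 ^ Suc j) powr s))"
      using A by (subst ennreal_mult) (auto simp: c_def)
    also have "c j * (A * (\<delta> * 2 ^ Suc j) powr s) = 2 powr s * A * (\<delta> powr (- \<alpha>) * \<rho> ^ j)"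
      unfolding e c_def using \<delta> by (simp add: powr_mult powr_diff powr_minus field_simps)
    finally show ?thesis by (simp add: mult.assoc)
  qed
  have "(\<integral>\<^sup>+x. ennreal (max \<delta> (dist y x) powr (- s - \<alpha>)) \<partial>N)
      \<le> (\<integral>\<^sup>+x. (\<Sum>j. ennreal (c j) * indicator (ball y (\<delta> * 2 ^ Suc j)) x) \<partial>N)"
    by (intro nn_integral_mono pw)
  also have "\<dots> = (\<Sum>j. ennreal (c j) * emeasure N (ball y (\<delta> * 2 ^ Suc j)))"
    by (subst nn_integral_suminf, measurable) (simp add: nn_integral_cmult_indicator del: power_Suc)
  also have "\<dots> \<le> (\<Sum>j. ennreal (2 powr s * A * \<delta> powr (- \<alpha>) * \<rho> ^ j))"
    by (intro suminf_le trm) auto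
  also have "\<dots> = ennreal (2 powr s * A * \<delta> powr (- \<alpha>) * (1 / (1 - \<rho>)))"
    using \<rho> A by (intro suminf_ennreal_eq sums_mult geometric_sums) auto
  finally show ?thesis by (simp add: \<rho>_def field_simps)
qed

section \<open>Bump functions and nice measures\<close>

text \<open>The Riesz potential truncated at radius \<open>R\<close>. At distance \<open>0\<close>
  the value of \<open>powr\<close> is \<open>0\<close>, which is harmless for nice measures because
  they have no atoms.\<close>

definition potential :: "real \<Rightarrow> 'a::euclidean_space measure \<Rightarrow> real \<Rightarrow> 'a \<Rightarrow> ennreal" where
  "potential s \<mu> R x = (\<integral>\<^sup>+y. ennreal (dist x y powr (- s)) * indicator (ball x R) y \<partial>\<mu>)"

definition bump :: "'a::euclidean_space \<Rightarrow> real \<Rightarrow> 'a \<Rightarrow> real" where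
  "bump z T y = max 0 (min 1 (2 - dist z y / T))"

lemma bump_nonneg: "0 \<le> bump z T y" and bump_le_1: "bump z T y \<le> 1"
  by (auto simp: bump_def)

lemma bump_eq_1: "0 < T \<Longrightarrow> dist z y \<le> T \<Longrightarrow> bump z T y = 1"
  by (auto simp: bump_def field_simps)

lemma bump_pos_iff: "0 < T \<Longrightarrow> 0 < bump z T y \<longleftrightarrow> dist z y < 2 * T"
  by (auto simp: bump_def less_max_iff_disj pos_divide_less_eq)

lemma bump_eq_0: "0 < T \<Longrightarrow> 2 * T \<le> dist z y \<Longrightarrow> bump z T y = 0"
  using bump_pos_iff[of T z y] bump_nonneg[of z T y] by linarith

lemma bump_diff_le: "0 < T \<Longrightarrow> \<bar>bump z T x - bump z T y\<bar> \<le> dist x y / T"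
proof -
  assume T: "0 < T"
  have "\<bar>bump z T x - bump z T y\<bar> \<le> \<bar>dist z x / T - dist z y / T\<bar>"
    by (auto simp: bump_def)
  also have "\<dots> = \<bar>dist z x - dist z y\<bar> / T" using T by (simp add: abs_divide flip: diff_divide_distrib)
  also have "\<dots> \<le> dist x y / T"
    using T abs_dist_diff_le[of x z y] by (intro divide_right_mono) (auto simp: dist_commute)
  finally show ?thesis .
qed

lemma csupp_subset_cball: "(\<And>y. f y \<noteq> 0 \<Longrightarrow> dist z y \<le> R) \<Longrightarrow> csupp f \<subseteq> cball z R"
  unfolding csupp_def by (rule closure_minimal) auto

lemma Lip0I:
  fixes f :: "'a::euclidean_space \<Rightarrow> 'b::real_normed_vector"
  assumes "L-lipschitz_on UNIV f" "\<And>y. f y \<noteq> 0 \<Longrightarrow> dist z y \<le> R"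
  shows "f \<in> Lip0"
proof -
  have "bounded (csupp f)"
    using csupp_subset_cball[of f z R] assms(2) bounded_cball bounded_subset by blast
  then show ?thesis
    using assms(1) by (auto simp: Lip0_def csupp_def compact_eq_bounded_closed)
qed

lemma bump_Lip0: "0 < T \<Longrightarrow> bump z T \<in> Lip0"
  using bump_diff_le[of T z] bump_eq_0[of T z]
  by (intro Lip0I[of "1 / T" _ z "2 * T"] lipschitz_onI) (force simp: dist_real_def)+

text \<open>Compact support turns continuity into a sup bound. One constant serves both as Lipschitz
  constant and as sup bound.\<close>

lemma Lip0E:
  fixes f :: "'a::euclidean_space \<Rightarrow> 'b::real_normed_vector"
  assumes "f \<in> Lip0"
  obtains L R where "0 < L" "0 < R" "\<And>x y. norm (f x - f y) \<le> L * dist x y"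
    "\<And>x. norm (f x) \<le> L" "\<And>x. f x \<noteq> 0 \<Longrightarrow> norm x < R" "csupp f \<subseteq> ball 0 R" "continuous_on UNIV f"
proof -
  obtain L where L: "L-lipschitz_on UNIV f" and c: "compact (csupp f)"
    using assms by (auto simp: Lip0_def)
  have cont: "continuous_on UNIV f" using L by (rule lipschitz_on_continuous_on)
  obtain R where R: "0 < R" "csupp f \<subseteq> ball 0 R"
    using compact_imp_bounded[OF c] bounded_subset_ballD by blast
  have ss: "x \<in> csupp f" if "f x \<noteq> 0" for x
    using that closure_subset[of "{x. f x \<noteq> 0}"] by (auto simp: csupp_def)
  have "compact (f ` csupp f)"
    using cont c continuous_on_subset by (intro compact_continuous_image) blast+
  then obtain C where C: "\<And>x. x \<in> csupp f \<Longrightarrow> norm (f x) \<le> C"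
    using compact_imp_bounded bounded_iff by (metis image_eqI)
  define L' where "L' = \<bar>L\<bar> + \<bar>C\<bar> + 1"
  show ?thesis
  proof (rule that[of L' R])
    fix x y
    have "norm (f x - f y) \<le> L * dist x y"
      using lipschitz_onD[OF L, of x y] by (simp add: dist_norm)
    also have "\<dots> \<le> L' * dist x y" by (intro mult_right_mono) (auto simp: L'_def)
    finally show "norm (f x - f y) \<le> L' * dist x y" .
    show "norm (f x) \<le> L'"
    proof (cases "f x = 0")
      case False
      then show ?thesis using C[OF ss[OF False]] by (simp add: L'_def)
    qed (simp add: L'_def)
    show "norm x < R" if "f x \<noteq> 0" using ss[OF that] R by auto
  qed (use R cont in \<open>auto simp: L'_def\<close>)
qed

section \<open>First consequences of the growth condition\<close>

locale nice_measure =
  fixes \<mu> :: "'a::euclidean_space measure" and s \<Lambda> :: real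
  assumes sets_mu [measurable_cong]: "sets \<mu> = sets borel"
    and nice: "nice s \<Lambda> \<mu>"
    and s_pos: "0 < s" and \<Lambda>_pos: "0 < \<Lambda>"
begin

lemma emeasure_ball_le: "0 < r \<Longrightarrow> emeasure \<mu> (ball x r) \<le> ennreal (\<Lambda> * r powr s)"
  using nice by (auto simp: nice_def)

lemma space_mu [simp]: "space \<mu> = UNIV"
  using sets_eq_imp_space_eq[OF sets_mu] by simp

lemma emeasure_ball_finite: "emeasure \<mu> (ball x r) < \<infinity>"
proof (cases "0 < r")
  case True
  then show ?thesis using emeasure_ball_le[of r x] by (simp add: le_less_trans[OF _ ennreal_less_top])
next
  case False
  then have "ball x r = {}" by (simp add: ball_empty)
  then show ?thesis by (simp del: ball_eq_empty)
qed

lemma sigma_finite_mu: "sigma_finite_measure \<mu>"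
proof (rule sigma_finite_measure.intro, intro exI conjI)
  show "countable (range (\<lambda>n. ball (0::'a) (real n)))" by auto
  have "x \<in> \<Union> (range (\<lambda>n. ball (0::'a) (real n)))" for x
    using reals_Archimedean2[of "norm x"] by auto
  then show "\<Union> (range (\<lambda>n. ball (0::'a) (real n))) = space \<mu>" by auto
  show "\<forall>a\<in>range (\<lambda>n. ball (0::'a) (real n)). emeasure \<mu> a \<noteq> \<infinity>"
    using emeasure_ball_finite by (auto simp: less_top[symmetric])
qed (auto simp: sets_mu)

sublocale sigma_finite_measure \<mu> by (rule sigma_finite_mu)

sublocale pair_sigma_finite \<mu> \<mu> by (intro pair_sigma_finite.intro sigma_finite_mu)

text \<open>The bound \<open>\<Lambda> * r powr s\<close> tends to \<open>0\<close> with
  \<open>r\<close> since \<open>0 < s\<close>; the radius below solves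
  \<open>\<Lambda> * r powr s = e\<close>. Hence the value of a kernel at the origin never affects
  an integral over \<mu>.\<close>

lemma emeasure_singleton: "emeasure \<mu> {x} = 0"
proof -
  have "emeasure \<mu> {x} \<le> ennreal e" if e: "0 < e" for e
  proof -
    define r where "r = (e / \<Lambda>) powr (1 / s)"
    have r: "0 < r" "\<Lambda> * r powr s = e" using e \<Lambda>_pos s_pos by (auto simp: r_def powr_powr)
    have "emeasure \<mu> {x} \<le> emeasure \<mu> (ball x r)"
      using r(1) by (intro emeasure_mono) (auto simp: sets_mu)
    then show ?thesis using emeasure_ball_le[OF r(1), of x] r(2) by auto
  qed
  then have "emeasure \<mu> {x} \<le> 0" using ennreal_le_epsilon[of 0 "emeasure \<mu> {x}"] by simp
  then show ?thesis by simp
qed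

lemma AE_neq: "AE y in \<mu>. y \<noteq> x"
  by (rule AE_I[of _ _ "{x}"]) (auto simp: emeasure_singleton sets_mu)

lemma nn_integral_pair:
  assumes "h \<in> borel_measurable (\<mu> \<Otimes>\<^sub>M \<mu>)"
  shows "integral\<^sup>N (\<mu> \<Otimes>\<^sub>M \<mu>) h = (\<integral>\<^sup>+x. \<integral>\<^sup>+y. h (x, y) \<partial>\<mu> \<partial>\<mu>)"
  by (rule sigma_finite_measure.nn_integral_fst[OF sigma_finite_mu assms, symmetric])

text \<open>Symmetry of \<open>W\<close> and Tonelli make the contributions of \<open>g x\<close>
  and \<open>g y\<close> equal. Double integrals near the diagonal thus reduce to the one-variable
  integrals of \<open>W x\<close>, which are potentials.\<close>

lemma nn_integral_symmetric_le:
  assumes [measurable]: "(\<lambda>p. W (fst p) (snd p)) \<in> borel_measurable (\<mu> \<Otimes>\<^sub>M \<mu>)" "g \<in> borel_measurable \<mu>"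
    and sym: "\<And>x y. W x y = W y x"
    and le: "\<And>x y. F (x, y) \<le> W x y * (g x + g y :: ennreal)"
  shows "(\<integral>\<^sup>+p. F p \<partial>(\<mu> \<Otimes>\<^sub>M \<mu>)) \<le> 2 * (\<integral>\<^sup>+x. g x * (\<integral>\<^sup>+y. W x y \<partial>\<mu>) \<partial>\<mu>)"
proof -
  have W [measurable]: "(\<lambda>y. W x y) \<in> borel_measurable \<mu>" for x
    using measurable_compose[OF measurable_Pair1' assms(1), of x] by simp
  let ?I = "\<integral>\<^sup>+x. g x * (\<integral>\<^sup>+y. W x y \<partial>\<mu>) \<partial>\<mu>"
  have 1: "(\<integral>\<^sup>+p. W (fst p) (snd p) * g (fst p) \<partial>(\<mu> \<Otimes>\<^sub>M \<mu>)) = ?I"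
    by (simp add: nn_integral_pair nn_integral_cmult mult.commute[of _ "g _"])
  have 2: "(\<integral>\<^sup>+p. W (fst p) (snd p) * g (snd p) \<partial>(\<mu> \<Otimes>\<^sub>M \<mu>)) = ?I"
  proof -
    have "(\<integral>\<^sup>+x. W x y * g y \<partial>\<mu>) = (\<integral>\<^sup>+x. g y * W y x \<partial>\<mu>)" for y
      by (rule nn_integral_cong) (subst sym, rule mult.commute)
    moreover have "(\<integral>\<^sup>+x. g y * W y x \<partial>\<mu>) = g y * (\<integral>\<^sup>+x. W y x \<partial>\<mu>)" for y
      by (rule nn_integral_cmult) simp
    ultimately have "(\<integral>\<^sup>+x. W x y * g y \<partial>\<mu>) = g y * (\<integral>\<^sup>+x. W y x \<partial>\<mu>)" for y by metis
    then show ?thesis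
      using nn_integral_snd[where f = "\<lambda>p. W (fst p) (snd p) * g (snd p)"] by simp
  qed
  have "(\<integral>\<^sup>+p. F p \<partial>(\<mu> \<Otimes>\<^sub>M \<mu>))
      \<le> (\<integral>\<^sup>+p. W (fst p) (snd p) * g (fst p) + W (fst p) (snd p) * g (snd p) \<partial>(\<mu> \<Otimes>\<^sub>M \<mu>))"
  proof (rule nn_integral_mono)
    fix p :: "'a \<times> 'a"
    show "F p \<le> W (fst p) (snd p) * g (fst p) + W (fst p) (snd p) * g (snd p)"
      using le[of "fst p" "snd p"] by (simp add: distrib_left)
  qed
  also have "\<dots> = ?I + ?I" by (subst nn_integral_add) (auto simp: 1 2)
  finally show ?thesis by (simp add: mult_2)
qed

text \<open>On the ball the Riesz kernel is at least \<open>R powr (- s)\<close>, apart from the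
  centre, which is a null set.\<close>

lemma emeasure_ball_le_potential:
  assumes R: "0 < R"
  shows "emeasure \<mu> (ball x R) \<le> ennreal (R powr s) * potential s \<mu> R x"
proof -
  have "emeasure \<mu> (ball x R) = (\<integral>\<^sup>+y. indicator (ball x R) y \<partial>\<mu>)"
    by (simp add: sets_mu)
  also have "\<dots> \<le> (\<integral>\<^sup>+y. ennreal (R powr s) * (ennreal (dist x y powr (- s)) * indicator (ball x R) y) \<partial>\<mu>)"
  proof (rule nn_integral_mono_AE, rule AE_mp[OF AE_neq[of x]], rule AE_I2, rule impI)
    fix y assume y: "y \<noteq> x"
    show "(indicator (ball x R) y :: ennreal)
        \<le> ennreal (R powr s) * (ennreal (dist x y powr (- s)) * indicator (ball x R) y)"
    proof (cases "dist x y < R")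
      case True
      have "1 = R powr s * R powr (- s)" using R by (simp add: powr_minus)
      also have "\<dots> \<le> R powr s * dist x y powr (- s)"
        using True y s_pos by (intro mult_left_mono powr_mono2') auto
      finally show ?thesis using True by (simp flip: ennreal_mult ennreal_1)
    qed simp
  qed
  also have "\<dots> = ennreal (R powr s) * potential s \<mu> R x"
    unfolding potential_def by (subst nn_integral_cmult) auto
  finally show ?thesis .
qed

lemma integrable_bounded_support:
  fixes f :: "'a \<Rightarrow> 'b::{banach, second_countable_topology}"
  assumes [measurable]: "f \<in> borel_measurable borel" and "\<And>y. norm (f y) \<le> C"
    and "\<And>y. f y \<noteq> 0 \<Longrightarrow> norm y < R"
  shows "integrable \<mu> f"
proof (rule integrableI_bounded_set[of "ball 0 R" _ _ C])
  show "AE x in \<mu>. x \<notin> ball 0 R \<longrightarrow> f x = 0" using assms(3) by (intro AE_I2) auto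
qed (use assms emeasure_ball_finite in auto)

lemma Lip0_measurable:
  fixes f :: "'a \<Rightarrow> 'b::{banach, second_countable_topology}"
  shows "f \<in> Lip0 \<Longrightarrow> f \<in> borel_measurable borel"
  by (elim Lip0E) (rule borel_measurable_continuous_onI)

lemma Lip0_integrable:
  fixes f :: "'a \<Rightarrow> 'b::{banach, second_countable_topology}"
  assumes "f \<in> Lip0"
  shows "integrable \<mu> f"
  using assms by (elim Lip0E) (rule integrable_bounded_support[OF Lip0_measurable[OF assms]])

end

section \<open>Energies of bump functions\<close>

text \<open>A truncated fractional seminorm. It dominates twice the modulus of the near-diagonal
  part of the bilinear form, see \<open>near_form_le\<close>.\<close>

definition energy :: "real \<Rightarrow> real \<Rightarrow> 'a::euclidean_space measure \<Rightarrow> ('a \<Rightarrow> real) \<Rightarrow> ennreal" where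
  "energy s \<delta> \<mu> f = (\<integral>\<^sup>+p. ennreal (dist (fst p) (snd p) powr (- s) * \<bar>f (snd p) - f (fst p)\<bar>)
     * indicator {p. dist (fst p) (snd p) < \<delta>} p \<partial>(\<mu> \<Otimes>\<^sub>M \<mu>))"

context nice_measure
begin

lemma potential_eq:
  "potential s \<mu> \<delta> x = (\<integral>\<^sup>+y. ennreal (dist x y powr (- s)) * indicator {..<\<delta>} (dist x y) \<partial>\<mu>)"
  unfolding potential_def by (intro nn_integral_cong) (auto simp: indicator_def)

lemma potential_le:
  assumes "0 < \<delta>" "0 \<le> A" and q: "s < q"
    and "\<And>t. 0 < t \<Longrightarrow> t \<le> \<delta> \<Longrightarrow> emeasure \<mu> (ball x t) \<le> ennreal (A * t powr q)"
  shows "potential s \<mu> \<delta> x \<le> ennreal (2 powr s / (1 - 2 powr (s - q)) * A * \<delta> powr (q - s))"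
  unfolding potential_def
  using nn_integral_dist_powr_ball_le[OF sets_mu assms(1) q assms(2,4)] s_pos by simp

text \<open>Uses only \<open>\<bar>b y - b x\<bar> \<le> b x + b y\<close>, no cancellation. This
  suffices where the density of the measure is small at every scale up to \<delta>, since the
  potential is then small on the support of \<open>b\<close>.\<close>

lemma energy_le_potential:
  assumes b: "b \<in> borel_measurable borel" "\<And>y. 0 \<le> b y" "integrable \<mu> b" and Q: "0 \<le> Q"
    and pot: "\<And>y. b y \<noteq> 0 \<Longrightarrow> potential s \<mu> \<delta> y \<le> ennreal Q"
  shows "energy s \<delta> \<mu> b \<le> ennreal (2 * Q * (\<integral>y. b y \<partial>\<mu>))"
proof -
  note [measurable] = b(1)
  let ?W = "\<lambda>x y. ennreal (dist x y powr (- s)) * indicator {..<\<delta>} (dist x y)"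
  have "energy s \<delta> \<mu> b \<le> 2 * (\<integral>\<^sup>+x. ennreal (b x) * (\<integral>\<^sup>+y. ?W x y \<partial>\<mu>) \<partial>\<mu>)"
    unfolding energy_def
  proof (rule nn_integral_symmetric_le)
    fix x y
    have "\<bar>b y - b x\<bar> \<le> b x + b y" using b(2)[of x] b(2)[of y] by linarith
    then have "ennreal (dist x y powr (- s) * \<bar>b y - b x\<bar>) \<le> ennreal (dist x y powr (- s) * (b x + b y))"
      by (intro ennreal_leI mult_left_mono) auto
    also have "\<dots> = ennreal (dist x y powr (- s)) * (ennreal (b x) + ennreal (b y))"
      using b(2) by (simp add: ennreal_mult ennreal_plus)
    finally show "ennreal (dist (fst (x, y)) (snd (x, y)) powr (- s) * \<bar>b (snd (x, y)) - b (fst (x, y))\<bar>)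
        * indicator {p. dist (fst p) (snd p) < \<delta>} (x, y) \<le> ?W x y * (ennreal (b x) + ennreal (b y))"
      by (auto simp: indicator_def)
  qed (auto simp: dist_commute)
  also have "(\<integral>\<^sup>+x. ennreal (b x) * (\<integral>\<^sup>+y. ?W x y \<partial>\<mu>) \<partial>\<mu>) \<le> (\<integral>\<^sup>+x. ennreal (b x) * ennreal Q \<partial>\<mu>)"
  proof (rule nn_integral_mono)
    fix x
    show "ennreal (b x) * (\<integral>\<^sup>+y. ?W x y \<partial>\<mu>) \<le> ennreal (b x) * ennreal Q"
    proof (cases "b x = 0")
      case False
      then show ?thesis using pot[of x] by (intro mult_left_mono) (auto simp: potential_eq)
    qed simp
  qed
  also have "\<dots> = ennreal (\<integral>y. b y \<partial>\<mu>) * ennreal Q"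
    using b by (simp add: nn_integral_multc nn_integral_eq_integral)
  also have "2 * \<dots> = ennreal (2 * Q * (\<integral>y. b y \<partial>\<mu>))"
    using b(2) Q by (simp add: ennreal_mult'' integral_nonneg_AE mult_ac ennreal_mult)
  finally show ?thesis by (simp add: mult_left_mono)
qed

text \<open>Here the smoothness of the bump counts: the difference is at most
  \<open>min 1 (dist x y / T)\<close> and vanishes unless one of the points lies in
  \<open>ball z (2 * T)\<close>. Doubling replaces the mass of that ball by \<open>D\<close> times
  the integral of the bump, so the bound survives normalisation.\<close>

lemma energy_bump_le:
  assumes T: "0 < T" and Q: "0 \<le> Q"
    and pot: "\<And>y. y \<in> ball z (2 * T) \<Longrightarrow>
      (\<integral>\<^sup>+x. ennreal (dist y x powr (- s) * min 1 (dist y x / T)) * indicator {..<\<delta>} (dist y x) \<partial>\<mu>)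
        \<le> ennreal Q"
    and dbl: "emeasure \<mu> (ball z (2 * T)) \<le> ennreal D * emeasure \<mu> (ball z T)" and D: "0 \<le> D"
  shows "energy s \<delta> \<mu> (bump z T) \<le> ennreal (2 * D * Q * (\<integral>y. bump z T y \<partial>\<mu>))"
proof -
  let ?W = "\<lambda>x y. ennreal (dist x y powr (- s) * min 1 (dist x y / T)) * indicator {..<\<delta>} (dist x y)"
  let ?g = "indicator (ball z (2 * T)) :: 'a \<Rightarrow> ennreal"
  have b: "integrable \<mu> (bump z T)" using T by (intro Lip0_integrable bump_Lip0)
  have "energy s \<delta> \<mu> (bump z T) \<le> 2 * (\<integral>\<^sup>+x. ?g x * (\<integral>\<^sup>+y. ?W x y \<partial>\<mu>) \<partial>\<mu>)"
    unfolding energy_def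
  proof (rule nn_integral_symmetric_le)
    fix x y
    have "ennreal (dist x y powr (- s) * \<bar>bump z T y - bump z T x\<bar>)
        \<le> ennreal (dist x y powr (- s) * min 1 (dist x y / T)) * (?g x + ?g y)"
    proof (cases "x \<in> ball z (2 * T) \<or> y \<in> ball z (2 * T)")
      case True
      have "\<bar>bump z T y - bump z T x\<bar> \<le> min 1 (dist x y / T)"
        using bump_diff_le[OF T, of z y x] bump_nonneg[of z T x] bump_nonneg[of z T y]
          bump_le_1[of z T x] bump_le_1[of z T y] by (auto simp: dist_commute)
      then have "ennreal (dist x y powr (- s) * \<bar>bump z T y - bump z T x\<bar>)
          \<le> ennreal (dist x y powr (- s) * min 1 (dist x y / T)) * 1"
        by (simp add: ennreal_leI mult_left_mono)
      also have "\<dots> \<le> ennreal (dist x y powr (- s) * min 1 (dist x y / T)) * (?g x + ?g y)"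
        using True by (intro mult_left_mono) (auto simp: indicator_def)
      finally show ?thesis .
    qed (use T bump_eq_0[OF T, of z x] bump_eq_0[OF T, of z y] in auto)
    then show "ennreal (dist (fst (x, y)) (snd (x, y)) powr (- s) * \<bar>bump z T (snd (x, y)) - bump z T (fst (x, y))\<bar>)
        * indicator {p. dist (fst p) (snd p) < \<delta>} (x, y) \<le> ?W x y * (?g x + ?g y)"
      by (cases "dist x y < \<delta>") auto
  qed (auto simp: dist_commute)
  also have "(\<integral>\<^sup>+x. ?g x * (\<integral>\<^sup>+y. ?W x y \<partial>\<mu>) \<partial>\<mu>) \<le> (\<integral>\<^sup>+x. ennreal Q * ?g x \<partial>\<mu>)"
  proof (rule nn_integral_mono)
    fix x
    show "?g x * (\<integral>\<^sup>+y. ?W x y \<partial>\<mu>) \<le> ennreal Q * ?g x"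
      using pot[of x] by (cases "x \<in> ball z (2 * T)") auto
  qed
  also have "\<dots> = ennreal Q * emeasure \<mu> (ball z (2 * T))"
    by (simp add: nn_integral_cmult_indicator sets_mu)
  also have "\<dots> \<le> ennreal Q * (ennreal D * emeasure \<mu> (ball z T))"
    by (intro mult_left_mono dbl) auto
  also have "emeasure \<mu> (ball z T) = (\<integral>\<^sup>+y. indicator (ball z T) y \<partial>\<mu>)" by (simp add: sets_mu)
  also have "\<dots> \<le> (\<integral>\<^sup>+y. ennreal (bump z T y) \<partial>\<mu>)"
    using bump_eq_1[OF T, of z] by (intro nn_integral_mono) (auto simp: indicator_def)
  also have "\<dots> = ennreal (\<integral>y. bump z T y \<partial>\<mu>)"
    using b by (intro nn_integral_eq_integral) (auto simp: bump_nonneg)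
  also have "2 * (ennreal Q * (ennreal D * ennreal (\<integral>y. bump z T y \<partial>\<mu>)))
      = ennreal (2 * D * Q * (\<integral>y. bump z T y \<partial>\<mu>))"
    using Q D by (simp add: mult_ac bump_nonneg flip: ennreal_mult' ennreal_numeral)
  finally show ?thesis by (simp add: mult_left_mono)
qed

end

section \<open>Selection of a bump with small energy\<close>

definition energy_const :: "real \<Rightarrow> real \<Rightarrow> real \<Rightarrow> real" where
  "energy_const s c \<kappa> = 2 powr (s + 2) * (\<kappa> powr (- s) + 2 powr (s + 1)) * 3 powr (s + 1) * (5 powr s / c powr (s + 1))"

context nice_measure
begin

text \<open>Three ranges of \<open>dist y x\<close>. Below \<open>\<kappa> * T\<close> the factor
  \<open>dist y x / T\<close> and the growth bound give a multiple of
  \<open>\<Lambda> * \<kappa>\<close>; between \<open>\<kappa> * T\<close> and \<open>T\<close> the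
  kernel is at most \<open>(\<kappa> * T) powr (- s)\<close>; above \<open>T\<close> the density
  bound makes the dyadic sum converge. Densities below scale \<open>T\<close> cost only the term
  with \<open>\<Lambda> * \<kappa>\<close>, which can be made small.\<close>

lemma truncated_kernel_le:
  assumes T: "0 < T" "T \<le> \<delta>" and \<kappa>: "0 < \<kappa>" "\<kappa> \<le> 1" and B: "0 \<le> B"
    and ball: "\<And>t. T \<le> t \<Longrightarrow> t \<le> \<delta> \<Longrightarrow> emeasure \<mu> (ball y t) \<le> ennreal (B / \<delta> * t powr (s + 1))"
  shows "(\<integral>\<^sup>+x. ennreal (dist y x powr (- s) * min 1 (dist y x / T)) * indicator {..<\<delta>} (dist y x) \<partial>\<mu>)
    \<le> ennreal (2 powr (\<bar>s - 1\<bar> + 1) * \<Lambda> * \<kappa> + (\<kappa> powr (- s) + 2 powr (s + 1)) * B)"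
proof -
  let ?f1 = "\<lambda>x. ennreal (1 / T) * (ennreal (dist y x powr (- (s - 1))) * indicator (ball y (\<kappa> * T)) x)"
  let ?f2 = "\<lambda>x. ennreal ((\<kappa> * T) powr (- s)) * indicator (ball y T) x"
  let ?f3 = "\<lambda>x. ennreal (dist y x powr (- s)) * indicator (ball y \<delta>) x * indicator (- ball y T) x"
  have \<delta>: "0 < \<delta>" using T by simp
  have \<kappa>T: "0 < \<kappa> * T" using T \<kappa> by simp
  have pw: "ennreal (dist y x powr (- s) * min 1 (dist y x / T)) * indicator {..<\<delta>} (dist y x)
      \<le> ?f1 x + ?f2 x + ?f3 x" for x
  proof -
    consider "dist y x < \<kappa> * T" | "\<kappa> * T \<le> dist y x" "dist y x < T"
      | "T \<le> dist y x" "dist y x < \<delta>" | "\<delta> \<le> dist y x" by linarith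
    then show ?thesis
    proof cases
      case 1
      have "dist y x powr (- s) * min 1 (dist y x / T) \<le> dist y x powr (- s) * (dist y x / T)"
        by (intro mult_left_mono) auto
      also have "\<dots> = 1 / T * dist y x powr (- (s - 1))"
        by (cases "y = x") (auto simp: powr_diff powr_minus field_simps)
      finally have "ennreal (dist y x powr (- s) * min 1 (dist y x / T)) \<le> ?f1 x"
        using 1 T by (simp add: ennreal_leI flip: ennreal_mult')
      then show ?thesis by (auto simp: indicator_def add_increasing2)
    next
      case 2
      have "dist y x powr (- s) * min 1 (dist y x / T) \<le> dist y x powr (- s) * 1"
        by (intro mult_left_mono) auto
      also have "\<dots> \<le> (\<kappa> * T) powr (- s)" using 2 \<kappa>T s_pos by (simp add: powr_mono2')
      finally have "ennreal (dist y x powr (- s) * min 1 (dist y x / T)) \<le> ?f2 x"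
        using 2 by (simp add: ennreal_leI)
      also have "\<dots> \<le> ?f1 x + ?f2 x + ?f3 x" by (simp add: add_increasing add_increasing2)
      finally show ?thesis using 2 T by simp
    next
      case 3
      have "dist y x powr (- s) * min 1 (dist y x / T) \<le> dist y x powr (- s) * 1"
        by (intro mult_left_mono) auto
      then have "ennreal (dist y x powr (- s) * min 1 (dist y x / T)) \<le> ?f3 x"
        using 3 by (simp add: ennreal_leI)
      also have "\<dots> \<le> ?f1 x + ?f2 x + ?f3 x" by (simp add: add_increasing)
      finally show ?thesis using 3 by simp
    qed simp
  qed
  have I1: "(\<integral>\<^sup>+x. ?f1 x \<partial>\<mu>) \<le> ennreal (2 powr (\<bar>s - 1\<bar> + 1) * \<Lambda> * \<kappa>)"
  proof -
    have "(\<integral>\<^sup>+x. ?f1 x \<partial>\<mu>) = ennreal (1 / T) *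
        (\<integral>\<^sup>+x. ennreal (dist y x powr (- (s - 1))) * indicator (ball y (\<kappa> * T)) x \<partial>\<mu>)"
      by (rule nn_integral_cmult) measurable
    \<comment> \<open>The kernel exponent is now \<open>s - 1\<close>, so the gap to the growth
      exponent is \<open>1\<close> and the geometric series sums to \<open>2\<close>.\<close>
    also have "\<dots> \<le> ennreal (1 / T) *
        ennreal (2 powr \<bar>s - 1\<bar> / (1 - 2 powr (s - 1 - s)) * \<Lambda> * (\<kappa> * T) powr (s - (s - 1)))"
      using \<kappa>T \<Lambda>_pos emeasure_ball_le
      by (intro mult_left_mono nn_integral_dist_powr_ball_le) (auto simp: sets_mu)
    also have "\<dots> = ennreal (1 / T * (2 powr \<bar>s - 1\<bar> / (1 - 2 powr (s - 1 - s)) * \<Lambda> * (\<kappa> * T) powr (s - (s - 1))))"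
      using T by (intro ennreal_mult'[symmetric]) auto
    also have "1 / T * (2 powr \<bar>s - 1\<bar> / (1 - 2 powr (s - 1 - s)) * \<Lambda> * (\<kappa> * T) powr (s - (s - 1)))
        = 2 powr (\<bar>s - 1\<bar> + 1) * \<Lambda> * \<kappa>"
      using T \<kappa>T by (simp add: powr_add powr_minus_divide)
    finally show ?thesis .
  qed
  have I2: "(\<integral>\<^sup>+x. ?f2 x \<partial>\<mu>) \<le> ennreal (\<kappa> powr (- s) * B)"
  proof -
    have "(\<integral>\<^sup>+x. ?f2 x \<partial>\<mu>) = ennreal ((\<kappa> * T) powr (- s)) * emeasure \<mu> (ball y T)"
      by (simp add: nn_integral_cmult_indicator sets_mu)
    also have "\<dots> \<le> ennreal ((\<kappa> * T) powr (- s)) * ennreal (B / \<delta> * T powr (s + 1))"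
      using T by (intro mult_left_mono ball) auto
    also have "\<dots> = ennreal ((\<kappa> * T) powr (- s) * (B / \<delta> * T powr (s + 1)))"
      by (intro ennreal_mult'[symmetric]) auto
    also have "(\<kappa> * T) powr (- s) * (B / \<delta> * T powr (s + 1)) = \<kappa> powr (- s) * B * (T / \<delta>)"
      using T \<kappa> by (simp add: powr_mult powr_add powr_minus field_simps)
    also have "\<dots> \<le> \<kappa> powr (- s) * B * 1"
      using T B \<delta> by (intro mult_left_mono) auto
    finally show ?thesis by (simp add: ennreal_leI)
  qed
  have I3: "(\<integral>\<^sup>+x. ?f3 x \<partial>\<mu>) \<le> ennreal (2 powr (s + 1) * B)"
  proof -
    \<comment> \<open>Removing \<open>ball y T\<close> makes all balls of radius below
      \<open>T\<close> null, so the density bound holds at every scale up to \<delta> and the dyadic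
      estimate applies with exponent \<open>s + 1\<close>.\<close>
    define N where "N = density \<mu> (indicator (- ball y T))"
    have N: "sets N = sets borel" by (simp add: N_def sets_mu)
    have mb: "- ball y T \<in> sets \<mu>" by (auto simp: sets_mu)
    have mb': "ball y t \<in> sets \<mu>" for t by (auto simp: sets_mu)
    have eN: "emeasure N (ball y t) = emeasure \<mu> (- ball y T \<inter> ball y t)" for t
      unfolding N_def using mb mb'[of t]
      by (subst emeasure_density) (auto simp: indicator_inter_arith[symmetric] simp flip: nn_integral_indicator)
    have "(\<integral>\<^sup>+x. ?f3 x \<partial>\<mu>) = (\<integral>\<^sup>+x. ennreal (dist y x powr (- s)) * indicator (ball y \<delta>) x \<partial>N)"
      unfolding N_def by (subst nn_integral_density) (auto simp: mult_ac mb)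
    also have "\<dots> \<le> ennreal (2 powr \<bar>s\<bar> / (1 - 2 powr (s - (s + 1))) * (B / \<delta>) * \<delta> powr (s + 1 - s))"
    proof (rule nn_integral_dist_powr_ball_le[OF N \<delta>])
      fix t assume t: "0 < t" "t \<le> \<delta>"
      show "emeasure N (ball y t) \<le> ennreal (B / \<delta> * t powr (s + 1))"
      proof (cases "T \<le> t")
        case True
        have "emeasure N (ball y t) \<le> emeasure \<mu> (ball y t)"
          unfolding eN by (intro emeasure_mono) (auto simp: sets_mu)
        then show ?thesis using ball[OF True t(2)] by simp
      next
        case False
        then have "- ball y T \<inter> ball y t = {}" by auto
        then show ?thesis by (simp add: eN)
      qed
    qed (use B \<delta> in auto)
    also have "2 powr \<bar>s\<bar> / (1 - 2 powr (s - (s + 1))) * (B / \<delta>) * \<delta> powr (s + 1 - s) = 2 powr (s + 1) * B"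
      using \<delta> s_pos by (simp add: powr_add powr_minus_divide)
    finally show ?thesis .
  qed
  have "(\<integral>\<^sup>+x. ennreal (dist y x powr (- s) * min 1 (dist y x / T)) * indicator {..<\<delta>} (dist y x) \<partial>\<mu>)
      \<le> (\<integral>\<^sup>+x. ?f1 x + ?f2 x + ?f3 x \<partial>\<mu>)"
    by (intro nn_integral_mono pw)
  also have "\<dots> = (\<integral>\<^sup>+x. ?f1 x \<partial>\<mu>) + (\<integral>\<^sup>+x. ?f2 x \<partial>\<mu>) + (\<integral>\<^sup>+x. ?f3 x \<partial>\<mu>)"
    by (simp add: nn_integral_add)
  also have "\<dots> \<le> ennreal (2 powr (\<bar>s - 1\<bar> + 1) * \<Lambda> * \<kappa>) + ennreal (\<kappa> powr (- s) * B) + ennreal (2 powr (s + 1) * B)"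
    by (intro add_mono I1 I2 I3)
  also have "\<dots> = ennreal (2 powr (\<bar>s - 1\<bar> + 1) * \<Lambda> * \<kappa> + (\<kappa> powr (- s) + 2 powr (s + 1)) * B)"
    using B \<kappa> \<Lambda>_pos by (simp add: distrib_right add.assoc flip: ennreal_plus)
  finally show ?thesis .
qed

text \<open>A stopping-scale argument. Call a ball heavy when its mass exceeds
  \<open>A / \<delta> * t powr (s + 1)\<close>; the threshold has one power of \<open>t\<close> more
  than the growth bound, so a lack of heavy balls makes dyadic sums converge. Without heavy balls
  around \<open>x0\<close> the crude energy bound applies to a bump there; otherwise the bump sits
  on a heavy ball of nearly maximal radius.\<close>

lemma exists_bump_energy_le:
  assumes c: "0 < c" "c \<le> 1" and \<delta>: "0 < \<delta>" and \<kappa>: "0 < \<kappa>" "\<kappa> \<le> 1"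
    and x0: "dist x x0 < c * \<delta>" and charged: "emeasure \<mu> (ball x0 (c * \<delta>)) \<noteq> 0"
    and P: "potential s \<mu> (5 * \<delta>) x = ennreal P" "0 \<le> P"
  obtains z T where "0 < T" "ball z (2 * T) \<subseteq> ball x (4 * c * \<delta>)" "0 < (\<integral>y. bump z T y \<partial>\<mu>)"
    "energy s \<delta> \<mu> (bump z T) \<le> ennreal ((2 powr (s + 2) * 2 powr (\<bar>s - 1\<bar> + 1) * \<Lambda> * \<kappa> + energy_const s c \<kappa> * P)
       * (\<integral>y. bump z T y \<partial>\<mu>))"
proof -
  \<comment> \<open>Chosen so that \<open>A / \<delta> * (c * \<delta>) powr (s + 1) = (5 *
    \<delta>) powr s * P\<close>, an upper bound for the mass of
    \<open>ball x (5 * \<delta>)\<close>. This forces heavy balls to have radius below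
    \<open>c * \<delta>\<close>.\<close>
  define A where "A = 5 powr s / c powr (s + 1) * P"
  \<comment> \<open>The bound of \<open>truncated_kernel_le\<close> for
    \<open>B = 3 powr (s + 1) * A\<close>.\<close>
  define Q where "Q = 2 powr (\<bar>s - 1\<bar> + 1) * \<Lambda> * \<kappa> + (\<kappa> powr (- s) + 2 powr (s + 1)) * (3 powr (s + 1) * A)"
  have A: "0 \<le> A" using P by (simp add: A_def)
  have Q: "0 \<le> Q" using A \<Lambda>_pos \<kappa> by (simp add: Q_def)
  \<comment> \<open>The factors of \<open>energy_const\<close>: \<open>2 powr (s + 2)\<close> from
    the doubling constant and the symmetric double integral, the next from the kernel bound,
    \<open>3 powr (s + 1)\<close> from recentring balls at \<open>z\<close>, the last from
    \<open>A\<close>.\<close>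
  have Q_eq: "2 powr (s + 2) * Q = 2 powr (s + 2) * 2 powr (\<bar>s - 1\<bar> + 1) * \<Lambda> * \<kappa> + energy_const s c \<kappa> * P"
    by (simp add: Q_def energy_const_def A_def algebra_simps add_divide_distrib)
  \<comment> \<open>Radii up to \<open>3 * \<delta>\<close> occur because balls of radius up to
    \<delta> will be recentred with triple radius; two shifts by at most
    \<open>c * \<delta> \<le> \<delta>\<close> then explain the radius \<open>5 * \<delta>\<close>
    of the potential.\<close>
  have large: "emeasure \<mu> (ball z t) \<le> ennreal (A / \<delta> * t powr (s + 1))"
    if z: "z \<in> ball x0 (c * \<delta>)" and t: "c * \<delta> \<le> t" "t \<le> 3 * \<delta>" for z t
  proof -
    have "ball z t \<subseteq> ball x (5 * \<delta>)"
    proof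
      fix w assume "w \<in> ball z t"
      moreover have "c * \<delta> \<le> \<delta>" using c \<delta> by simp
      ultimately show "w \<in> ball x (5 * \<delta>)"
        using dist_triangle[of x w x0] dist_triangle[of x0 w z] z x0 t by simp
    qed
    then have "emeasure \<mu> (ball z t) \<le> emeasure \<mu> (ball x (5 * \<delta>))"
      by (intro emeasure_mono) (auto simp: sets_mu)
    also have "\<dots> \<le> ennreal ((5 * \<delta>) powr s) * ennreal P"
      using emeasure_ball_le_potential[of "5 * \<delta>" x] \<delta> P(1) by simp
    also have "\<dots> = ennreal ((5 * \<delta>) powr s * P)" by (simp add: ennreal_mult')
    also have "(5 * \<delta>) powr s * P = A / \<delta> * (c * \<delta>) powr (s + 1)"
      using c \<delta> by (simp add: A_def powr_mult powr_add field_simps)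
    also have "\<dots> \<le> A / \<delta> * t powr (s + 1)"
      using A c \<delta> t s_pos by (intro mult_left_mono powr_mono2) auto
    finally show ?thesis by (simp add: ennreal_leI)
  qed
  show ?thesis
  proof (cases "\<exists>z\<in>ball x0 (c * \<delta>). \<exists>t>0. t \<le> 3 * \<delta> \<and> ennreal (A / \<delta> * t powr (s + 1)) < emeasure \<mu> (ball z t)")
    case False
    \<comment> \<open>With this \<open>T\<close> the bump is positive exactly on the charged ball
      \<open>ball x0 (c * \<delta>)\<close>, so its integral is positive.\<close>
    define T where "T = c * \<delta> / 2"
    have T: "0 < T" "2 * T = c * \<delta>" using c \<delta> by (auto simp: T_def)
    have b: "bump x0 T \<in> borel_measurable borel" "integrable \<mu> (bump x0 T)"
      using T by (auto intro: Lip0_measurable Lip0_integrable bump_Lip0)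
    have I: "0 < (\<integral>y. bump x0 T y \<partial>\<mu>)"
    proof -
      have "\<not> (AE y in \<mu>. bump x0 T y = 0)"
      proof
        assume "AE y in \<mu>. bump x0 T y = 0"
        then have "AE y in \<mu>. y \<notin> ball x0 (c * \<delta>)"
        proof eventually_elim
          case (elim y)
          then show ?case using bump_pos_iff[OF T(1), of x0 y] T(2) by auto
        qed
        then have "ball x0 (c * \<delta>) \<in> null_sets \<mu>"
          by (subst AE_iff_null_sets) (simp_all add: sets_mu)
        then show False using charged by (simp add: null_setsD1)
      qed
      then have "(\<integral>y. bump x0 T y \<partial>\<mu>) \<noteq> 0"
        using integral_nonneg_eq_0_iff_AE[OF b(2)] by (auto simp: bump_nonneg)
      moreover have "0 \<le> (\<integral>y. bump x0 T y \<partial>\<mu>)" by (simp add: bump_nonneg)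
      ultimately show ?thesis by simp
    qed
    have "energy s \<delta> \<mu> (bump x0 T) \<le> ennreal (2 * (2 powr (s + 1) * Q) * (\<integral>y. bump x0 T y \<partial>\<mu>))"
    proof (rule energy_le_potential[OF b(1) _ b(2)])
      fix y assume "bump x0 T y \<noteq> 0"
      then have y: "y \<in> ball x0 (c * \<delta>)"
        using bump_eq_0[OF T(1), of x0 y] T(2) by (auto simp: not_le[symmetric])
      have small: "emeasure \<mu> (ball y t) \<le> ennreal (A / \<delta> * t powr (s + 1))"
        if "0 < t" "t \<le> \<delta>" for t
      proof (rule leI, rule notI)
        assume "ennreal (A / \<delta> * t powr (s + 1)) < emeasure \<mu> (ball y t)"
        moreover have "t \<le> 3 * \<delta>" using that by linarith
        ultimately show False using False y that(1) by blast
      qed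
      have "potential s \<mu> \<delta> y \<le> ennreal (2 powr s / (1 - 2 powr (s - (s + 1))) * (A / \<delta>) * \<delta> powr (s + 1 - s))"
        using \<delta> A by (intro potential_le small) auto
      also have "2 powr s / (1 - 2 powr (s - (s + 1))) * (A / \<delta>) * \<delta> powr (s + 1 - s) = 2 powr (s + 1) * A"
        using \<delta> by (simp add: powr_add powr_minus_divide)
      \<comment> \<open>Passing from \<open>A\<close> to \<open>Q\<close> is wasteful, but gives
        both cases the same final constant.\<close>
      also have "\<dots> \<le> 2 powr (s + 1) * Q"
      proof (rule mult_left_mono)
        have "A \<le> 1 * (1 * A)" by simp
        also have "\<dots> \<le> (\<kappa> powr (- s) + 2 powr (s + 1)) * (3 powr (s + 1) * A)"
          using A s_pos ge_one_powr_ge_zero[of 2 "s + 1"] ge_one_powr_ge_zero[of 3 "s + 1"]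
          by (intro mult_mono) (auto intro: add_increasing)
        also have "\<dots> \<le> Q" using \<Lambda>_pos \<kappa> by (simp add: Q_def)
        finally show "A \<le> Q" .
      qed simp
      finally show "potential s \<mu> \<delta> y \<le> ennreal (2 powr (s + 1) * Q)" by (simp add: ennreal_leI)
    qed (use Q in \<open>auto simp: bump_nonneg\<close>)
    also have "2 * (2 powr (s + 1) * Q) = 2 powr (s + 2) * Q" by (simp add: powr_add)
    finally have "energy s \<delta> \<mu> (bump x0 T) \<le> ennreal (2 powr (s + 2) * Q * (\<integral>y. bump x0 T y \<partial>\<mu>))" .
    moreover have "ball x0 (2 * T) \<subseteq> ball x (4 * c * \<delta>)"
    proof
      fix w assume "w \<in> ball x0 (2 * T)"
      then show "w \<in> ball x (4 * c * \<delta>)" using dist_triangle[of x w x0] x0 T c \<delta> by simp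
    qed
    ultimately show ?thesis using that[of T x0] T(1) I by (simp only: Q_eq)
  next
    case True
    then obtain z t0 where z: "z \<in> ball x0 (c * \<delta>)" and t0: "0 < t0" "t0 \<le> 3 * \<delta>"
      "ennreal (A / \<delta> * t0 powr (s + 1)) < emeasure \<mu> (ball z t0)" by blast
    define S where "S = {t. 0 < t \<and> t \<le> 3 * \<delta> \<and> ennreal (A / \<delta> * t powr (s + 1)) < emeasure \<mu> (ball z t)}"
    have S: "t0 \<in> S" "bdd_above S" using t0 by (auto simp: S_def intro!: bdd_aboveI[of _ "3 * \<delta>"])
    have "0 < Sup S" using cSup_upper[OF S] t0 by linarith
    then have "Sup S / 2 < Sup S" by simp
    \<comment> \<open>The supremum need not be attained. A heavy radius above half of it suffices:
      every \<open>t \<ge> 2 * T\<close> then exceeds the supremum and is not heavy.\<close>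
    then obtain T where T: "T \<in> S" "Sup S / 2 < T" using S less_cSup_iff[of S "Sup S / 2"] by auto
    have T0: "0 < T" using T by (simp add: S_def)
    have Tc: "T < c * \<delta>" using large[OF z, of T] T(1) by (force simp: S_def not_le[symmetric])
    have T\<delta>: "T \<le> \<delta>" using Tc c \<delta> by (smt (verit) mult_left_le_one_le)
    have after: "emeasure \<mu> (ball z t) \<le> ennreal (A / \<delta> * t powr (s + 1))" if "2 * T \<le> t" "t \<le> 3 * \<delta>" for t
    proof (rule ccontr)
      assume "\<not> ?thesis"
      then have "t \<in> S" using that T0 by (auto simp: S_def)
      then show False using cSup_upper[of t S] S T(2) that by simp
    qed
    \<comment> \<open>Radius \<open>T\<close> is heavy and \<open>2 * T\<close> is not, so the
      masses compare at worst like the two thresholds, whose ratio is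
      \<open>2 powr (s + 1)\<close>.\<close>
    have dbl: "emeasure \<mu> (ball z (2 * T)) \<le> ennreal (2 powr (s + 1)) * emeasure \<mu> (ball z T)"
    proof -
      have "emeasure \<mu> (ball z (2 * T)) \<le> ennreal (A / \<delta> * (2 * T) powr (s + 1))"
        using T\<delta> T0 by (intro after) auto
      also have "\<dots> = ennreal (2 powr (s + 1)) * ennreal (A / \<delta> * T powr (s + 1))"
        using T0 by (simp add: powr_mult mult_ac flip: ennreal_mult')
      also have "\<dots> \<le> ennreal (2 powr (s + 1)) * emeasure \<mu> (ball z T)"
        using T(1) by (intro mult_left_mono) (auto simp: S_def)
      finally show ?thesis .
    qed
    have "energy s \<delta> \<mu> (bump z T) \<le> ennreal (2 * 2 powr (s + 1) * Q * (\<integral>y. bump z T y \<partial>\<mu>))"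
    proof (rule energy_bump_le[OF T0 Q _ dbl])
      fix y assume y: "y \<in> ball z (2 * T)"
      show "(\<integral>\<^sup>+x. ennreal (dist y x powr (- s) * min 1 (dist y x / T)) * indicator {..<\<delta>} (dist y x) \<partial>\<mu>)
        \<le> ennreal Q" unfolding Q_def
      proof (rule truncated_kernel_le[OF T0 T\<delta> \<kappa>])
        fix t assume t: "T \<le> t" "t \<le> \<delta>"
        \<comment> \<open>Since \<open>t \<ge> T\<close>, the new radius satisfies
          \<open>3 * t \<ge> 2 * T\<close>, so the recentred ball is not heavy.\<close>
        have "ball y t \<subseteq> ball z (3 * t)"
        proof
          fix w assume "w \<in> ball y t"
          then show "w \<in> ball z (3 * t)" using dist_triangle[of z w y] y t by simp
        qed
        then have "emeasure \<mu> (ball y t) \<le> emeasure \<mu> (ball z (3 * t))"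
          by (intro emeasure_mono) (auto simp: sets_mu)
        also have "\<dots> \<le> ennreal (A / \<delta> * (3 * t) powr (s + 1))" using t T0 by (intro after) auto
        also have "A / \<delta> * (3 * t) powr (s + 1) = 3 powr (s + 1) * A / \<delta> * t powr (s + 1)"
          using t T0 by (simp add: powr_mult)
        finally show "emeasure \<mu> (ball y t) \<le> ennreal (3 powr (s + 1) * A / \<delta> * t powr (s + 1))" .
      qed (use A in auto)
    qed simp
    also have "2 * 2 powr (s + 1) * Q = 2 powr (s + 2) * Q" by (simp add: powr_add)
    finally have e: "energy s \<delta> \<mu> (bump z T) \<le> ennreal (2 powr (s + 2) * Q * (\<integral>y. bump z T y \<partial>\<mu>))" .
    have I: "0 < (\<integral>y. bump z T y \<partial>\<mu>)"
    proof -
      \<comment> \<open>Membership in \<open>S\<close> is a strict inequality, so a heavy ball has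
        positive mass.\<close>
      have "0 < emeasure \<mu> (ball z T)"
        using T(1) by (auto simp: S_def intro: le_less_trans[OF zero_le])
      also have "emeasure \<mu> (ball z T) = (\<integral>\<^sup>+y. indicator (ball z T) y \<partial>\<mu>)" by (simp add: sets_mu)
      also have "\<dots> \<le> (\<integral>\<^sup>+y. ennreal (bump z T y) \<partial>\<mu>)"
        using bump_eq_1[OF T0, of z] by (intro nn_integral_mono) (auto simp: indicator_def)
      also have "\<dots> = ennreal (\<integral>y. bump z T y \<partial>\<mu>)"
        using T0 by (intro nn_integral_eq_integral) (auto simp: bump_nonneg intro: Lip0_integrable bump_Lip0)
      finally show ?thesis by simp
    qed
    have "ball z (2 * T) \<subseteq> ball x (4 * c * \<delta>)"
    proof
      fix w assume "w \<in> ball z (2 * T)"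
      then show "w \<in> ball x (4 * c * \<delta>)"
        using dist_triangle[of x w x0] dist_triangle[of x0 w z] x0 z Tc by simp
    qed
    then show ?thesis using that[of T z] T0 I e by (simp only: Q_eq)
  qed
qed

end

section \<open>Truncated kernels\<close>

text \<open>The mean value bound for \<open>t powr (- q)\<close>, whose derivative is largest in
  modulus at the lower bound \<open>m\<close>; it is obtained from \<open>exp u \<ge> 1 + u\<close>
  and \<open>ln v \<le> v - 1\<close>.\<close>

lemma powr_minus_diff_le:
  fixes a b q :: real
  assumes "0 < a" "0 < b" "0 \<le> q" "m \<le> a" "m \<le> b" "0 < m"
  shows "\<bar>a powr (- q) - b powr (- q)\<bar> \<le> q * \<bar>a - b\<bar> * m powr (- q - 1)"
proof -
  have main: "x powr (- q) - y powr (- q) \<le> q * (y - x) * m powr (- q - 1)"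
    if "0 < x" "x \<le> y" "m \<le> x" for x y :: real
  proof -
    have "1 - q * (y / x - 1) \<le> 1 + - q * ln (y / x)"
      using ln_le_minus_one[of "y / x"] that assms(3) by (simp add: mult_left_mono)
    also have "\<dots> \<le> (y / x) powr (- q)"
      using exp_ge_add_one_self[of "- q * ln (y / x)"] that by (simp add: powr_def)
    finally have "x powr (- q) * (1 - (y / x) powr (- q)) \<le> x powr (- q) * (q * (y / x - 1))"
      by (intro mult_left_mono) auto
    also have "\<dots> = q * (y - x) * x powr (- q - 1)"
      using that by (simp add: powr_diff field_simps)
    also have "\<dots> \<le> q * (y - x) * m powr (- q - 1)"
      using that assms by (intro mult_left_mono powr_mono2') auto
    also have "x powr (- q) * (1 - (y / x) powr (- q)) = x powr (- q) - y powr (- q)"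
      using that by (simp add: powr_divide right_diff_distrib)
    finally show ?thesis .
  qed
  show ?thesis
  proof (cases "a \<le> b")
    case True
    then have "b powr (- q) \<le> a powr (- q)" using assms by (intro powr_mono2') auto
    then show ?thesis using main[of a b] True assms by simp
  next
    case False
    then have "a powr (- q) \<le> b powr (- q)" using assms by (intro powr_mono2') auto
    then show ?thesis using main[of b a] False assms by simp
  qed
qed

text \<open>Modulus of continuity of the regularised kernel under a shift by \<open>h\<close>: the
  first term comes from the Hoelder numerator, the second from the radial denominator. A shift
  changes \<open>max \<delta> (norm u)\<close> at most by the factor
  \<open>1 + h / \<delta>\<close>, which enters with exponent \<alpha> through the numerator and
  \<open>s + \<alpha> + 1\<close> through the derivative of the denominator.\<close>

definition far_modulus :: "real \<Rightarrow> real \<Rightarrow> real \<Rightarrow> real \<Rightarrow> real \<Rightarrow> real" where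
  "far_modulus s \<alpha> M \<delta> h =
     M * h powr \<alpha> + (s + \<alpha>) * (1 + h / \<delta>) powr (s + 2 * \<alpha> + 1) * h * \<delta> powr (\<alpha> - 1)"

text \<open>To be applied to \<open>\<Sum>i<n. u i * K x i\<close> with
  \<open>cnorm n u \<le> 1\<close>, which inherits the constants \<open>1\<close> and
  \<open>M\<close> from \<open>K\<close>; no bound then depends on the target dimension.\<close>

locale scalar_kernel =
  fixes k :: "'a::euclidean_space \<Rightarrow> complex" and s \<alpha> M :: real
  assumes s_positive: "0 < s" and \<alpha>_pos: "0 < \<alpha>" and \<alpha>_le_1: "\<alpha> \<le> 1" and M_nonneg: "0 \<le> M"
    and k_le: "x \<noteq> 0 \<Longrightarrow> cmod (k x) \<le> norm x powr (- s)"
    and k_odd: "x \<noteq> 0 \<Longrightarrow> k (- x) = - k x"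
    and k_holder: "cmod ((if x = 0 then 0 else k x * of_real (norm x powr (s + \<alpha>)))
      - (if y = 0 then 0 else k y * of_real (norm y powr (s + \<alpha>)))) \<le> M * dist x y powr \<alpha>"
begin

definition profile :: "'a \<Rightarrow> complex" where
  "profile x = (if x = 0 then 0 else k x * of_real (norm x powr (s + \<alpha>)))"

text \<open>\<open>k_far\<close> is the regularised kernel at scale \<delta> and
  \<open>k_near\<close> the remainder, which vanishes beyond distance \<delta>. For
  \<open>0 < \<delta>\<close> the far kernel is \<open>0\<close> at the origin whatever
  \<open>k 0\<close> is.\<close>

definition k_far :: "real \<Rightarrow> 'a \<Rightarrow> complex" where
  "k_far \<delta> u = k u * of_real ((norm u / max \<delta> (norm u)) powr (s + \<alpha>))"

definition k_near :: "real \<Rightarrow> 'a \<Rightarrow> complex" where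
  "k_near \<delta> u = k u - k_far \<delta> u"

lemma profile_holder: "cmod (profile x - profile y) \<le> M * dist x y powr \<alpha>"
  using k_holder unfolding profile_def .

lemma profile_le: "cmod (profile x) \<le> norm x powr \<alpha>"
proof (cases "x = 0")
  case False
  have "cmod (profile x) \<le> norm x powr (- s) * norm x powr (s + \<alpha>)"
    using False by (simp add: profile_def norm_mult mult_right_mono k_le)
  also have "\<dots> = norm x powr \<alpha>" by (simp flip: powr_add)
  finally show ?thesis .
qed (simp add: profile_def)

lemma continuous_profile: "continuous_on UNIV profile"
proof (intro continuous_at_imp_continuous_on ballI)
  fix x :: 'a
  have "((\<lambda>y. M * dist y x powr \<alpha>) \<longlongrightarrow> M * dist x x powr \<alpha>) (at x)"
    using \<alpha>_pos by (intro tendsto_mult tendsto_const tendsto_powr' tendsto_dist tendsto_ident_at) auto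
  then have "((\<lambda>y. M * dist y x powr \<alpha>) \<longlongrightarrow> 0) (at x)" by simp
  then have "((\<lambda>y. profile y - profile x) \<longlongrightarrow> 0) (at x)"
    by (rule Lim_null_comparison[rotated]) (simp add: profile_holder)
  then show "isCont profile x" by (simp add: isCont_def LIM_zero_iff)
qed

lemma borel_profile [measurable]: "profile \<in> borel_measurable borel"
  by (rule borel_measurable_continuous_onI[OF continuous_profile])

text \<open>Measurability comes from the Hoelder condition: off the origin \<open>k\<close> is the
  continuous \<open>profile\<close> times a power of the norm.\<close>

lemma borel_k [measurable]: "k \<in> borel_measurable borel"
proof -
  have "k = (\<lambda>x. if x = 0 then k 0 else profile x * of_real (norm x powr (- (s + \<alpha>))))"
    by (auto simp: profile_def fun_eq_iff mult.assoc simp flip: of_real_mult powr_add)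
  also have "\<dots> \<in> borel_measurable borel" by measurable
  finally show ?thesis .
qed

lemma borel_k_far [measurable]: "k_far \<delta> \<in> borel_measurable borel"
  unfolding k_far_def by measurable

lemma borel_k_near [measurable]: "k_near \<delta> \<in> borel_measurable borel"
  unfolding k_near_def by measurable

lemma k_far_eq: "0 < \<delta> \<Longrightarrow> k_far \<delta> u = profile u * of_real (max \<delta> (norm u) powr (- (s + \<alpha>)))"
proof -
  assume "0 < \<delta>"
  then have "(norm u / max \<delta> (norm u)) powr (s + \<alpha>) = norm u powr (s + \<alpha>) * max \<delta> (norm u) powr (- (s + \<alpha>))"
    unfolding powr_minus by (subst powr_divide) (auto simp: divide_inverse)
  then show ?thesis by (simp add: k_far_def profile_def)
qed

lemma k_far_le: "0 < \<delta> \<Longrightarrow> cmod (k_far \<delta> u) \<le> \<delta> powr (- s)"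
proof -
  assume \<delta>: "0 < \<delta>"
  have "cmod (k_far \<delta> u) \<le> norm u powr \<alpha> * max \<delta> (norm u) powr (- (s + \<alpha>))"
    using \<delta> by (simp add: k_far_eq norm_mult mult_right_mono profile_le)
  also have "\<dots> \<le> max \<delta> (norm u) powr \<alpha> * max \<delta> (norm u) powr (- (s + \<alpha>))"
    using \<alpha>_pos by (intro mult_right_mono powr_mono2) auto
  also have "\<dots> = max \<delta> (norm u) powr (- s)" by (simp flip: powr_add)
  also have "\<dots> \<le> \<delta> powr (- s)" using \<delta> s_positive by (intro powr_mono2') auto
  finally show ?thesis .
qed

lemma k_far_odd: "k_far \<delta> (- u) = - k_far \<delta> u"
  by (cases "u = 0") (auto simp: k_far_def k_odd)

lemma k_near_eq_0: "0 < \<delta> \<Longrightarrow> \<delta> \<le> norm u \<Longrightarrow> k_near \<delta> u = 0"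
  by (auto simp: k_near_def k_far_def)

lemma k_near_le: assumes "0 < \<delta>" "u \<noteq> 0" shows "cmod (k_near \<delta> u) \<le> norm u powr (- s)"
proof -
  define t where "t = (norm u / max \<delta> (norm u)) powr (s + \<alpha>)"
  have "norm u / max \<delta> (norm u) \<le> 1" using assms by (intro divide_le_eq_1_pos[THEN iffD2]) auto
  then have "t \<le> 1 powr (s + \<alpha>)"
    unfolding t_def using s_positive \<alpha>_pos assms by (intro powr_mono2) auto
  then have t: "0 \<le> t" "t \<le> 1" by (auto simp: t_def)
  have "k_near \<delta> u = k u * of_real (1 - t)" by (simp add: k_near_def k_far_def t_def algebra_simps)
  then have "cmod (k_near \<delta> u) = cmod (k u) * (1 - t)"
    using t by (simp add: norm_mult del: of_real_diff)
  also have "\<dots> \<le> cmod (k u)" using t by (simp add: mult_left_le)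
  finally show ?thesis using k_le[OF assms(2)] by simp
qed

lemma far_modulus_nonneg: "0 < \<delta> \<Longrightarrow> 0 \<le> h \<Longrightarrow> 0 \<le> far_modulus s \<alpha> M \<delta> h"
  using s_positive \<alpha>_pos M_nonneg by (simp add: far_modulus_def)

text \<open>The far kernel is \<open>profile\<close> over a power of
  \<open>max \<delta> (norm u)\<close>; the two factors are varied in turn. The decay exponent
  \<open>- s - \<alpha>\<close> is better by \<alpha> than that of the kernel, which makes the
  difference integrable for nice measures.\<close>

lemma k_far_diff_le:
  assumes \<delta>: "0 < \<delta>" and h: "dist u v \<le> h"
  shows "cmod (k_far \<delta> v - k_far \<delta> u) \<le> far_modulus s \<alpha> M \<delta> h * max \<delta> (norm u) powr (- s - \<alpha>)"
proof -
  define a where "a = max \<delta> (norm u)"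
  define b where "b = max \<delta> (norm v)"
  define q where "q = s + \<alpha>"
  \<comment> \<open>A common lower bound for \<open>a\<close> and \<open>b\<close>, as each is at
    most \<open>1 + h / \<delta>\<close> times the other.\<close>
  define m where "m = a / (1 + h / \<delta>)"
  have h0: "0 \<le> h" using h zero_le_dist[of u v] by linarith
  have q: "0 < q" using s_positive \<alpha>_pos by (simp add: q_def)
  have ab: "\<delta> \<le> a" "\<delta> \<le> b" "0 < a" "0 < b" using \<delta> by (auto simp: a_def b_def)
  have "\<bar>norm u - norm v\<bar> \<le> h" using h norm_triangle_ineq3[of u v] by (simp add: dist_norm)
  then have abh: "\<bar>a - b\<bar> \<le> h" by (auto simp: a_def b_def)
  have H: "1 \<le> 1 + h / \<delta>" using h0 \<delta> by simp
  have le: "x \<le> y * (1 + h / \<delta>)" if "\<bar>x - y\<bar> \<le> h" "\<delta> \<le> y" for x y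
  proof -
    have "h = \<delta> * (h / \<delta>)" using \<delta> by simp
    also have "\<dots> \<le> y * (h / \<delta>)" using that h0 \<delta> by (intro mult_right_mono) auto
    finally show ?thesis using that by (simp add: distrib_left)
  qed
  have b_le: "b \<le> a * (1 + h / \<delta>)" using abh ab by (intro le) auto
  have "a \<le> b * (1 + h / \<delta>)" using abh ab by (intro le) auto
  then have m: "0 < m" "m \<le> a" "m \<le> b"
    using H ab by (auto simp: m_def pos_divide_le_eq mult_le_cancel_left1)
  have "k_far \<delta> v - k_far \<delta> u
      = (profile v - profile u) * of_real (a powr (- q)) + profile v * of_real (b powr (- q) - a powr (- q))"
    using \<delta> by (simp add: k_far_eq a_def b_def q_def algebra_simps)
  then have "cmod (k_far \<delta> v - k_far \<delta> u)
      \<le> cmod ((profile v - profile u) * of_real (a powr (- q))) + cmod (profile v * of_real (b powr (- q) - a powr (- q)))"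
    by (simp add: norm_triangle_ineq del: of_real_diff)
  also have "\<dots> = cmod (profile v - profile u) * a powr (- q) + cmod (profile v) * \<bar>b powr (- q) - a powr (- q)\<bar>"
    by (simp add: norm_mult del: of_real_diff)
  also have "\<dots> \<le> (M * h powr \<alpha>) * a powr (- q) + b powr \<alpha> * (q * h * m powr (- q - 1))"
  proof (intro add_mono mult_right_mono mult_mono)
    have "cmod (profile v - profile u) \<le> M * dist v u powr \<alpha>" by (rule profile_holder)
    also have "\<dots> \<le> M * h powr \<alpha>"
      using h M_nonneg \<alpha>_pos by (intro mult_left_mono powr_mono2) (auto simp: dist_commute)
    finally show "cmod (profile v - profile u) \<le> M * h powr \<alpha>" .
    have "norm v powr \<alpha> \<le> b powr \<alpha>" using \<alpha>_pos by (intro powr_mono2) (auto simp: b_def)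
    then show "cmod (profile v) \<le> b powr \<alpha>" using profile_le[of v] by linarith
    have "\<bar>b powr (- q) - a powr (- q)\<bar> \<le> q * \<bar>b - a\<bar> * m powr (- q - 1)"
      using ab m q by (intro powr_minus_diff_le) auto
    also have "\<dots> \<le> q * h * m powr (- q - 1)"
      using abh q by (intro mult_right_mono mult_left_mono) auto
    finally show "\<bar>b powr (- q) - a powr (- q)\<bar> \<le> q * h * m powr (- q - 1)" .
  qed auto
  also have "b powr \<alpha> * (q * h * m powr (- q - 1))
      \<le> (a * (1 + h / \<delta>)) powr \<alpha> * (q * h * m powr (- q - 1))"
    using b_le ab q h0 \<alpha>_pos by (intro mult_right_mono powr_mono2) auto
  also have "\<dots> = q * (1 + h / \<delta>) powr (s + 2 * \<alpha> + 1) * h * (a powr (\<alpha> - 1) * a powr (- q))"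
  proof -
    have e: "m powr (- q - 1) = a powr (- q - 1) * (1 + h / \<delta>) powr (q + 1)"
      using ab H powr_minus[of "1 + h / \<delta>" "- q - 1"]
      unfolding m_def by (subst powr_divide) (auto simp: divide_inverse add.commute)
    have "(a * (1 + h / \<delta>)) powr \<alpha> * (q * h * m powr (- q - 1))
        = q * ((1 + h / \<delta>) powr \<alpha> * (1 + h / \<delta>) powr (q + 1)) * h * (a powr \<alpha> * a powr (- q - 1))"
      unfolding e using ab H by (simp add: powr_mult)
    also have "(1 + h / \<delta>) powr \<alpha> * (1 + h / \<delta>) powr (q + 1) = (1 + h / \<delta>) powr (s + 2 * \<alpha> + 1)"
      by (simp add: q_def algebra_simps flip: powr_add)
    also have "a powr \<alpha> * a powr (- q - 1) = a powr (\<alpha> - 1) * a powr (- q)"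
      by (simp add: algebra_simps flip: powr_add)
    finally show ?thesis .
  qed
  \<comment> \<open>\<open>\<alpha> \<le> 1\<close> and \<open>\<delta> \<le> a\<close> allow
    \<open>a powr (\<alpha> - 1)\<close> to be replaced by
    \<open>\<delta> powr (\<alpha> - 1)\<close>.\<close>
  also have "\<dots> \<le> q * (1 + h / \<delta>) powr (s + 2 * \<alpha> + 1) * h * (\<delta> powr (\<alpha> - 1) * a powr (- q))"
    using ab \<delta> q h0 \<alpha>_le_1 by (intro mult_left_mono mult_right_mono powr_mono2') auto
  also have "M * h powr \<alpha> * a powr (- q) + q * (1 + h / \<delta>) powr (s + 2 * \<alpha> + 1) * h * (\<delta> powr (\<alpha> - 1) * a powr (- q))
      = far_modulus s \<alpha> M \<delta> h * a powr (- q)"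
    by (simp add: far_modulus_def distrib_right mult.assoc flip: q_def)
  also have "- q = - s - \<alpha>" by (simp add: q_def)
  finally show ?thesis by (simp add: a_def)
qed

end

section \<open>Splitting the bilinear form\<close>

lemma of_real_Lip0:
  assumes "f \<in> Lip0"
  shows "(\<lambda>x. complex_of_real (f x)) \<in> Lip0"
proof -
  obtain L where L: "L-lipschitz_on UNIV f" "compact (csupp f)" using assms by (auto simp: Lip0_def)
  then have "L-lipschitz_on UNIV (\<lambda>x. complex_of_real (f x))"
    by (auto simp: lipschitz_on_def dist_norm simp flip: of_real_diff)
  then show ?thesis using L(2) by (auto simp: Lip0_def csupp_def)
qed

lemma cutoff_seq_bump: "cutoff_seq (\<lambda>j. bump (0::'a::euclidean_space) (real j + 1))"
  by (auto simp: cutoff_seq_def bump_nonneg bump_le_1 intro!: bump_Lip0 bump_eq_1)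

lemma norm_lebesgue_integral_le:
  fixes f :: "'a \<Rightarrow> 'b::{banach, second_countable_topology}"
  assumes "integrable N f" "integrable N g" "\<And>x. norm (f x) \<le> g x"
  shows "norm (\<integral>x. f x \<partial>N) \<le> (\<integral>x. g x \<partial>N)"
proof -
  have "norm (\<integral>x. f x \<partial>N) \<le> (\<integral>x. norm (f x) \<partial>N)" by (rule Bochner_Integration.integral_norm_bound)
  also have "\<dots> \<le> (\<integral>x. g x \<partial>N)" using assms by (intro integral_mono) auto
  finally show ?thesis .
qed

definition tail_const :: "real \<Rightarrow> real \<Rightarrow> real \<Rightarrow> real" where
  "tail_const s \<alpha> \<Lambda> = 2 powr s / (1 - 2 powr (- \<alpha>)) * \<Lambda>"

locale kernel_measure = nice_measure \<mu> s \<Lambda> + scalar_kernel k s \<alpha> M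
  for \<mu> :: "'a::euclidean_space measure" and s \<Lambda> and k :: "'a \<Rightarrow> complex" and \<alpha> M
begin

text \<open>The form of the near kernel against the constant \<open>1\<close>, for which
  \<open>H_form g (\<lambda>_. 1) x y\<close> becomes \<open>(g y - g x) / 2\<close>.\<close>

definition near_form :: "real \<Rightarrow> ('a \<Rightarrow> complex) \<Rightarrow> complex" where
  "near_form \<delta> g = (\<integral>p. k_near \<delta> (fst p - snd p) * ((g (snd p) - g (fst p)) / 2) \<partial>(\<mu> \<Otimes>\<^sub>M \<mu>))"

definition far_fun :: "real \<Rightarrow> ('a \<Rightarrow> complex) \<Rightarrow> 'a \<Rightarrow> complex" where
  "far_fun \<delta> g x = (\<integral>y. k_far \<delta> (x - y) * g y \<partial>\<mu>)"

text \<open>The antisymmetric Lipschitz expression \<open>H_form f \<phi>\<close> vanishes to first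
  order on the diagonal, so the singularity drops to exponent \<open>1 - s\<close>, which the growth
  condition integrates over bounded sets.\<close>

lemma integrable_T_form:
  assumes f: "f \<in> Lip0" and \<phi>: "\<phi> \<in> Lip0"
  shows "integrable (\<mu> \<Otimes>\<^sub>M \<mu>) (\<lambda>p. k (fst p - snd p) * H_form f \<phi> (fst p) (snd p))"
proof (rule integrableI_bounded)
  have [measurable]: "f \<in> borel_measurable borel" "\<phi> \<in> borel_measurable borel"
    using f \<phi> by (auto intro: Lip0_measurable)
  show "(\<lambda>p. k (fst p - snd p) * H_form f \<phi> (fst p) (snd p)) \<in> borel_measurable (\<mu> \<Otimes>\<^sub>M \<mu>)"
    unfolding H_form_def by measurable
  obtain L1 R1 where 1: "0 < L1" "0 < R1" "\<And>x y. norm (f x - f y) \<le> L1 * dist x y"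
    "\<And>x. norm (f x) \<le> L1" "\<And>x. f x \<noteq> 0 \<Longrightarrow> norm x < R1" by (rule Lip0E[OF f]) (rule that, assumption+)
  obtain L2 R2 where 2: "0 < L2" "0 < R2" "\<And>x y. norm (\<phi> x - \<phi> y) \<le> L2 * dist x y"
    "\<And>x. norm (\<phi> x) \<le> L2" "\<And>x. \<phi> x \<noteq> 0 \<Longrightarrow> norm x < R2" by (rule Lip0E[OF \<phi>]) (rule that, assumption+)
  define R where "R = max R1 R2"
  have R: "0 < R" using 1 by (simp add: R_def)
  let ?g = "\<lambda>x y. ennreal (L1 * L2) * indicator (ball 0 R) x *
    (ennreal (dist x y powr (- (s - 1))) * indicator {..<2 * R} (dist x y))"
  have bound: "ennreal (norm (k (x - y) * H_form f \<phi> x y)) \<le> ?g x y" for x y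
  proof (cases "H_form f \<phi> x y = 0 \<or> x = y")
    case True
    then show ?thesis by (auto simp: H_form_def)
  next
    case False
    then have "f y * \<phi> x \<noteq> 0 \<or> f x * \<phi> y \<noteq> 0" by (auto simp: H_form_def)
    then have xy: "norm x < R" "norm y < R"
      using 1(5) 2(5) by (auto simp: R_def less_max_iff_disj)
    have d: "dist x y < 2 * R" using xy norm_triangle_ineq4[of x y] by (simp add: dist_norm)
    have "f y * \<phi> x - f x * \<phi> y = f y * (\<phi> x - \<phi> y) + (f y - f x) * \<phi> y" by (simp add: algebra_simps)
    then have "norm (f y * \<phi> x - f x * \<phi> y) \<le> norm (f y) * norm (\<phi> x - \<phi> y) + norm (f y - f x) * norm (\<phi> y)"
      by (metis norm_triangle_ineq norm_mult)
    also have "\<dots> \<le> L1 * (L2 * dist x y) + (L1 * dist y x) * L2"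
      using 1 2 by (intro add_mono mult_mono) auto
    finally have H: "norm (H_form f \<phi> x y) \<le> L1 * L2 * dist x y"
      by (simp add: H_form_def norm_divide dist_commute)
    have "norm (k (x - y) * H_form f \<phi> x y) \<le> dist x y powr (- s) * (L1 * L2 * dist x y)"
      using H k_le[of "x - y"] False unfolding norm_mult by (intro mult_mono) (auto simp: dist_norm)
    also have "\<dots> = L1 * L2 * dist x y powr (- (s - 1))"
      using False by (simp add: powr_diff powr_minus field_simps)
    finally show ?thesis using xy d 1 2 by (simp add: ennreal_leI flip: ennreal_mult)
  qed
  have "(\<integral>\<^sup>+p. ennreal (norm (k (fst p - snd p) * H_form f \<phi> (fst p) (snd p))) \<partial>(\<mu> \<Otimes>\<^sub>M \<mu>))
      \<le> (\<integral>\<^sup>+p. ?g (fst p) (snd p) \<partial>(\<mu> \<Otimes>\<^sub>M \<mu>))"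
    by (intro nn_integral_mono bound)
  also have "\<dots> = (\<integral>\<^sup>+x. \<integral>\<^sup>+y. ?g x y \<partial>\<mu> \<partial>\<mu>)"
    by (simp add: nn_integral_pair)
  also have "\<dots> \<le> (\<integral>\<^sup>+x. ennreal (L1 * L2) * indicator (ball 0 R) x *
      ennreal (2 powr \<bar>s - 1\<bar> / (1 - 2 powr (s - 1 - s)) * \<Lambda> * (2 * R) powr (s - (s - 1))) \<partial>\<mu>)"
  proof (rule nn_integral_mono)
    fix x
    have "(\<integral>\<^sup>+y. ?g x y \<partial>\<mu>) = ennreal (L1 * L2) * indicator (ball 0 R) x *
        (\<integral>\<^sup>+y. ennreal (dist x y powr (- (s - 1))) * indicator {..<2 * R} (dist x y) \<partial>\<mu>)"
      by (rule nn_integral_cmult) measurable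
    also have "(\<integral>\<^sup>+y. ennreal (dist x y powr (- (s - 1))) * indicator {..<2 * R} (dist x y) \<partial>\<mu>)
        = (\<integral>\<^sup>+y. ennreal (dist x y powr (- (s - 1))) * indicator (ball x (2 * R)) y \<partial>\<mu>)"
      by (intro nn_integral_cong) (auto simp: indicator_def)
    also have "\<dots> \<le> ennreal (2 powr \<bar>s - 1\<bar> / (1 - 2 powr (s - 1 - s)) * \<Lambda> * (2 * R) powr (s - (s - 1)))"
      using R \<Lambda>_pos by (intro nn_integral_dist_powr_ball_le emeasure_ball_le) (auto simp: sets_mu)
    finally show "(\<integral>\<^sup>+y. ?g x y \<partial>\<mu>) \<le> ennreal (L1 * L2) * indicator (ball 0 R) x *
      ennreal (2 powr \<bar>s - 1\<bar> / (1 - 2 powr (s - 1 - s)) * \<Lambda> * (2 * R) powr (s - (s - 1)))"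
      by (simp add: mult_left_mono)
  qed
  also have "\<dots> = ennreal (L1 * L2) * emeasure \<mu> (ball 0 R) *
      ennreal (2 powr \<bar>s - 1\<bar> / (1 - 2 powr (s - 1 - s)) * \<Lambda> * (2 * R) powr (s - (s - 1)))"
    by (simp add: nn_integral_multc nn_integral_cmult_indicator sets_mu)
  also have "\<dots> < \<infinity>" using emeasure_ball_finite[of 0 R] by (simp add: ennreal_mult_less_top)
  finally show "(\<integral>\<^sup>+p. ennreal (norm (k (fst p - snd p) * H_form f \<phi> (fst p) (snd p))) \<partial>(\<mu> \<Otimes>\<^sub>M \<mu>)) < \<infinity>" .
qed

lemma integrable_far:
  assumes g: "g \<in> Lip0" and \<psi>: "\<psi> \<in> Lip0" and \<delta>: "0 < \<delta>"
  shows "integrable (\<mu> \<Otimes>\<^sub>M \<mu>) (\<lambda>p. k_far \<delta> (fst p - snd p) * (g (snd p) * \<psi> (fst p)))"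
proof -
  have [measurable]: "g \<in> borel_measurable borel" "\<psi> \<in> borel_measurable borel"
    using g \<psi> by (auto intro: Lip0_measurable)
  obtain L1 R1 where 1: "0 < L1" "\<And>x. norm (g x) \<le> L1" "\<And>x. g x \<noteq> 0 \<Longrightarrow> norm x < R1"
    by (rule Lip0E[OF g]) (rule that, assumption+)
  obtain L2 R2 where 2: "0 < L2" "\<And>x. norm (\<psi> x) \<le> L2" "\<And>x. \<psi> x \<noteq> 0 \<Longrightarrow> norm x < R2"
    by (rule Lip0E[OF \<psi>]) (rule that, assumption+)
  show ?thesis
  proof (rule integrableI_bounded_set[where A = "ball 0 R2 \<times> ball 0 R1" and B = "\<delta> powr (- s) * (L1 * L2)"])
    show "ball 0 R2 \<times> ball 0 R1 \<in> sets (\<mu> \<Otimes>\<^sub>M \<mu>)" by (intro pair_measureI) (auto simp: sets_mu)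
    show "emeasure (\<mu> \<Otimes>\<^sub>M \<mu>) (ball 0 R2 \<times> ball 0 R1) < \<infinity>"
    proof -
      have "emeasure (\<mu> \<Otimes>\<^sub>M \<mu>) (ball 0 R2 \<times> ball 0 R1) = emeasure \<mu> (ball 0 R2) * emeasure \<mu> (ball 0 R1)"
        by (rule sigma_finite_measure.emeasure_pair_measure_Times[OF sigma_finite_mu]) (auto simp: sets_mu)
      then show ?thesis
        using emeasure_ball_finite[of 0 R1] emeasure_ball_finite[of 0 R2] by (simp add: ennreal_mult_less_top)
    qed
    show "AE p in \<mu> \<Otimes>\<^sub>M \<mu>. p \<in> ball 0 R2 \<times> ball 0 R1 \<longrightarrow>
        norm (k_far \<delta> (fst p - snd p) * (g (snd p) * \<psi> (fst p))) \<le> \<delta> powr (- s) * (L1 * L2)"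
      unfolding norm_mult using k_far_le[OF \<delta>] 1 2 by (intro AE_I2 impI mult_mono) auto
    show "AE p in \<mu> \<Otimes>\<^sub>M \<mu>. p \<notin> ball 0 R2 \<times> ball 0 R1 \<longrightarrow>
        k_far \<delta> (fst p - snd p) * (g (snd p) * \<psi> (fst p)) = 0"
      using 1(3) 2(3) by (intro AE_I2) (auto simp: mem_Times_iff)
  qed measurable
qed

text \<open>The far kernel is bounded, so the two halves of \<open>H_form\<close> are integrable
  separately; exchanging the variables and oddness turn the integral of one product into the
  negative of the other.\<close>

lemma far_form_eq:
  assumes g: "g \<in> Lip0" and \<psi>: "\<psi> \<in> Lip0" and \<delta>: "0 < \<delta>"
  shows "integrable (\<mu> \<Otimes>\<^sub>M \<mu>) (\<lambda>p. k_far \<delta> (fst p - snd p) * H_form g \<psi> (fst p) (snd p))" (is ?int)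
    and "(\<integral>p. k_far \<delta> (fst p - snd p) * H_form g \<psi> (fst p) (snd p) \<partial>(\<mu> \<Otimes>\<^sub>M \<mu>))
      = (\<integral>x. far_fun \<delta> g x * \<psi> x \<partial>\<mu>)" (is ?eq)
proof -
  let ?F = "\<lambda>p. k_far \<delta> (fst p - snd p) * (g (snd p) * \<psi> (fst p))"
  let ?F' = "\<lambda>p. k_far \<delta> (fst p - snd p) * (g (fst p) * \<psi> (snd p))"
  note F = integrable_far[OF g \<psi> \<delta>]
  note F1 = integrable_far[OF \<psi> g \<delta>]
  have F'_eq: "(\<lambda>p. k_far \<delta> (fst p - snd p) * (\<psi> (snd p) * g (fst p))) = ?F'" by (simp add: mult.commute)
  have F': "integrable (\<mu> \<Otimes>\<^sub>M \<mu>) ?F'" using F1 unfolding F'_eq .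
  have swap: "(\<integral>p. ?F' p \<partial>(\<mu> \<Otimes>\<^sub>M \<mu>)) = - (\<integral>p. ?F p \<partial>(\<mu> \<Otimes>\<^sub>M \<mu>))"
  proof -
    have "(\<integral>p. ?F' p \<partial>(\<mu> \<Otimes>\<^sub>M \<mu>)) = (\<integral>(x, y). ?F' (y, x) \<partial>(\<mu> \<Otimes>\<^sub>M \<mu>))"
      using F' by (intro integral_product_swap[symmetric]) auto
    also have "\<dots> = (\<integral>p. - ?F p \<partial>(\<mu> \<Otimes>\<^sub>M \<mu>))"
    proof (intro Bochner_Integration.integral_cong refl)
      fix p :: "'a \<times> 'a"
      show "(case p of (x, y) \<Rightarrow> ?F' (y, x)) = - ?F p"
        using k_far_odd[of \<delta> "fst p - snd p"] by (simp add: case_prod_beta)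
    qed
    finally show ?thesis by simp
  qed
  have H: "k_far \<delta> (fst p - snd p) * H_form g \<psi> (fst p) (snd p) = (?F p - ?F' p) / 2" for p
    by (simp add: H_form_def algebra_simps)
  show ?int unfolding H using F F' by (intro integrable_divide Bochner_Integration.integrable_diff)
  have "(\<integral>p. k_far \<delta> (fst p - snd p) * H_form g \<psi> (fst p) (snd p) \<partial>(\<mu> \<Otimes>\<^sub>M \<mu>)) = (\<integral>p. ?F p \<partial>(\<mu> \<Otimes>\<^sub>M \<mu>))"
    unfolding H using F F' by (simp add: swap)
  also have "\<dots> = (\<integral>x. \<integral>y. ?F (x, y) \<partial>\<mu> \<partial>\<mu>)" using F by (rule integral_fst'[symmetric])
  also have "\<dots> = (\<integral>x. far_fun \<delta> g x * \<psi> x \<partial>\<mu>)"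
    unfolding far_fun_def by (simp add: mult.assoc flip: integral_mult_left_zero)
  finally show ?eq .
qed

text \<open>As \<psi> is \<open>1\<close> within distance \<delta> of the set where \<open>g\<close>
  is nonzero, the near part does not see \<psi>; all dependence on the cut-off sits in an ordinary
  integral.\<close>

lemma T_form_eq:
  assumes g: "g \<in> Lip0" and \<psi>: "\<psi> \<in> Lip0" and \<delta>: "0 < \<delta>"
    and one: "\<And>x y. g y \<noteq> 0 \<Longrightarrow> dist x y < \<delta> \<Longrightarrow> \<psi> x = 1"
  shows "T_form k \<mu> g \<psi> = near_form \<delta> g + (\<integral>x. far_fun \<delta> g x * \<psi> x \<partial>\<mu>)"
proof -
  let ?I = "\<lambda>K. \<lambda>p. K (fst p - snd p) * H_form g \<psi> (fst p) (snd p)"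
  have near: "?I (k_near \<delta>) p = k_near \<delta> (fst p - snd p) * ((g (snd p) - g (fst p)) / 2)" for p
  proof (cases "dist (fst p) (snd p) < \<delta>")
    case True
    then have "H_form g \<psi> (fst p) (snd p) = (g (snd p) - g (fst p)) / 2"
      using one[of "snd p" "fst p"] one[of "fst p" "snd p"]
      by (cases "g (snd p) = 0"; cases "g (fst p) = 0") (auto simp: H_form_def dist_commute)
    then show ?thesis by simp
  next
    case False
    then show ?thesis using k_near_eq_0[OF \<delta>, of "fst p - snd p"] by (simp add: dist_norm)
  qed
  have "near_form \<delta> g = (\<integral>p. ?I k p - ?I (k_far \<delta>) p \<partial>(\<mu> \<Otimes>\<^sub>M \<mu>))"
    unfolding near_form_def near[symmetric] by (simp add: k_near_def left_diff_distrib)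
  also have "\<dots> = T_form k \<mu> g \<psi> - (\<integral>x. far_fun \<delta> g x * \<psi> x \<partial>\<mu>)"
    unfolding T_form_def far_form_eq(2)[OF g \<psi> \<delta>, symmetric]
    by (rule Bochner_Integration.integral_diff[OF integrable_T_form[OF g \<psi>] far_form_eq(1)[OF g \<psi> \<delta>]])
  finally show ?thesis by simp
qed

lemma borel_far_fun [measurable]:
  assumes [measurable]: "g \<in> borel_measurable borel"
  shows "far_fun \<delta> g \<in> borel_measurable borel"
proof -
  have "far_fun \<delta> g \<in> borel_measurable \<mu>" unfolding far_fun_def by measurable
  then show ?thesis by (simp cong: measurable_cong_sets add: measurable_cong_sets[OF sets_mu refl])
qed

lemma integrable_k_far_mult:
  assumes g: "g \<in> Lip0" and \<delta>: "0 < \<delta>"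
  shows "integrable \<mu> (\<lambda>z. k_far \<delta> (y - z) * g z)"
proof -
  have [measurable]: "g \<in> borel_measurable borel" using g by (rule Lip0_measurable)
  obtain L1 R1 where 1: "0 < L1" "\<And>x. norm (g x) \<le> L1" "\<And>x. g x \<noteq> 0 \<Longrightarrow> norm x < R1"
    by (rule Lip0E[OF g]) (rule that, assumption+)
  show ?thesis
  proof (rule integrable_bounded_support[where C = "\<delta> powr (- s) * L1" and R = R1])
    show "norm (k_far \<delta> (y - z) * g z) \<le> \<delta> powr (- s) * L1" for z
      unfolding norm_mult using k_far_le[OF \<delta>] 1 by (intro mult_mono) auto
  qed (use 1 in auto)
qed

text \<open>Averages the shift estimate for the far kernel over \<open>g\<close>. For mass
  \<open>1\<close> it compares a point source at \<open>x\<close> with \<open>g\<close>; for mass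
  \<open>0\<close> it gives the decay of \<open>far_fun \<delta> g\<close> at infinity.\<close>

lemma far_fun_diff_le:
  assumes g: "g \<in> Lip0" and \<delta>: "0 < \<delta>" and supp: "\<And>z. g z \<noteq> 0 \<Longrightarrow> dist x z \<le> h"
  shows "cmod (k_far \<delta> (y - x) * (\<integral>z. g z \<partial>\<mu>) - far_fun \<delta> g y)
    \<le> far_modulus s \<alpha> M \<delta> h * (\<integral>z. cmod (g z) \<partial>\<mu>) * max \<delta> (dist x y) powr (- s - \<alpha>)"
proof -
  note gi = Lip0_integrable[OF g]
  have "k_far \<delta> (y - x) * (\<integral>z. g z \<partial>\<mu>) - far_fun \<delta> g y
      = (\<integral>z. k_far \<delta> (y - x) * g z - k_far \<delta> (y - z) * g z \<partial>\<mu>)"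
    unfolding far_fun_def using gi integrable_k_far_mult[OF g \<delta>] by simp
  also have "cmod \<dots> \<le> (\<integral>z. far_modulus s \<alpha> M \<delta> h * max \<delta> (dist x y) powr (- s - \<alpha>) * cmod (g z) \<partial>\<mu>)"
  proof (rule norm_lebesgue_integral_le)
    fix z
    show "cmod (k_far \<delta> (y - x) * g z - k_far \<delta> (y - z) * g z)
        \<le> far_modulus s \<alpha> M \<delta> h * max \<delta> (dist x y) powr (- s - \<alpha>) * cmod (g z)"
    proof (cases "g z = 0")
      case False
      have "cmod (k_far \<delta> (y - z) - k_far \<delta> (y - x))
          \<le> far_modulus s \<alpha> M \<delta> h * max \<delta> (norm (y - x)) powr (- s - \<alpha>)"
        using supp[OF False] by (intro k_far_diff_le \<delta>) (simp add: dist_norm norm_minus_commute)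
      then have "cmod (k_far \<delta> (y - x) - k_far \<delta> (y - z)) \<le> far_modulus s \<alpha> M \<delta> h * max \<delta> (dist x y) powr (- s - \<alpha>)"
        by (simp add: dist_norm norm_minus_commute)
      then show ?thesis by (simp add: norm_mult mult_right_mono flip: left_diff_distrib)
    qed simp
  qed (use gi integrable_k_far_mult[OF g \<delta>] in auto)
  finally show ?thesis by (simp add: mult_ac)
qed

lemma tail:
  assumes \<delta>: "0 < \<delta>"
  shows "integrable \<mu> (\<lambda>y. max \<delta> (dist x y) powr (- s - \<alpha>))"
    and "(\<integral>y. max \<delta> (dist x y) powr (- s - \<alpha>) \<partial>\<mu>) \<le> tail_const s \<alpha> \<Lambda> * \<delta> powr (- \<alpha>)"
proof -
  have le: "(\<integral>\<^sup>+y. ennreal (max \<delta> (dist x y) powr (- s - \<alpha>)) \<partial>\<mu>) \<le> ennreal (tail_const s \<alpha> \<Lambda> * \<delta> powr (- \<alpha>))"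
    unfolding tail_const_def using s_pos \<alpha>_pos \<Lambda>_pos \<delta> emeasure_ball_le
    by (intro nn_integral_max_powr_le) (auto simp: sets_mu)
  show int: "integrable \<mu> (\<lambda>y. max \<delta> (dist x y) powr (- s - \<alpha>))"
    using le by (intro integrableI_bounded) (auto intro: le_less_trans[OF _ ennreal_less_top])
  have "0 \<le> tail_const s \<alpha> \<Lambda>"
    using \<Lambda>_pos \<alpha>_pos powr_less_mono[of "- \<alpha>" 0 "2::real"] by (auto simp: tail_const_def)
  then show "(\<integral>y. max \<delta> (dist x y) powr (- s - \<alpha>) \<partial>\<mu>) \<le> tail_const s \<alpha> \<Lambda> * \<delta> powr (- \<alpha>)"
    using le int by (subst (asm) nn_integral_eq_integral) (auto simp: ennreal_le_iff)
qed

end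

section \<open>Extended form and limits over cut-offs\<close>

context kernel_measure
begin

text \<open>Mean zero cancels the leading term \<open>k_far \<delta> y\<close>, so
  \<open>far_fun_diff_le\<close> with centre \<open>0\<close> leaves an integrable majorant.\<close>

lemma integrable_far_fun:
  assumes g: "g \<in> Lip0" and \<delta>: "0 < \<delta>" and zero: "(\<integral>z. g z \<partial>\<mu>) = 0"
  shows "integrable \<mu> (far_fun \<delta> g)"
proof -
  obtain R1 where 1: "\<And>x. g x \<noteq> 0 \<Longrightarrow> norm x < R1"
    by (rule Lip0E[OF g]) (rule that, assumption+)
  show ?thesis
  proof (rule Bochner_Integration.integrable_bound)
    show "integrable \<mu> (\<lambda>y. far_modulus s \<alpha> M \<delta> R1 * (\<integral>z. cmod (g z) \<partial>\<mu>) * max \<delta> (dist 0 y) powr (- s - \<alpha>))"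
      using tail(1)[OF \<delta>, of 0] by simp
    show "AE y in \<mu>. norm (far_fun \<delta> g y)
        \<le> norm (far_modulus s \<alpha> M \<delta> R1 * (\<integral>z. cmod (g z) \<partial>\<mu>) * max \<delta> (dist 0 y) powr (- s - \<alpha>))"
    proof (rule AE_I2)
      fix y
      have supp: "dist 0 z \<le> R1" if "g z \<noteq> 0" for z using 1[OF that] by simp
      have "cmod (far_fun \<delta> g y) \<le> far_modulus s \<alpha> M \<delta> R1 * (\<integral>z. cmod (g z) \<partial>\<mu>) * max \<delta> (dist 0 y) powr (- s - \<alpha>)"
        using far_fun_diff_le[OF g \<delta> supp, of y] by (simp add: zero)
      then show "norm (far_fun \<delta> g y)
        \<le> norm (far_modulus s \<alpha> M \<delta> R1 * (\<integral>z. cmod (g z) \<partial>\<mu>) * max \<delta> (dist 0 y) powr (- s - \<alpha>))"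
        by simp
    qed
    show "far_fun \<delta> g \<in> borel_measurable \<mu>" using Lip0_measurable[OF g] by measurable
  qed
qed

lemma cutoff_of_real:
  fixes \<psi> :: "nat \<Rightarrow> 'a \<Rightarrow> real"
  assumes "cutoff_seq \<psi>"
  shows "(\<lambda>x. complex_of_real (\<psi> j x)) \<in> Lip0" "(\<lambda>x. complex_of_real (\<psi> j x)) \<in> borel_measurable borel"
    "0 \<le> \<psi> j x" "\<psi> j x \<le> 1" "norm x < real j \<Longrightarrow> \<psi> j x = 1"
proof -
  show L: "(\<lambda>x. complex_of_real (\<psi> j x)) \<in> Lip0"
    using assms by (auto simp: cutoff_seq_def intro!: of_real_Lip0)
  show "(\<lambda>x. complex_of_real (\<psi> j x)) \<in> borel_measurable borel" using L by (rule Lip0_measurable)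
qed (use assms in \<open>auto simp: cutoff_seq_def\<close>)

text \<open>Dominated convergence with majorant \<open>norm (F x)\<close>, as at each point the
  cut-offs are eventually \<open>1\<close>.\<close>

lemma cutoff_tendsto:
  fixes F :: "'a \<Rightarrow> complex"
  assumes \<psi>: "cutoff_seq \<psi>" and F: "integrable \<mu> F"
  shows "(\<lambda>j. \<integral>x. F x * of_real (\<psi> j x) \<partial>\<mu>) \<longlonglongrightarrow> (\<integral>x. F x \<partial>\<mu>)"
    and "integrable \<mu> (\<lambda>x. F x * of_real (\<psi> j x))"
proof -
  note [measurable] = cutoff_of_real(2)[OF \<psi>]
  have Fm [measurable]: "F \<in> borel_measurable \<mu>" using F by auto
  have le: "norm (F x * of_real (\<psi> j x)) \<le> norm (F x)" for j x
    using cutoff_of_real(3,4)[OF \<psi>, of j x] by (simp add: norm_mult mult_left_le)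
  show "integrable \<mu> (\<lambda>x. F x * of_real (\<psi> j x))"
    using le by (intro Bochner_Integration.integrable_bound[OF F]) auto
  show "(\<lambda>j. \<integral>x. F x * of_real (\<psi> j x) \<partial>\<mu>) \<longlonglongrightarrow> (\<integral>x. F x \<partial>\<mu>)"
  proof (rule integral_dominated_convergence[where w = "\<lambda>x. norm (F x)"])
    show "AE x in \<mu>. (\<lambda>j. F x * of_real (\<psi> j x)) \<longlonglongrightarrow> F x"
    proof (rule AE_I2, rule tendsto_eventually)
      fix x :: 'a
      obtain n where n: "norm x < real n" using reals_Archimedean2 by blast
      show "\<forall>\<^sub>F j in sequentially. F x * of_real (\<psi> j x) = F x"
        using eventually_ge_at_top[of n]
      proof eventually_elim
        case (elim j)
        then show ?case using n cutoff_of_real(5)[OF \<psi>, of x j] by simp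
      qed
    qed
  qed (use F le in auto)
qed

lemma cutoff_eventually_one:
  fixes \<psi> :: "nat \<Rightarrow> 'a \<Rightarrow> real"
  assumes \<psi>: "cutoff_seq \<psi>" and g: "g \<in> Lip0"
  shows "\<forall>\<^sub>F j in sequentially. \<forall>x y. g y \<noteq> 0 \<longrightarrow> dist x y < \<delta> \<longrightarrow> \<psi> j x = 1"
proof -
  obtain R1 where 1: "\<And>x. g x \<noteq> 0 \<Longrightarrow> norm x < R1"
    by (rule Lip0E[OF g]) (rule that, assumption+)
  obtain n where n: "R1 + \<delta> < real n" using reals_Archimedean2 by blast
  show ?thesis using eventually_ge_at_top[of n]
  proof eventually_elim
    case (elim j)
    show ?case
    proof (intro allI impI)
      fix x y assume "g y \<noteq> 0" "dist x y < \<delta>"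
      then have "norm x < real j"
        using 1[of y] n elim norm_triangle_ineq2[of x y] by (simp add: dist_norm)
      then show "\<psi> j x = 1" by (rule cutoff_of_real(5)[OF \<psi>])
    qed
  qed
qed

lemma cutoff_T_form_eq:
  fixes \<psi> :: "nat \<Rightarrow> 'a \<Rightarrow> real"
  assumes \<psi>: "cutoff_seq \<psi>" and g: "g \<in> Lip0" and \<delta>: "0 < \<delta>"
  shows "\<forall>\<^sub>F j in sequentially. T_form k \<mu> g (\<lambda>x. of_real (\<psi> j x))
      = near_form \<delta> g + (\<integral>x. far_fun \<delta> g x * of_real (\<psi> j x) \<partial>\<mu>)"
  using cutoff_eventually_one[OF \<psi> g, of \<delta>]
proof eventually_elim
  case (elim j)
  show ?case by (rule T_form_eq[OF g cutoff_of_real(1)[OF \<psi>] \<delta>]) (use elim in auto)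
qed

text \<open>Where \<psi> differs from \<open>1\<close>, the point is at distance at least \<delta>
  from the set where \<open>g\<close> is nonzero, so \<open>k\<close> and
  \<open>k_far \<delta>\<close> agree in \<open>T_fun\<close>. The two terms with
  \<open>far_fun \<delta> g x * \<psi> x\<close> then cancel.\<close>

lemma T_form_ext_summand_eq:
  assumes g: "g \<in> Lip0" and \<psi>: "\<psi> \<in> Lip0" and \<delta>: "0 < \<delta>" and zero: "(\<integral>z. g z \<partial>\<mu>) = 0"
    and one: "\<And>x y. g y \<noteq> 0 \<Longrightarrow> dist x y < \<delta> \<Longrightarrow> \<psi> x = 1"
  shows "T_form k \<mu> g (\<lambda>x. \<psi> x * 1) + (\<integral>x. T_fun k \<mu> g x * (1 - \<psi> x) * 1 \<partial>\<mu>)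
    = near_form \<delta> g + (\<integral>x. far_fun \<delta> g x \<partial>\<mu>)"
proof -
  have T: "T_fun k \<mu> g x * (1 - \<psi> x) * 1 = far_fun \<delta> g x - far_fun \<delta> g x * \<psi> x" for x
  proof (cases "\<psi> x = 1")
    case False
    have "k (x - y) * g y = k_far \<delta> (x - y) * g y" for y
    proof (cases "g y = 0")
      case g: False
      then have "\<delta> \<le> norm (x - y)" using one[of y x] False by (auto simp: dist_norm not_less[symmetric])
      then show ?thesis using k_near_eq_0[OF \<delta>, of "x - y"] by (simp add: k_near_def)
    qed simp
    then have "T_fun k \<mu> g x = far_fun \<delta> g x" by (simp only: T_fun_def far_fun_def)
    then show ?thesis by (simp add: algebra_simps)
  qed simp
  note G = integrable_far_fun[OF g \<delta> zero]
  have "integrable \<mu> (\<lambda>x. far_fun \<delta> g x * \<psi> x)"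
  proof -
    have [measurable]: "g \<in> borel_measurable borel" "\<psi> \<in> borel_measurable borel"
      using g \<psi> by (auto intro: Lip0_measurable)
    obtain L2 where 2: "0 < L2" "\<And>x. norm (\<psi> x) \<le> L2"
      by (rule Lip0E[OF \<psi>]) (rule that, assumption+)
    have "integrable \<mu> (\<lambda>x. far_fun \<delta> g x * of_real L2)" using G by simp
    then show ?thesis
    proof (rule Bochner_Integration.integrable_bound)
      show "AE x in \<mu>. norm (far_fun \<delta> g x * \<psi> x) \<le> norm (far_fun \<delta> g x * complex_of_real L2)"
        unfolding norm_mult using 2 by (intro AE_I2 mult_left_mono) auto
    qed measurable
  qed
  then show ?thesis unfolding T using G T_form_eq[OF g \<psi> \<delta> one] by simp
qed

text \<open>The definite description is well defined: an admissible \<psi> has its own scale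
  \<open>\<delta> \<le> 1\<close>, and a fixed wide bump \<open>\<beta> j\<close>, for which both
  \<delta> and \<open>1\<close> are valid scales, links the value at scale \<delta> to that at scale
  \<open>1\<close>.\<close>

lemma T_form_ext_eq:
  assumes g: "g \<in> Lip0" and zero: "(\<integral>z. g z \<partial>\<mu>) = 0"
  shows "T_form_ext k \<mu> g (\<lambda>_. 1) = near_form 1 g + (\<integral>x. far_fun 1 g x \<partial>\<mu>)"
proof -
  define \<beta> where "\<beta> j x = complex_of_real (bump (0::'a) (real j + 1) x)" for j x
  define V where "V \<psi> = T_form k \<mu> g (\<lambda>x. \<psi> x * 1) + (\<integral>x. T_fun k \<mu> g x * (1 - \<psi> x) * 1 \<partial>\<mu>)" for \<psi>
  define adm where "adm \<psi> \<longleftrightarrow> (\<exists>U. open U \<and> csupp g \<subseteq> U \<and> (\<forall>x\<in>U. \<psi> x = (1::complex)))" for \<psi>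
  obtain R1 where R1: "csupp g \<subseteq> ball 0 R1" by (rule Lip0E[OF g]) (rule that, assumption+)
  have supp: "y \<in> csupp g" if "g y \<noteq> 0" for y
    using that closure_subset[of "{x. g x \<noteq> 0}"] by (auto simp: csupp_def)
  obtain j where j: "\<And>x y. g y \<noteq> 0 \<Longrightarrow> dist x y < 1 \<Longrightarrow> \<beta> j x = 1" "R1 < real j"
  proof -
    obtain n where n: "R1 < real n" using reals_Archimedean2 by blast
    have "\<forall>\<^sub>F j in sequentially. (\<forall>x y. g y \<noteq> 0 \<longrightarrow> dist x y < 1 \<longrightarrow> bump (0::'a) (real j + 1) x = 1) \<and> R1 < real j"
      using cutoff_eventually_one[OF cutoff_seq_bump g, of 1] eventually_ge_at_top[of n]
      by eventually_elim (use n in auto)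
    then obtain j where "\<forall>x y. g y \<noteq> 0 \<longrightarrow> dist x y < 1 \<longrightarrow> bump (0::'a) (real j + 1) x = 1" "R1 < real j"
      using eventually_happens'[OF sequentially_bot] by blast
    then show ?thesis by (intro that[of j]) (auto simp: \<beta>_def)
  qed
  have \<beta>_Lip: "\<beta> j \<in> Lip0"
    unfolding \<beta>_def by (rule cutoff_of_real(1)[OF cutoff_seq_bump])
  have \<beta>_adm: "adm (\<beta> j)"
    unfolding adm_def using R1 j(2) by (intro exI[of _ "ball 0 R1"]) (auto simp: \<beta>_def bump_eq_1)
  have val: "V \<psi> = near_form 1 g + (\<integral>x. far_fun 1 g x \<partial>\<mu>)" if \<psi>: "\<psi> \<in> Lip0" "adm \<psi>" for \<psi>
  proof -
    obtain U where U: "open U" "csupp g \<subseteq> U" "\<And>x. x \<in> U \<Longrightarrow> \<psi> x = 1"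
      using \<psi>(2) by (auto simp: adm_def)
    have "compact (csupp g)" using g by (auto simp: Lip0_def)
    then obtain e where e: "0 < e" "\<And>y. y \<in> csupp g \<Longrightarrow> ball y e \<subseteq> U"
      using U by (elim compact_subset_open_imp_ball_epsilon_subset) blast+
    define \<delta> where "\<delta> = min 1 e"
    have \<delta>: "0 < \<delta>" "\<delta> \<le> 1" "\<delta> \<le> e" using e by (auto simp: \<delta>_def)
    have one: "\<psi> x = 1" if "g y \<noteq> 0" "dist x y < \<delta>" for x y
      using e(2)[OF supp[OF that(1)]] that(2) \<delta> by (intro U(3)) (auto simp: dist_commute subset_iff)
    have one': "\<beta> j x = 1" if "g y \<noteq> 0" "dist x y < \<delta>" for x y
      using j(1)[OF that(1), of x] that(2) \<delta> by simp
    have "V \<psi> = near_form \<delta> g + (\<integral>x. far_fun \<delta> g x \<partial>\<mu>)"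
      unfolding V_def by (rule T_form_ext_summand_eq[OF g \<psi>(1) \<delta>(1) zero one])
    also have "\<dots> = V (\<beta> j)"
      unfolding V_def by (rule T_form_ext_summand_eq[OF g \<beta>_Lip \<delta>(1) zero one', symmetric])
    also have "\<dots> = near_form 1 g + (\<integral>x. far_fun 1 g x \<partial>\<mu>)"
      unfolding V_def by (rule T_form_ext_summand_eq[OF g \<beta>_Lip _ zero j(1)]) simp
    finally show ?thesis .
  qed
  have "T_form_ext k \<mu> g (\<lambda>_. 1) = (THE L. \<forall>\<psi>\<in>Lip0. adm \<psi> \<longrightarrow> L = V \<psi>)"
    unfolding T_form_ext_def V_def adm_def ..
  \<comment> \<open>\<open>\<beta> j\<close> is itself admissible, so the condition on
    \<open>L\<close> is not vacuous and determines it.\<close>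
  also have "\<dots> = near_form 1 g + (\<integral>x. far_fun 1 g x \<partial>\<mu>)"
    using val \<beta>_Lip \<beta>_adm by (intro the_equality) auto
  finally show ?thesis .
qed

text \<open>For large \<open>j\<close> the cut-off enters only through the integral of
  \<open>far_fun 1 g x * \<psi> j x\<close>, which converges since \<open>far_fun 1 g\<close> is
  integrable. For reflectionless \<mu> the limit is \<open>0\<close>, and this is how
  reflectionlessness enters the proof.\<close>

lemma cutoff_T_form_tendsto:
  fixes \<psi> :: "nat \<Rightarrow> 'a \<Rightarrow> real"
  assumes g: "g \<in> Lip0" and zero: "(\<integral>z. g z \<partial>\<mu>) = 0" and \<psi>: "cutoff_seq \<psi>"
  shows "(\<lambda>j. T_form k \<mu> g (\<lambda>x. of_real (\<psi> j x))) \<longlonglongrightarrow> T_form_ext k \<mu> g (\<lambda>_. 1)"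
proof -
  have "(\<lambda>j. near_form 1 g + (\<integral>x. far_fun 1 g x * of_real (\<psi> j x) \<partial>\<mu>)) \<longlonglongrightarrow> T_form_ext k \<mu> g (\<lambda>_. 1)"
    unfolding T_form_ext_eq[OF g zero]
    by (intro tendsto_add tendsto_const cutoff_tendsto(1)[OF \<psi> integrable_far_fun[OF g _ zero]]) simp
  then show ?thesis
    using cutoff_T_form_eq[OF \<psi> g, of 1] by (elim Lim_transform_eventually) (auto elim: eventually_mono)
qed

end

section \<open>Limit and size of the potential at a point\<close>

lemma Lip0_diff:
  fixes f g :: "'a::euclidean_space \<Rightarrow> 'b::real_normed_vector"
  assumes f: "f \<in> Lip0" and g: "g \<in> Lip0"
  shows "(\<lambda>x. f x - g x) \<in> Lip0"
proof -
  obtain L1 R1 where 1: "0 < L1" "0 < R1" "\<And>x y. norm (f x - f y) \<le> L1 * dist x y" "\<And>x. f x \<noteq> 0 \<Longrightarrow> norm x < R1"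
    by (rule Lip0E[OF f]) (rule that, assumption+)
  obtain L2 R2 where 2: "0 < L2" "0 < R2" "\<And>x y. norm (g x - g y) \<le> L2 * dist x y" "\<And>x. g x \<noteq> 0 \<Longrightarrow> norm x < R2"
    by (rule Lip0E[OF g]) (rule that, assumption+)
  show ?thesis
  proof (rule Lip0I[where L = "L1 + L2" and z = 0 and R = "R1 + R2"])
    show "(L1 + L2)-lipschitz_on UNIV (\<lambda>x. f x - g x)"
    proof (rule lipschitz_onI)
      fix x y :: 'a
      have "norm ((f x - g x) - (f y - g y)) \<le> norm (f x - f y) + norm (g x - g y)"
        using norm_triangle_ineq4[of "f x - f y" "g x - g y"] by (simp add: algebra_simps)
      then show "dist (f x - g x) (f y - g y) \<le> (L1 + L2) * dist x y"
        using 1(3)[of x y] 2(3)[of x y] by (simp add: dist_norm distrib_right)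
    qed (use 1 2 in auto)
    fix y assume "f y - g y \<noteq> 0"
    then have "f y \<noteq> 0 \<or> g y \<noteq> 0" by auto
    then show "dist 0 y \<le> R1 + R2" using 1(2) 1(4)[of y] 2(2) 2(4)[of y] by auto
  qed
qed

lemma nn_integral_cmult_norm:
  fixes F :: "'a \<Rightarrow> 'b::{second_countable_topology, real_normed_vector}"
  assumes [measurable]: "F \<in> borel_measurable N"
  shows "(\<integral>\<^sup>+x. c * ennreal (norm (F x)) \<partial>N) = c * (\<integral>\<^sup>+x. ennreal (norm (F x)) \<partial>N)"
  by (rule nn_integral_cmult) measurable

context kernel_measure
begin

lemma T_form_diff:
  assumes f: "f \<in> Lip0" and g: "g \<in> Lip0" and \<phi>: "\<phi> \<in> Lip0"
  shows "T_form k \<mu> (\<lambda>y. f y - g y) \<phi> = T_form k \<mu> f \<phi> - T_form k \<mu> g \<phi>"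
proof -
  have "k (fst p - snd p) * H_form (\<lambda>y. f y - g y) \<phi> (fst p) (snd p)
      = k (fst p - snd p) * H_form f \<phi> (fst p) (snd p) - k (fst p - snd p) * H_form g \<phi> (fst p) (snd p)" for p
    by (simp add: H_form_def algebra_simps flip: diff_divide_distrib)
  then show ?thesis
    unfolding T_form_def using integrable_T_form[OF f \<phi>] integrable_T_form[OF g \<phi>] by simp
qed

text \<open>The near kernel is dominated off the origin by the Riesz kernel and vanishes beyond
  \<delta>; the point \<open>y = x\<close> is null.\<close>

lemma k_near_integral:
  assumes \<delta>: "0 < \<delta>" and P: "potential s \<mu> \<delta> x \<le> ennreal P" "0 \<le> P"
  shows "integrable \<mu> (\<lambda>y. k_near \<delta> (y - x))" and "cmod (\<integral>y. k_near \<delta> (y - x) \<partial>\<mu>) \<le> P"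
proof -
  have "(\<integral>\<^sup>+y. ennreal (cmod (k_near \<delta> (y - x))) \<partial>\<mu>) \<le> potential s \<mu> \<delta> x"
    unfolding potential_def
  proof (rule nn_integral_mono_AE, rule AE_mp[OF AE_neq[of x]], rule AE_I2, rule impI)
    fix y assume y: "y \<noteq> x"
    show "ennreal (cmod (k_near \<delta> (y - x))) \<le> ennreal (dist x y powr (- s)) * indicator (ball x \<delta>) y"
    proof (cases "dist x y < \<delta>")
      case True
      then show ?thesis using k_near_le[OF \<delta>, of "y - x"] y
        by (simp add: dist_norm norm_minus_commute ennreal_leI)
    next
      case False
      then show ?thesis using k_near_eq_0[OF \<delta>, of "y - x"] by (simp add: dist_norm norm_minus_commute)
    qed
  qed
  then have le: "(\<integral>\<^sup>+y. ennreal (cmod (k_near \<delta> (y - x))) \<partial>\<mu>) \<le> ennreal P" using P by simp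
  then show int: "integrable \<mu> (\<lambda>y. k_near \<delta> (y - x))"
    by (intro integrableI_bounded) (auto intro: le_less_trans[OF _ ennreal_less_top])
  have "ennreal (cmod (\<integral>y. k_near \<delta> (y - x) \<partial>\<mu>)) \<le> ennreal P"
    using integral_norm_bound_ennreal[OF int] le by simp
  then show "cmod (\<integral>y. k_near \<delta> (y - x) \<partial>\<mu>) \<le> P" using P(2) by simp
qed

text \<open>The factor \<open>1 / 2\<close> is the one in \<open>H_form\<close>. Off the diagonal
  the near kernel is bounded by the Riesz kernel, and on the diagonal the difference of
  \<open>f\<close> vanishes.\<close>

lemma near_form_le:
  assumes \<delta>: "0 < \<delta>" and e: "energy s \<delta> \<mu> f \<le> ennreal e" "0 \<le> e"
  shows "cmod (near_form \<delta> (\<lambda>y. of_real (f y))) \<le> e / 2"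
proof -
  let ?F = "\<lambda>p. k_near \<delta> (fst p - snd p) * ((complex_of_real (f (snd p)) - of_real (f (fst p))) / 2)"
  show ?thesis
  proof (cases "integrable (\<mu> \<Otimes>\<^sub>M \<mu>) ?F")
    case True
    have pw: "2 * ennreal (cmod (?F p)) \<le> ennreal (dist (fst p) (snd p) powr (- s) * \<bar>f (snd p) - f (fst p)\<bar>)
        * indicator {p. dist (fst p) (snd p) < \<delta>} p" for p
    proof -
      have F: "2 * ennreal (cmod (?F p)) = ennreal (cmod (k_near \<delta> (fst p - snd p)) * \<bar>f (snd p) - f (fst p)\<bar>)"
        by (simp add: norm_mult norm_divide mult.commute flip: of_real_diff ennreal_mult' ennreal_numeral)
      show ?thesis
      proof (cases "fst p = snd p \<or> \<delta> \<le> dist (fst p) (snd p)")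
        case True
        then show ?thesis unfolding F using k_near_eq_0[OF \<delta>, of "fst p - snd p"] by (auto simp: dist_norm)
      next
        case False
        then show ?thesis unfolding F using k_near_le[OF \<delta>, of "fst p - snd p"]
          by (auto simp: dist_norm intro!: ennreal_leI mult_right_mono)
      qed
    qed
    have "ennreal (2 * cmod (near_form \<delta> (\<lambda>y. of_real (f y)))) = 2 * ennreal (cmod (integral\<^sup>L (\<mu> \<Otimes>\<^sub>M \<mu>) ?F))"
      unfolding near_form_def by (subst ennreal_mult') simp_all
    also have "\<dots> \<le> 2 * (\<integral>\<^sup>+p. ennreal (cmod (?F p)) \<partial>(\<mu> \<Otimes>\<^sub>M \<mu>))"
      by (intro mult_left_mono integral_norm_bound_ennreal True) simp
    also have "\<dots> = (\<integral>\<^sup>+p. 2 * ennreal (cmod (?F p)) \<partial>(\<mu> \<Otimes>\<^sub>M \<mu>))"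
      by (rule nn_integral_cmult_norm[OF borel_measurable_integrable[OF True], symmetric])
    also have "\<dots> \<le> energy s \<delta> \<mu> f" unfolding energy_def by (intro nn_integral_mono pw)
    also note e(1)
    finally show ?thesis using e(2) by simp
  next
    \<comment> \<open>The Bochner integral of a non-integrable function is \<open>0\<close>.\<close>
    case False
    show ?thesis unfolding near_form_def not_integrable_integral_eq[OF False] using e(2) by simp
  qed
qed

lemma integrable_k_cutoff:
  assumes \<delta>: "0 < \<delta>" and P: "potential s \<mu> \<delta> x \<le> ennreal P" "0 \<le> P" and \<psi>: "cutoff_seq \<psi>"
  shows "integrable \<mu> (\<lambda>y. k_far \<delta> (y - x) * of_real (\<psi> j y))"
    and "integrable \<mu> (\<lambda>y. k (y - x) * of_real (\<psi> j y))"
    and "(\<integral>y. k (y - x) * of_real (\<psi> j y) \<partial>\<mu>)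
      = (\<integral>y. k_near \<delta> (y - x) * of_real (\<psi> j y) \<partial>\<mu>) + (\<integral>y. k_far \<delta> (y - x) * of_real (\<psi> j y) \<partial>\<mu>)"
proof -
  note near = cutoff_tendsto(2)[OF \<psi> k_near_integral(1)[OF \<delta> P], of j]
  have "integrable \<mu> (\<lambda>z. - (k_far \<delta> (x - z) * of_real (\<psi> j z)))"
    using integrable_k_far_mult[OF cutoff_of_real(1)[OF \<psi>] \<delta>] by simp
  moreover have "- (k_far \<delta> (x - z) * of_real (\<psi> j z)) = k_far \<delta> (z - x) * of_real (\<psi> j z)" for z
    using k_far_odd[of \<delta> "z - x"] by simp
  ultimately show far: "integrable \<mu> (\<lambda>y. k_far \<delta> (y - x) * of_real (\<psi> j y))" by simp
  have split: "k (y - x) * of_real (\<psi> j y)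
      = k_near \<delta> (y - x) * of_real (\<psi> j y) + k_far \<delta> (y - x) * of_real (\<psi> j y)" for y
    by (simp add: k_near_def flip: distrib_right)
  show "integrable \<mu> (\<lambda>y. k (y - x) * of_real (\<psi> j y))"
    "(\<integral>y. k (y - x) * of_real (\<psi> j y) \<partial>\<mu>)
      = (\<integral>y. k_near \<delta> (y - x) * of_real (\<psi> j y) \<partial>\<mu>) + (\<integral>y. k_far \<delta> (y - x) * of_real (\<psi> j y) \<partial>\<mu>)"
    unfolding split using near far by simp_all
qed

text \<open>Neither \<open>k_far \<delta> (y - x)\<close> nor \<open>far_fun \<delta> g y\<close>
  need be integrable in \<open>y\<close>, but their difference \<open>G\<close> is, because
  \<open>f\<close> has mass \<open>1\<close>. So the limit exists along every cut-off sequence, and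
  its three contributions are bounded by the potential, half the energy and the tail with the far
  modulus.\<close>

lemma potential_limit:
  fixes f :: "'a \<Rightarrow> real"
  assumes f: "f \<in> Lip0" "\<And>y. 0 \<le> f y" "(\<integral>y. f y \<partial>\<mu>) = 1" "\<And>y. f y \<noteq> 0 \<Longrightarrow> dist x y \<le> h"
    and \<delta>: "0 < \<delta>" and P: "potential s \<mu> \<delta> x \<le> ennreal P" "0 \<le> P"
    and e: "energy s \<delta> \<mu> f \<le> ennreal e" "0 \<le> e"
  obtains L where
    "\<And>\<psi>. cutoff_seq \<psi> \<Longrightarrow> (\<lambda>j. (\<integral>y. k (y - x) * of_real (\<psi> j y) \<partial>\<mu>)
       - T_form k \<mu> (\<lambda>y. of_real (f y)) (\<lambda>y. of_real (\<psi> j y))) \<longlonglongrightarrow> L"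
    "cmod L \<le> P + e / 2 + far_modulus s \<alpha> M \<delta> h * (tail_const s \<alpha> \<Lambda> * \<delta> powr (- \<alpha>))"
proof -
  define g where "g y = complex_of_real (f y)" for y
  have g: "g \<in> Lip0" unfolding g_def by (rule of_real_Lip0[OF f(1)])
  have [measurable]: "g \<in> borel_measurable borel" using g by (rule Lip0_measurable)
  have g1: "(\<integral>z. g z \<partial>\<mu>) = 1" using f(3) by (simp add: g_def)
  have g2: "(\<integral>z. cmod (g z) \<partial>\<mu>) = 1" using f(2,3) by (simp add: g_def)
  have supp: "dist x z \<le> h" if "g z \<noteq> 0" for z using f(4)[of z] that by (simp add: g_def)
  define G where "G y = k_far \<delta> (y - x) - far_fun \<delta> g y" for y
  have G_le: "cmod (G y) \<le> far_modulus s \<alpha> M \<delta> h * max \<delta> (dist x y) powr (- s - \<alpha>)" for y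
    using far_fun_diff_le[OF g \<delta> supp, of y] by (simp add: G_def g1 g2)
  have w: "integrable \<mu> (\<lambda>y. far_modulus s \<alpha> M \<delta> h * max \<delta> (dist x y) powr (- s - \<alpha>))"
    using tail(1)[OF \<delta>] by simp
  have h: "0 \<le> h"
  proof (rule ccontr)
    assume "\<not> 0 \<le> h"
    then have "f y = 0" for y using f(4)[of y] zero_le_dist[of x y] by (cases "f y = 0") auto
    then show False using f(3) by simp
  qed
  have G: "integrable \<mu> G"
  proof (rule Bochner_Integration.integrable_bound[OF w])
    show "G \<in> borel_measurable \<mu>" unfolding G_def by measurable
    show "AE y in \<mu>. norm (G y) \<le> norm (far_modulus s \<alpha> M \<delta> h * max \<delta> (dist x y) powr (- s - \<alpha>))"
      by (intro AE_I2 order_trans[OF G_le]) simp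
  qed
  have "cmod (\<integral>y. G y \<partial>\<mu>) \<le> (\<integral>y. far_modulus s \<alpha> M \<delta> h * max \<delta> (dist x y) powr (- s - \<alpha>) \<partial>\<mu>)"
    by (rule norm_lebesgue_integral_le[OF G w G_le])
  also have "\<dots> = far_modulus s \<alpha> M \<delta> h * (\<integral>y. max \<delta> (dist x y) powr (- s - \<alpha>) \<partial>\<mu>)" by simp
  also have "\<dots> \<le> far_modulus s \<alpha> M \<delta> h * (tail_const s \<alpha> \<Lambda> * \<delta> powr (- \<alpha>))"
    by (intro mult_left_mono tail(2) \<delta> far_modulus_nonneg h)
  finally have G_int_le: "cmod (\<integral>y. G y \<partial>\<mu>) \<le> far_modulus s \<alpha> M \<delta> h * (tail_const s \<alpha> \<Lambda> * \<delta> powr (- \<alpha>))" .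
  note near = k_near_integral[OF \<delta> P]
  define L where "L = (\<integral>y. k_near \<delta> (y - x) \<partial>\<mu>) - near_form \<delta> g + (\<integral>y. G y \<partial>\<mu>)"
  show ?thesis
  proof (rule that)
    have "cmod L \<le> cmod (\<integral>y. k_near \<delta> (y - x) \<partial>\<mu>) + cmod (near_form \<delta> g) + cmod (\<integral>y. G y \<partial>\<mu>)"
      unfolding L_def by (intro order_trans[OF norm_triangle_ineq] add_mono norm_triangle_ineq4 order_refl)
    then show "cmod L \<le> P + e / 2 + far_modulus s \<alpha> M \<delta> h * (tail_const s \<alpha> \<Lambda> * \<delta> powr (- \<alpha>))"
      using near(2) near_form_le[OF \<delta> e, folded g_def] G_int_le by linarith
    fix \<psi> :: "nat \<Rightarrow> 'a \<Rightarrow> real" assume \<psi>: "cutoff_seq \<psi>"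
    have lim: "(\<lambda>j. (\<integral>y. k_near \<delta> (y - x) * of_real (\<psi> j y) \<partial>\<mu>) - near_form \<delta> g
        + (\<integral>y. G y * of_real (\<psi> j y) \<partial>\<mu>)) \<longlonglongrightarrow> L"
      unfolding L_def by (intro tendsto_intros cutoff_tendsto(1)[OF \<psi>] near(1) G)
    have "\<forall>\<^sub>F j in sequentially. (\<integral>y. k_near \<delta> (y - x) * of_real (\<psi> j y) \<partial>\<mu>) - near_form \<delta> g
        + (\<integral>y. G y * of_real (\<psi> j y) \<partial>\<mu>)
      = (\<integral>y. k (y - x) * of_real (\<psi> j y) \<partial>\<mu>) - T_form k \<mu> g (\<lambda>y. of_real (\<psi> j y))"
      using cutoff_T_form_eq[OF \<psi> g \<delta>]
    proof eventually_elim
      case (elim j)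
      note k = integrable_k_cutoff[OF \<delta> P \<psi>, of j]
      have far: "far_fun \<delta> g y * of_real (\<psi> j y) = k_far \<delta> (y - x) * of_real (\<psi> j y) - G y * of_real (\<psi> j y)" for y
        by (simp add: G_def algebra_simps)
      have "(\<integral>y. far_fun \<delta> g y * of_real (\<psi> j y) \<partial>\<mu>)
          = (\<integral>y. k_far \<delta> (y - x) * of_real (\<psi> j y) \<partial>\<mu>) - (\<integral>y. G y * of_real (\<psi> j y) \<partial>\<mu>)"
        unfolding far using k(1) cutoff_tendsto(2)[OF \<psi> G, of j] by simp
      then show ?case unfolding elim k(3) by simp
    qed
    with lim show "(\<lambda>j. (\<integral>y. k (y - x) * of_real (\<psi> j y) \<partial>\<mu>)
       - T_form k \<mu> (\<lambda>y. of_real (f y)) (\<lambda>y. of_real (\<psi> j y))) \<longlonglongrightarrow> L"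
      unfolding g_def by (rule Lim_transform_eventually)
  qed
qed

end

section \<open>Vector-valued kernels\<close>

lemma cmod_sum_mult_le_cnorm:
  assumes "cnorm n u \<le> 1"
  shows "cmod (\<Sum>i<n. u i * v i) \<le> cnorm n v"
proof -
  have "cmod (\<Sum>i<n. u i * v i) \<le> (\<Sum>i<n. \<bar>cmod (u i)\<bar> * \<bar>cmod (v i)\<bar>)"
    by (rule order_trans[OF norm_sum]) (simp add: norm_mult)
  also have "\<dots> \<le> cnorm n u * cnorm n v" unfolding cnorm_def by (rule L2_set_mult_ineq)
  also have "\<dots> \<le> 1 * cnorm n v"
    using assms by (intro mult_right_mono) (auto simp: cnorm_def)
  finally show ?thesis by simp
qed

text \<open>\<open>u i = cnj (v i) / cnorm n v\<close> attains equality in Cauchy-Schwarz. This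
  reduces norm bounds for vector-valued potentials to scalar kernels at no cost in the
  constants.\<close>

lemma cnorm_dual:
  obtains u where "cnorm n u \<le> 1" "of_real (cnorm n v) = (\<Sum>i<n. u i * v i)"
proof (cases "cnorm n v = 0")
  case True
  then show ?thesis by (intro that[of "\<lambda>_. 0"]) (simp_all add: cnorm_def L2_set_def)
next
  case False
  have pos: "0 < cnorm n v" using False by (simp add: cnorm_def less_le)
  have sq: "(cnorm n v)\<^sup>2 = (\<Sum>i<n. (cmod (v i))\<^sup>2)"
    by (simp add: cnorm_def L2_set_def sum_nonneg)
  define u where "u i = cnj (v i) / of_real (cnorm n v)" for i
  have "cnorm n u = L2_set (\<lambda>i. inverse (cnorm n v) * cmod (v i)) {..<n}"
    unfolding cnorm_def[of n u] u_def using pos by (simp add: norm_mult norm_inverse divide_inverse mult.commute)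
  also have "\<dots> = inverse (cnorm n v) * cnorm n v"
    using pos by (simp add: cnorm_def flip: L2_set_right_distrib)
  finally have "cnorm n u \<le> 1" using pos by simp
  moreover have "(\<Sum>i<n. u i * v i) = of_real (cnorm n v)"
  proof -
    have "(\<Sum>i<n. u i * v i) = (\<Sum>i<n. of_real ((cmod (v i))\<^sup>2)) / of_real (cnorm n v)"
      unfolding u_def sum_divide_distrib by (intro sum.cong) (auto simp: complex_norm_square mult.commute simp del: of_real_power)
    also have "\<dots> = of_real ((cnorm n v)\<^sup>2) / of_real (cnorm n v)" by (simp add: sq)
    finally show ?thesis using pos by (simp add: power2_eq_square)
  qed
  ultimately show ?thesis using that[of u] by simp
qed

lemma cnorm_zero [simp]: "cnorm n (\<lambda>_. 0) = 0"
  by (simp add: cnorm_def L2_set_def)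

text \<open>Cauchy-Schwarz against \<open>u\<close> transfers the size and Hoelder bounds with
  unchanged constants; oddness is linear.\<close>

lemma scalar_kernel_of_cz_kernel:
  fixes K :: "'a::euclidean_space \<Rightarrow> nat \<Rightarrow> complex"
  assumes s: "0 < s" and M: "0 \<le> M" and K: "cz_kernel n s \<alpha> K" "kernel_seminorm n s \<alpha> K = ennreal M"
    and u: "cnorm n u \<le> 1"
  shows "scalar_kernel (\<lambda>x. \<Sum>i<n. u i * K x i) s \<alpha> M"
proof (rule scalar_kernel.intro)
  show "0 < \<alpha>" "\<alpha> \<le> 1" using K(1) by (auto simp: cz_kernel_def)
  fix x :: 'a
  show "cmod (\<Sum>i<n. u i * K x i) \<le> norm x powr (- s)" if "x \<noteq> 0"
    using cmod_sum_mult_le_cnorm[OF u, of "K x"] K(1) that by (fastforce simp: cz_kernel_def)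
  show "(\<Sum>i<n. u i * K (- x) i) = - (\<Sum>i<n. u i * K x i)" if "x \<noteq> 0"
    using K(1) that by (simp add: cz_kernel_def sum_negf)
  fix y :: 'a
  define \<Phi> where "\<Phi> x i = (if x = 0 then 0 else K x i * complex_of_real (norm x powr (s + \<alpha>)))" for x i
  have eq: "(if z = 0 then 0 else (\<Sum>i<n. u i * K z i) * complex_of_real (norm z powr (s + \<alpha>))) = (\<Sum>i<n. u i * \<Phi> z i)" for z
    by (simp add: \<Phi>_def sum_distrib_right mult.assoc)
  have "cnorm n (\<lambda>i. \<Phi> x i - \<Phi> y i) \<le> M * dist x y powr \<alpha>"
  proof (cases "x = y")
    case False
    have "ennreal (cnorm n (\<lambda>i. \<Phi> x i - \<Phi> y i) / dist x y powr \<alpha>) \<le> holder_seminorm n \<alpha> \<Phi>"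
      unfolding holder_seminorm_def using False by (intro SUP_upper2[of "(x, y)"]) auto
    also have "\<dots> = ennreal M" using K(2) by (simp add: kernel_seminorm_def \<Phi>_def[abs_def])
    finally show ?thesis using M False by (simp add: pos_divide_le_eq)
  qed simp
  then have "cmod (\<Sum>i<n. u i * (\<Phi> x i - \<Phi> y i)) \<le> M * dist x y powr \<alpha>"
    using cmod_sum_mult_le_cnorm[OF u, of "\<lambda>i. \<Phi> x i - \<Phi> y i"] by linarith
  then show "cmod ((if x = 0 then 0 else (\<Sum>i<n. u i * K x i) * complex_of_real (norm x powr (s + \<alpha>))) -
      (if y = 0 then 0 else (\<Sum>i<n. u i * K y i) * complex_of_real (norm y powr (s + \<alpha>)))) \<le> M * dist x y powr \<alpha>"
    unfolding eq by (simp add: right_diff_distrib sum_subtractf)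
qed (use s M in auto)

lemma cnorm_unit: "i < n \<Longrightarrow> cnorm n (\<lambda>j. if j = i then 1 else 0) \<le> 1"
  by (simp add: cnorm_def L2_set_def if_distrib[of cmod] if_distrib[of "\<lambda>x. x\<^sup>2"] cong: if_cong)

context nice_measure
begin

text \<open>Growing bumps form a cut-off sequence, so uniqueness of limits makes the definite
  description pick \<open>L\<close>.\<close>

lemma T_bar_eq_limit:
  assumes fin: "(\<integral>\<^sup>+y\<in>ball x 1. epow (dist x y) (- s) \<partial>\<mu>) < \<infinity>"
    and lim: "\<And>\<psi>. cutoff_seq \<psi> \<Longrightarrow> (\<lambda>j. (\<integral>y. K (y - x) i * of_real (\<psi> j y) \<partial>\<mu>)
       - T_form (\<lambda>z. K z i) \<mu> (\<lambda>y. of_real (\<eta> y)) (\<lambda>y. of_real (\<psi> j y))) \<longlonglongrightarrow> L"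
  shows "T_bar K s \<mu> \<eta> (\<lambda>_. 1) x i = L"
proof -
  have "(THE L. \<forall>\<psi>. cutoff_seq \<psi> \<longrightarrow>
        (\<lambda>k. (\<integral>y. K (y - x) i * of_real (\<psi> k y) * 1 \<partial>\<mu>)
              - T_form (\<lambda>z. K z i) \<mu> (\<lambda>y. of_real (\<eta> y)) (\<lambda>y. of_real (\<psi> k y) * 1))
          \<longlonglongrightarrow> L) = L"
  proof (rule the_equality)
    fix L' assume "\<forall>\<psi>. cutoff_seq \<psi> \<longrightarrow>
        (\<lambda>k. (\<integral>y. K (y - x) i * of_real (\<psi> k y) * 1 \<partial>\<mu>)
              - T_form (\<lambda>z. K z i) \<mu> (\<lambda>y. of_real (\<eta> y)) (\<lambda>y. of_real (\<psi> k y) * 1)) \<longlonglongrightarrow> L'"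
    from this[rule_format, OF cutoff_seq_bump] show "L' = L"
      by (intro LIMSEQ_unique[OF _ lim[OF cutoff_seq_bump]]) simp
  qed (use lim in simp)
  then show ?thesis using fin by (simp add: T_bar_def)
qed

text \<open>Reflectionlessness permits \<eta> to be replaced by the density \<open>f\<close> in each
  component; a unit functional adapted to the vector at \<open>x\<close> then reduces the norm to
  \<open>potential_limit\<close> for one scalar kernel.\<close>

lemma cnorm_T_bar_le:
  fixes K :: "'a \<Rightarrow> nat \<Rightarrow> complex"
  assumes K: "cz_kernel n s \<alpha> K" "kernel_seminorm n s \<alpha> K = ennreal M" and M: "0 \<le> M"
    and refl: "reflectionless n s \<alpha> K \<mu>" and \<eta>: "normalizer \<mu> \<eta>"
    and f: "f \<in> Lip0" "\<And>y. 0 \<le> f y" "(\<integral>y. f y \<partial>\<mu>) = 1" "\<And>y. f y \<noteq> 0 \<Longrightarrow> dist x y \<le> h"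
    and \<delta>: "0 < \<delta>" and P: "potential s \<mu> \<delta> x \<le> ennreal P" "0 \<le> P"
    and e: "energy s \<delta> \<mu> f \<le> ennreal e" "0 \<le> e"
    and fin: "(\<integral>\<^sup>+y\<in>ball x 1. epow (dist x y) (- s) \<partial>\<mu>) < \<infinity>"
  shows "cnorm n (T_bar K s \<mu> \<eta> (\<lambda>_. 1) x)
    \<le> P + e / 2 + far_modulus s \<alpha> M \<delta> h * (tail_const s \<alpha> \<Lambda> * \<delta> powr (- \<alpha>))"
proof -
  let ?C = "P + e / 2 + far_modulus s \<alpha> M \<delta> h * (tail_const s \<alpha> \<Lambda> * \<delta> powr (- \<alpha>))"
  define a where "a k f \<psi> j = (\<integral>y. k (y - x) * of_real (\<psi> j y) \<partial>\<mu>)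
       - T_form k \<mu> (\<lambda>y. of_real (f y)) (\<lambda>y. of_real (\<psi> j y))"
    for k :: "'a \<Rightarrow> complex" and f :: "'a \<Rightarrow> real" and \<psi> :: "nat \<Rightarrow> 'a \<Rightarrow> real" and j
  have km: "kernel_measure \<mu> s \<Lambda> (\<lambda>x. \<Sum>i<n. u i * K x i) \<alpha> M" if "cnorm n u \<le> 1" for u
    using scalar_kernel_of_cz_kernel[OF s_pos M K that] nice_measure_axioms by (simp add: kernel_measure_def)
  have kmi: "kernel_measure \<mu> s \<Lambda> (\<lambda>x. K x i) \<alpha> M" if "i < n" for i
  proof -
    have "(\<lambda>x. \<Sum>j<n. (if j = i then 1 else 0) * K x j) = (\<lambda>x. K x i)"
      using that by (simp add: if_distrib[of "\<lambda>c. c * _"] cong: if_cong)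
    then show ?thesis using km[OF cnorm_unit[OF that]] by simp
  qed
  have f_Lip: "(\<lambda>y. complex_of_real (f y)) \<in> Lip0" using f(1) by (rule of_real_Lip0)
  have \<eta>_Lip: "(\<lambda>y. complex_of_real (\<eta> y)) \<in> Lip0" using \<eta> by (auto simp: normalizer_def intro: of_real_Lip0)
  have T_bar_lim: "a (\<lambda>x. K x i) f \<psi> \<longlonglongrightarrow> T_bar K s \<mu> \<eta> (\<lambda>_. 1) x i"
    if i: "i < n" and \<psi>: "cutoff_seq \<psi>" for i \<psi>
  proof -
    interpret k: kernel_measure \<mu> s \<Lambda> "\<lambda>x. K x i" \<alpha> M by (rule kmi[OF i])
    obtain L where "\<And>\<psi>. cutoff_seq \<psi> \<Longrightarrow> (\<lambda>j. (\<integral>y. K (y - x) i * of_real (\<psi> j y) \<partial>\<mu>)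
       - T_form (\<lambda>x. K x i) \<mu> (\<lambda>y. of_real (f y)) (\<lambda>y. of_real (\<psi> j y))) \<longlonglongrightarrow> L"
      by (rule k.potential_limit[OF f \<delta> P e]) (assumption, rule that, assumption)
    then have L: "a (\<lambda>x. K x i) f \<psi> \<longlonglongrightarrow> L" if "cutoff_seq \<psi>" for \<psi>
      unfolding a_def using that .
    have "a (\<lambda>x. K x i) \<eta> \<psi> \<longlonglongrightarrow> L" if \<psi>: "cutoff_seq \<psi>" for \<psi>
    proof -
      \<comment> \<open>\<open>f\<close> and \<eta> have the same integral, so their difference is a
        test function for the reflectionless condition and contributes \<open>0\<close> in the
        limit.\<close>
      define g where "g y = complex_of_real (f y) - of_real (\<eta> y)" for y
      have g: "g \<in> Lip0" unfolding g_def by (rule Lip0_diff[OF f_Lip \<eta>_Lip])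
      have g0: "(\<integral>y. g y \<partial>\<mu>) = 0"
        unfolding g_def using Lip0_integrable[OF f_Lip] Lip0_integrable[OF \<eta>_Lip] f(3) \<eta>
        by (simp add: normalizer_def)
      have "T_form_ext (\<lambda>x. K x i) \<mu> g (\<lambda>_. 1) = 0"
        using refl g g0 i by (auto simp: reflectionless_def)
      then have "(\<lambda>j. T_form (\<lambda>x. K x i) \<mu> g (\<lambda>y. of_real (\<psi> j y))) \<longlonglongrightarrow> 0"
        using k.cutoff_T_form_tendsto[OF g g0 \<psi>] by simp
      from tendsto_add[OF L[OF \<psi>] this]
      have "(\<lambda>j. a (\<lambda>x. K x i) f \<psi> j + T_form (\<lambda>x. K x i) \<mu> g (\<lambda>y. of_real (\<psi> j y))) \<longlonglongrightarrow> L" by simp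
      moreover have "T_form (\<lambda>x. K x i) \<mu> g (\<lambda>y. of_real (\<psi> j y)) =
          T_form (\<lambda>x. K x i) \<mu> (\<lambda>y. of_real (f y)) (\<lambda>y. of_real (\<psi> j y))
          - T_form (\<lambda>x. K x i) \<mu> (\<lambda>y. of_real (\<eta> y)) (\<lambda>y. of_real (\<psi> j y))" for j
        unfolding g_def by (rule k.T_form_diff[OF f_Lip \<eta>_Lip k.cutoff_of_real(1)[OF \<psi>]])
      ultimately show ?thesis unfolding a_def by simp
    qed
    then have "T_bar K s \<mu> \<eta> (\<lambda>_. 1) x i = L" unfolding a_def by (intro T_bar_eq_limit[OF fin])
    then show ?thesis using L[OF \<psi>] by simp
  qed
  obtain u where u: "cnorm n u \<le> 1"
    "of_real (cnorm n (T_bar K s \<mu> \<eta> (\<lambda>_. 1) x)) = (\<Sum>i<n. u i * T_bar K s \<mu> \<eta> (\<lambda>_. 1) x i)"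
    by (rule cnorm_dual)
  let ?k = "\<lambda>x. \<Sum>i<n. u i * K x i"
  interpret k: kernel_measure \<mu> s \<Lambda> ?k \<alpha> M by (rule km[OF u(1)])
  obtain L where L_raw: "\<And>\<psi>. cutoff_seq \<psi> \<Longrightarrow> (\<lambda>j. (\<integral>y. ?k (y - x) * of_real (\<psi> j y) \<partial>\<mu>)
       - T_form ?k \<mu> (\<lambda>y. of_real (f y)) (\<lambda>y. of_real (\<psi> j y))) \<longlonglongrightarrow> L" and L_le: "cmod L \<le> ?C"
    by (rule k.potential_limit[OF f \<delta> P e]) (assumption, rule that, assumption+)
  have L: "a ?k f \<psi> \<longlonglongrightarrow> L" if "cutoff_seq \<psi>" for \<psi>
    unfolding a_def using L_raw[OF that] .
  define \<psi> where "\<psi> j = bump (0::'a) (real j + 1)" for j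
  have \<psi>: "cutoff_seq \<psi>" unfolding \<psi>_def by (rule cutoff_seq_bump)
  \<comment> \<open>Linearity in the kernel: the finite sum commutes with both integrals because
    each component is integrable.\<close>
  have "a ?k f \<psi> j = (\<Sum>i<n. u i * a (\<lambda>x. K x i) f \<psi> j)" for j
  proof -
    have \<psi>_Lip: "(\<lambda>y. complex_of_real (\<psi> j y)) \<in> Lip0" by (rule k.cutoff_of_real(1)[OF \<psi>])
    have i1: "integrable \<mu> (\<lambda>y. u i * (K (y - x) i * of_real (\<psi> j y)))" if "i < n" for i
      using kernel_measure.integrable_k_cutoff(2)[OF kmi[OF that] \<delta> P \<psi>, of j] by simp
    have i2: "integrable (\<mu> \<Otimes>\<^sub>M \<mu>) (\<lambda>p. u i * (K (fst p - snd p) i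
        * H_form (\<lambda>y. of_real (f y)) (\<lambda>y. of_real (\<psi> j y)) (fst p) (snd p)))" if "i < n" for i
      using kernel_measure.integrable_T_form[OF kmi[OF that] f_Lip \<psi>_Lip] by simp
    have "(\<integral>y. ?k (y - x) * of_real (\<psi> j y) \<partial>\<mu>) = (\<integral>y. (\<Sum>i<n. u i * (K (y - x) i * of_real (\<psi> j y))) \<partial>\<mu>)"
      by (simp add: sum_distrib_right mult.assoc)
    also have "\<dots> = (\<Sum>i<n. u i * (\<integral>y. K (y - x) i * of_real (\<psi> j y) \<partial>\<mu>))"
      using i1 by (subst Bochner_Integration.integral_sum) auto
    finally have 1: "(\<integral>y. ?k (y - x) * of_real (\<psi> j y) \<partial>\<mu>) = \<dots>" .
    have "T_form ?k \<mu> (\<lambda>y. of_real (f y)) (\<lambda>y. of_real (\<psi> j y))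
        = (\<integral>p. (\<Sum>i<n. u i * (K (fst p - snd p) i
            * H_form (\<lambda>y. of_real (f y)) (\<lambda>y. of_real (\<psi> j y)) (fst p) (snd p))) \<partial>(\<mu> \<Otimes>\<^sub>M \<mu>))"
      unfolding T_form_def by (simp add: sum_distrib_right mult.assoc)
    also have "\<dots> = (\<Sum>i<n. u i * T_form (\<lambda>x. K x i) \<mu> (\<lambda>y. of_real (f y)) (\<lambda>y. of_real (\<psi> j y)))"
      unfolding T_form_def using i2 by (subst Bochner_Integration.integral_sum) auto
    finally show ?thesis unfolding a_def 1 by (simp add: right_diff_distrib sum_subtractf)
  qed
  then have eq: "a ?k f \<psi> = (\<lambda>j. \<Sum>i<n. u i * a (\<lambda>x. K x i) f \<psi> j)" by auto
  have "a ?k f \<psi> \<longlonglongrightarrow> of_real (cnorm n (T_bar K s \<mu> \<eta> (\<lambda>_. 1) x))"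
    unfolding eq u(2) by (intro tendsto_sum tendsto_mult tendsto_const T_bar_lim \<psi>) auto
  then have "L = of_real (cnorm n (T_bar K s \<mu> \<eta> (\<lambda>_. 1) x))"
    by (rule LIMSEQ_unique[OF L[OF \<psi>]])
  then show ?thesis using L_le by simp
qed

text \<open>Homogeneity in multiplied form, so that no division of extended reals occurs.\<close>

lemma energy_divide:
  assumes c: "0 < c" and f [measurable]: "f \<in> borel_measurable borel"
  shows "energy s \<delta> \<mu> f = energy s \<delta> \<mu> (\<lambda>y. f y / c) * ennreal c"
proof -
  have pw: "ennreal (dist (fst p) (snd p) powr (- s) * \<bar>f (snd p) - f (fst p)\<bar>) * indicator {p. dist (fst p) (snd p) < \<delta>} p
      = ennreal (dist (fst p) (snd p) powr (- s) * \<bar>f (snd p) / c - f (fst p) / c\<bar>)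
        * indicator {p. dist (fst p) (snd p) < \<delta>} p * ennreal c" for p :: "'a \<times> 'a"
  proof -
    have "\<bar>f (snd p) - f (fst p)\<bar> = \<bar>f (snd p) / c - f (fst p) / c\<bar> * c"
      using c by (simp add: abs_divide flip: diff_divide_distrib)
    then have "ennreal (dist (fst p) (snd p) powr (- s) * \<bar>f (snd p) - f (fst p)\<bar>)
        = ennreal (dist (fst p) (snd p) powr (- s) * \<bar>f (snd p) / c - f (fst p) / c\<bar>) * ennreal c"
      using c by (simp add: mult.assoc flip: ennreal_mult')
    then show ?thesis by (simp add: indicator_def)
  qed
  show ?thesis unfolding energy_def pw by (rule nn_integral_multc) measurable
qed

end

section \<open>The pointwise bound and its integral\<close>

text \<open>Scale invariance: the size of the far part depends only on the ratio \<open>t\<close> of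
  the support radius to \<delta>, so this ratio can be fixed before \<open>r\<close>.\<close>

lemma far_modulus_scale:
  assumes "0 < \<delta>" "0 \<le> t"
  shows "far_modulus s \<alpha> M \<delta> (t * \<delta>) * \<delta> powr (- \<alpha>) = far_modulus s \<alpha> M 1 t"
proof -
  have 1: "(t * \<delta>) powr \<alpha> * \<delta> powr (- \<alpha>) = t powr \<alpha>"
    using assms by (simp add: powr_mult powr_minus)
  have 2: "\<delta> * \<delta> powr (\<alpha> - 1) * \<delta> powr (- \<alpha>) = 1"
    using assms by (simp add: powr_diff powr_minus)
  have "far_modulus s \<alpha> M \<delta> (t * \<delta>) * \<delta> powr (- \<alpha>) = M * ((t * \<delta>) powr \<alpha> * \<delta> powr (- \<alpha>))
      + (s + \<alpha>) * (1 + t) powr (s + 2 * \<alpha> + 1) * t * (\<delta> * \<delta> powr (\<alpha> - 1) * \<delta> powr (- \<alpha>))"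
    unfolding far_modulus_def using assms by (simp add: algebra_simps)
  then show ?thesis unfolding 1 2 by (simp add: far_modulus_def)
qed

lemma far_modulus_tendsto_0:
  assumes "0 < \<alpha>"
  shows "((\<lambda>c. far_modulus s \<alpha> M 1 (4 * c)) \<longlongrightarrow> 0) (at_right 0)"
proof -
  have "((\<lambda>c. far_modulus s \<alpha> M 1 (4 * c)) \<longlongrightarrow> M * (4 * 0) powr \<alpha>
      + (s + \<alpha>) * (1 + (4 * 0) / 1) powr (s + 2 * \<alpha> + 1) * (4 * 0) * 1 powr (\<alpha> - 1)) (at_right 0)"
    unfolding far_modulus_def using assms
    by (intro tendsto_intros tendsto_powr') (auto intro: eventually_at_right_less[THEN eventually_mono])
  then show ?thesis by simp
qed

context nice_measure
begin

text \<open>The bump of \<open>exists_bump_energy_le\<close>, normalised to mass \<open>1\<close>,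
  is fed into \<open>cnorm_T_bar_le\<close>. By scaling, its support radius
  \<open>4 * c * \<delta>\<close> becomes the argument \<open>4 * c\<close> of the far
  modulus.\<close>

lemma cnorm_T_bar_le_potential:
  fixes K :: "'a \<Rightarrow> nat \<Rightarrow> complex"
  assumes K: "cz_kernel n s \<alpha> K" "kernel_seminorm n s \<alpha> K = ennreal M" and M: "0 \<le> M"
    and refl: "reflectionless n s \<alpha> K \<mu>" and \<eta>: "normalizer \<mu> \<eta>"
    and c: "0 < c" "c \<le> 1" and \<delta>: "0 < \<delta>" and \<kappa>: "0 < \<kappa>" "\<kappa> \<le> 1"
    and x0: "dist x x0 < c * \<delta>" and charged: "emeasure \<mu> (ball x0 (c * \<delta>)) \<noteq> 0"
  shows "ennreal (cnorm n (T_bar K s \<mu> \<eta> (\<lambda>_. 1) x))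
    \<le> ennreal (2 powr (s + 2) * 2 powr (\<bar>s - 1\<bar> + 1) * \<Lambda> * \<kappa> + far_modulus s \<alpha> M 1 (4 * c) * tail_const s \<alpha> \<Lambda>)
      + ennreal (1 + energy_const s c \<kappa>) * potential s \<mu> (5 * \<delta>) x"
    (is "_ \<le> ennreal ?E + ennreal ?D * _")
proof -
  have D: "1 \<le> ?D" by (simp add: energy_const_def)
  have \<alpha>: "0 < \<alpha>" using K(1) by (simp add: cz_kernel_def)
  have tc: "0 \<le> tail_const s \<alpha> \<Lambda>"
    using \<Lambda>_pos \<alpha> powr_less_mono[of "- \<alpha>" 0 "2::real"] by (auto simp: tail_const_def)
  show ?thesis
  proof (cases "(\<integral>\<^sup>+y\<in>ball x 1. epow (dist x y) (- s) \<partial>\<mu>) < \<infinity>")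
    \<comment> \<open>Here \<open>T_bar\<close> is \<open>0\<close> by definition.\<close>
    case False
    then have "T_bar K s \<mu> \<eta> (\<lambda>_. 1) x = (\<lambda>_. 0)" by (auto simp: T_bar_def)
    then show ?thesis by simp
  next
    case fin: True
    show ?thesis
    proof (cases "potential s \<mu> (5 * \<delta>) x = \<infinity>")
      \<comment> \<open>The right side is infinite because the coefficient \<open>?D\<close> is at
        least \<open>1\<close>.\<close>
      case True
      then show ?thesis using D by (simp add: ennreal_mult_top)
    next
      case False
      then obtain P where P: "potential s \<mu> (5 * \<delta>) x = ennreal P" "0 \<le> P"
        by (cases "potential s \<mu> (5 * \<delta>) x") auto
      define e where "e = 2 powr (s + 2) * 2 powr (\<bar>s - 1\<bar> + 1) * \<Lambda> * \<kappa> + energy_const s c \<kappa> * P"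
      have e: "0 \<le> e" using P \<Lambda>_pos \<kappa> by (simp add: e_def energy_const_def)
      obtain z T where T: "0 < T" "ball z (2 * T) \<subseteq> ball x (4 * c * \<delta>)" "0 < (\<integral>y. bump z T y \<partial>\<mu>)"
        "energy s \<delta> \<mu> (bump z T) \<le> ennreal (e * (\<integral>y. bump z T y \<partial>\<mu>))"
        unfolding e_def by (rule exists_bump_energy_le[OF c \<delta> \<kappa> x0 charged P])
      define I where "I = (\<integral>y. bump z T y \<partial>\<mu>)"
      define f where "f y = bump z T y / I" for y
      have I: "0 < I" using T(3) by (simp add: I_def)
      have bump: "bump z T \<in> Lip0" by (rule bump_Lip0[OF T(1)])
      have f_Lip: "f \<in> Lip0"
      proof (rule Lip0I[where L = "1 / T / I" and z = z and R = "2 * T"])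
        show "(1 / T / I)-lipschitz_on UNIV f"
        proof (rule lipschitz_onI)
          fix y w
          have "\<bar>f y - f w\<bar> = \<bar>bump z T y - bump z T w\<bar> / I"
            using I by (simp add: f_def abs_divide flip: diff_divide_distrib)
          also have "\<dots> \<le> dist y w / T / I"
            using I bump_diff_le[OF T(1)] by (intro divide_right_mono) auto
          finally show "dist (f y) (f w) \<le> 1 / T / I * dist y w" by (simp add: dist_real_def)
        qed (use T I in auto)
        show "dist z y \<le> 2 * T" if "f y \<noteq> 0" for y
          using that bump_eq_0[OF T(1), of z y] by (force simp: f_def)
      qed
      have f_supp: "dist x y \<le> 4 * c * \<delta>" if "f y \<noteq> 0" for y
      proof -
        have "y \<in> ball z (2 * T)" using that bump_eq_0[OF T(1), of z y] by (force simp: f_def)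
        then show ?thesis using T(2) by auto
      qed
      have f_energy: "energy s \<delta> \<mu> f \<le> ennreal e"
      proof -
        have "energy s \<delta> \<mu> f * ennreal I = energy s \<delta> \<mu> (bump z T)"
          unfolding f_def[abs_def] by (rule energy_divide[OF I Lip0_measurable[OF bump], symmetric])
        also have "\<dots> \<le> ennreal (e * I)" using T(4) by (simp only: I_def)
        also have "\<dots> = ennreal e * ennreal I" using e I by (intro ennreal_mult) auto
        finally have "energy s \<delta> \<mu> f * ennreal I \<le> ennreal e * ennreal I" .
        then show ?thesis using I by (simp add: ennreal_mult_le_mult_iff mult.commute)
      qed
      have "potential s \<mu> \<delta> x \<le> potential s \<mu> (5 * \<delta>) x"
        unfolding potential_def using \<delta> by (intro nn_integral_mono mult_left_mono) (auto simp: indicator_def)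
      then have "potential s \<mu> \<delta> x \<le> ennreal P" using P by simp
      then have "cnorm n (T_bar K s \<mu> \<eta> (\<lambda>_. 1) x)
          \<le> P + e / 2 + far_modulus s \<alpha> M \<delta> (4 * c * \<delta>) * (tail_const s \<alpha> \<Lambda> * \<delta> powr (- \<alpha>))"
        using f_supp by (intro cnorm_T_bar_le[OF K M refl \<eta> f_Lip _ _ _ \<delta> _ P(2) f_energy e fin])
          (use I in \<open>auto simp: f_def bump_nonneg I_def\<close>)
      also have "far_modulus s \<alpha> M \<delta> (4 * c * \<delta>) * (tail_const s \<alpha> \<Lambda> * \<delta> powr (- \<alpha>))
          = far_modulus s \<alpha> M 1 (4 * c) * tail_const s \<alpha> \<Lambda>"
        using far_modulus_scale[OF \<delta>, of "4 * c" s \<alpha> M] c by (simp add: mult_ac)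
      \<comment> \<open>Enlarging \<open>e / 2\<close> to \<open>e\<close> produces the constants of
        the claim.\<close>
      also have "P + e / 2 + far_modulus s \<alpha> M 1 (4 * c) * tail_const s \<alpha> \<Lambda> \<le> ?E + ?D * P"
      proof -
        have "?E + ?D * P = P + e + far_modulus s \<alpha> M 1 (4 * c) * tail_const s \<alpha> \<Lambda>"
          by (simp add: e_def algebra_simps)
        then show ?thesis using e by linarith
      qed
      finally have le: "cnorm n (T_bar K s \<mu> \<eta> (\<lambda>_. 1) x) \<le> ?E + ?D * P" .
      have "0 \<le> far_modulus s \<alpha> M 1 (4 * c)"
        using s_pos \<alpha> M c by (simp add: far_modulus_def)
      then have "0 \<le> ?E" using tc \<Lambda>_pos \<kappa> by simp
      then show ?thesis
        unfolding P(1) using le P(2) D by (simp add: ennreal_leI flip: ennreal_mult ennreal_plus)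
    qed
  qed
qed

text \<open>Tonelli: integrating first in the Lebesgue variable gives a multiple of
  \<open>R powr (d - s)\<close>, and only \<open>z\<close> in \<open>ball x (2 * r)\<close> count
  since \<open>R \<le> r\<close>; that ball has mass at most
  \<open>\<Lambda> * (2 * r) powr s\<close>. Relative to the volume of \<open>ball x r\<close> this
  leaves a power of \<open>R / r\<close>.\<close>

lemma nn_integral_potential_le:
  assumes R: "0 < R" "R \<le> r" and sd: "s < real DIM('a)"
  shows "(\<integral>\<^sup>+y\<in>ball x r. potential s \<mu> R y \<partial>lborel)
    \<le> ennreal (\<Lambda> * 2 powr s * (2 powr s / (1 - 2 powr (s - real DIM('a)))) * (R / r) powr (real DIM('a) - s))
      * emeasure lborel (ball x r)"
proof -
  let ?d = "real DIM('a)"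
  define C where "C = 2 powr s / (1 - 2 powr (s - ?d))"
  have C: "0 \<le> C"
    using sd powr_less_mono[of "s - ?d" 0 "2::real"] by (auto simp: C_def)
  have r: "0 < r" using R by simp
  interpret L: pair_sigma_finite lborel \<mu>
    by (intro pair_sigma_finite.intro sigma_finite_lborel sigma_finite_mu)
  let ?W = "\<lambda>y z. ennreal (dist y z powr (- s)) * indicator {..<R} (dist y z)"
  have meas: "(\<lambda>(y, z). ?W y z * indicator (ball x r) y) \<in> borel_measurable (lborel \<Otimes>\<^sub>M \<mu>)"
    by measurable
  have inner: "(\<integral>\<^sup>+y. ?W y z * indicator (ball x r) y \<partial>lborel)
      \<le> ennreal (C * unit_ball_vol ?d * R powr (?d - s)) * indicator (ball x (2 * r)) z" for z
  proof (cases "z \<in> ball x (2 * r)")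
    case True
    have "(\<integral>\<^sup>+y. ?W y z * indicator (ball x r) y \<partial>lborel)
        \<le> (\<integral>\<^sup>+y. ennreal (dist z y powr (- s)) * indicator (ball z R) y \<partial>lborel)"
      by (intro nn_integral_mono) (auto simp: indicator_def dist_commute)
    also have "\<dots> \<le> ennreal (2 powr \<bar>s\<bar> / (1 - 2 powr (s - ?d)) * unit_ball_vol ?d * R powr (?d - s))"
    proof (rule nn_integral_dist_powr_ball_le)
      fix t :: real assume "0 < t"
      then show "emeasure lborel (ball z t) \<le> ennreal (unit_ball_vol ?d * t powr ?d)"
        by (simp add: emeasure_ball powr_realpow)
    qed (use R sd in auto)
    finally show ?thesis using True s_pos by (simp add: C_def)
  next
    case False
    have zero: "?W y z * indicator (ball x r) y = 0" for y
      using False dist_triangle[of x z y] R by (auto simp: indicator_def)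
    show ?thesis unfolding zero by simp
  qed
  have "(\<integral>\<^sup>+y\<in>ball x r. potential s \<mu> R y \<partial>lborel) = (\<integral>\<^sup>+y. \<integral>\<^sup>+z. ?W y z * indicator (ball x r) y \<partial>\<mu> \<partial>lborel)"
    unfolding potential_eq by (intro nn_integral_cong nn_integral_multc[symmetric]) measurable
  also have "\<dots> = (\<integral>\<^sup>+z. \<integral>\<^sup>+y. ?W y z * indicator (ball x r) y \<partial>lborel \<partial>\<mu>)"
    by (rule L.Fubini'[symmetric, OF meas])
  also have "\<dots> \<le> (\<integral>\<^sup>+z. ennreal (C * unit_ball_vol ?d * R powr (?d - s)) * indicator (ball x (2 * r)) z \<partial>\<mu>)"
    by (intro nn_integral_mono inner)
  also have "\<dots> = ennreal (C * unit_ball_vol ?d * R powr (?d - s)) * emeasure \<mu> (ball x (2 * r))"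
    by (simp add: nn_integral_cmult_indicator sets_mu)
  also have "\<dots> \<le> ennreal (C * unit_ball_vol ?d * R powr (?d - s)) * ennreal (\<Lambda> * (2 * r) powr s)"
    using r by (intro mult_left_mono emeasure_ball_le) auto
  also have "\<dots> = ennreal (C * unit_ball_vol ?d * R powr (?d - s) * (\<Lambda> * (2 * r) powr s))"
    using \<Lambda>_pos by (intro ennreal_mult''[symmetric]) auto
  also have "C * unit_ball_vol ?d * R powr (?d - s) * (\<Lambda> * (2 * r) powr s)
      = (\<Lambda> * 2 powr s * C * (R / r) powr (?d - s)) * (unit_ball_vol ?d * r ^ DIM('a))"
  proof -
    have "R powr (?d - s) = (R / r) powr (?d - s) * r powr (?d - s)"
      using R r by (simp flip: powr_mult)
    moreover have "r powr (?d - s) * r powr s = r ^ DIM('a)"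
      using r by (simp add: powr_realpow flip: powr_add)
    ultimately have "R powr (?d - s) * r powr s = (R / r) powr (?d - s) * r ^ DIM('a)" by simp
    then show ?thesis using r by (simp add: powr_mult mult_ac)
  qed
  also have "ennreal \<dots> = ennreal (\<Lambda> * 2 powr s * C * (R / r) powr (?d - s)) * emeasure lborel (ball x r)"
    using r C \<Lambda>_pos by (simp add: emeasure_ball ennreal_mult)
  finally show ?thesis unfolding C_def .
qed

end

section \<open>Choice of the constants and averaging over the ball\<close>

theorem lemma6p7:
  fixes s \<alpha> M \<Lambda> \<epsilon> :: real
  assumes "2 \<le> CARD('d::finite)" and "0 < s" and "s < real CARD('d)"
    and "0 < \<alpha>" and "\<alpha> \<le> 1" and "0 \<le> M" and "0 < \<Lambda>" and "0 < \<epsilon>"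
  shows "\<exists>l>0. \<forall>(n::nat) (K :: real^'d \<Rightarrow> nat \<Rightarrow> complex) (\<mu> :: (real^'d) measure) \<eta> x r.
     1 \<le> n \<longrightarrow>
     cz_kernel n s \<alpha> K \<longrightarrow> kernel_seminorm n s \<alpha> K = ennreal M \<longrightarrow>
     loc_finite_borel \<mu> \<longrightarrow> nontrivial \<mu> \<longrightarrow> nice s \<Lambda> \<mu> \<longrightarrow> reflectionless n s \<alpha> K \<mu> \<longrightarrow>
     normalizer \<mu> \<eta> \<longrightarrow> 0 < r \<longrightarrow>
     (\<integral>\<^sup>+y\<in>ball x r. ennreal (cnorm n (T_bar K s \<mu> \<eta> (\<lambda>_. 1) y)) \<partial>lborel)
        > ennreal \<epsilon> * emeasure lborel (ball x r) \<longrightarrow>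
     (\<exists>z. ball z (l * r) \<subseteq> ball x r \<and> emeasure \<mu> (ball z (l * r)) = 0)"
proof -
  let ?d = "real CARD('d)"
  define C1 where "C1 = 2 powr (s + 2) * 2 powr (\<bar>s - 1\<bar> + 1) * \<Lambda>"
  have C1: "0 < C1" using assms by (simp add: C1_def)
  \<comment> \<open>The constants are fixed in the order \<kappa>, \<open>c\<close>, \<phi>, none
    depending on a later one. \<kappa> brings the growth term of the energy down to
    \<open>\<epsilon> / 4\<close>.\<close>
  define \<kappa> where "\<kappa> = min 1 (\<epsilon> / 4 / C1)"
  have \<kappa>: "0 < \<kappa>" "\<kappa> \<le> 1" using C1 assms by (auto simp: \<kappa>_def)
  have "C1 * \<kappa> \<le> C1 * (\<epsilon> / 4 / C1)" using C1 by (intro mult_left_mono) (auto simp: \<kappa>_def)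
  then have \<kappa>_le: "C1 * \<kappa> \<le> \<epsilon> / 4" using C1 by simp
  \<comment> \<open>The far part drops below \<open>\<epsilon> / 4\<close> once the density is
    concentrated close enough to the point.\<close>
  obtain c where c: "0 < c" "c \<le> 1" "far_modulus s \<alpha> M 1 (4 * c) * tail_const s \<alpha> \<Lambda> < \<epsilon> / 4"
  proof -
    have "((\<lambda>c. far_modulus s \<alpha> M 1 (4 * c) * tail_const s \<alpha> \<Lambda>) \<longlongrightarrow> 0 * tail_const s \<alpha> \<Lambda>) (at_right 0)"
      by (intro tendsto_mult tendsto_const far_modulus_tendsto_0 assms)
    then have "\<forall>\<^sub>F c in at_right 0. far_modulus s \<alpha> M 1 (4 * c) * tail_const s \<alpha> \<Lambda> < \<epsilon> / 4"
      using assms by (intro order_tendstoD(2)) auto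
    moreover have "\<forall>\<^sub>F c in at_right (0::real). 0 < c \<and> c < 1"
      using eventually_at_right_real[of 0 1] by simp
    ultimately have "\<forall>\<^sub>F c in at_right 0. 0 < c \<and> c < 1 \<and> far_modulus s \<alpha> M 1 (4 * c) * tail_const s \<alpha> \<Lambda> < \<epsilon> / 4"
      by eventually_elim auto
    then obtain c where "0 < c \<and> c < 1 \<and> far_modulus s \<alpha> M 1 (4 * c) * tail_const s \<alpha> \<Lambda> < \<epsilon> / 4"
      using eventually_happens'[OF trivial_limit_at_right_real] by blast
    then show ?thesis by (intro that[of c]) auto
  qed
  define D where "D = 1 + energy_const s c \<kappa>"
  have D: "1 \<le> D" by (simp add: D_def energy_const_def)
  define G where "G = \<Lambda> * 2 powr s * (2 powr s / (1 - 2 powr (s - ?d)))"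
  have G: "0 < G" using assms powr_less_mono[of "s - ?d" 0 "2::real"] by (auto simp: G_def)
  \<comment> \<open>The ratio of the radius of the potential to \<open>r\<close>; up to the cap at
    \<open>1\<close> it solves \<open>D * (G * \<phi> powr (d - s)) = \<epsilon> / 2\<close>.
    However large \<open>D\<close> is for small \<open>c\<close> and \<kappa>, it is beaten because
    \<open>s < d\<close>.\<close>
  define \<phi> where "\<phi> = min 1 ((\<epsilon> / 2 / (D * G)) powr (1 / (?d - s)))"
  have \<phi>: "0 < \<phi>" "\<phi> \<le> 1" using assms D G by (auto simp: \<phi>_def)
  have \<phi>_le: "D * (G * \<phi> powr (?d - s)) \<le> \<epsilon> / 2"
  proof -
    have "\<phi> powr (?d - s) \<le> ((\<epsilon> / 2 / (D * G)) powr (1 / (?d - s))) powr (?d - s)"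
      using \<phi> assms by (intro powr_mono2) (auto simp: \<phi>_def)
    also have "\<dots> = \<epsilon> / 2 / (D * G)" using assms D G by (simp add: powr_powr)
    finally have "D * G * \<phi> powr (?d - s) \<le> D * G * (\<epsilon> / 2 / (D * G))"
      using D G by (intro mult_left_mono) auto
    then show ?thesis using D G by (simp add: mult.assoc)
  qed
  \<comment> \<open>Dictated by \<open>5 * \<delta> = \<phi> * r\<close> and
    \<open>c * \<delta> = l * r\<close>.\<close>
  define l where "l = c * \<phi> / 5"
  have l: "0 < l" "l < 1"
  proof -
    show "0 < l" using c \<phi> by (simp add: l_def)
    have "c * \<phi> \<le> 1 * 1" using c \<phi> by (intro mult_mono) auto
    then show "l < 1" by (simp add: l_def)
  qed
  show ?thesis
  proof (intro exI[of _ l] conjI allI impI)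
    show "0 < l" by (rule l)
    fix n :: nat and K :: "real^'d \<Rightarrow> nat \<Rightarrow> complex" and \<mu> :: "(real^'d) measure" and \<eta> x and r :: real
    assume K: "cz_kernel n s \<alpha> K" "kernel_seminorm n s \<alpha> K = ennreal M"
      and \<mu>: "loc_finite_borel \<mu>" "nice s \<Lambda> \<mu>" "reflectionless n s \<alpha> K \<mu>" and \<eta>: "normalizer \<mu> \<eta>" and r: "0 < r"
      and big: "ennreal \<epsilon> * emeasure lborel (ball x r)
        < (\<integral>\<^sup>+y\<in>ball x r. ennreal (cnorm n (T_bar K s \<mu> \<eta> (\<lambda>_. 1) y)) \<partial>lborel)"
    interpret nice_measure \<mu> s \<Lambda>
      using \<mu> assms by unfold_locales (auto simp: loc_finite_borel_def)
    define \<delta> where "\<delta> = \<phi> * r / 5"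
    have \<delta>: "0 < \<delta>" "c * \<delta> = l * r" "5 * \<delta> = \<phi> * r" using \<phi> r by (auto simp: \<delta>_def l_def)
    show "\<exists>z. ball z (l * r) \<subseteq> ball x r \<and> emeasure \<mu> (ball z (l * r)) = 0"
    proof (rule ccontr)
      assume none: "\<not> ?thesis"
      have pw: "ennreal (cnorm n (T_bar K s \<mu> \<eta> (\<lambda>_. 1) y)) * indicator (ball x r) y
          \<le> ennreal (\<epsilon> / 2) * indicator (ball x r) y + ennreal D * (potential s \<mu> (\<phi> * r) y * indicator (ball x r) y)" for y
      proof (cases "y \<in> ball x r")
        case True
        \<comment> \<open>Moving \<open>y\<close> towards the centre by the fraction
          \<open>l\<close> gives a ball of radius \<open>l * r\<close> that contains
          \<open>y\<close> and stays inside \<open>ball x r\<close>, even for \<open>y\<close> near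
          the boundary.\<close>
        define x0 where "x0 = y + l *\<^sub>R (x - y)"
        have "ball x0 (l * r) \<subseteq> ball x r"
        proof
          fix w assume "w \<in> ball x0 (l * r)"
          moreover have "dist x x0 = (1 - l) * dist x y"
          proof -
            have "x - x0 = (1 - l) *\<^sub>R (x - y)" by (simp add: x0_def algebra_simps)
            then show ?thesis using l by (simp add: dist_norm)
          qed
          moreover have "(1 - l) * dist x y \<le> (1 - l) * r" using True l by (intro mult_left_mono) auto
          ultimately show "w \<in> ball x r" using dist_triangle[of x w x0] by (simp add: algebra_simps)
        qed
        then have charged: "emeasure \<mu> (ball x0 (c * \<delta>)) \<noteq> 0" using none \<delta>(2) by auto
        have "dist y x0 = l * dist x y" using l by (simp add: x0_def dist_norm)
        then have x0: "dist y x0 < c * \<delta>" using True l \<delta>(2) by simp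
        have "ennreal (cnorm n (T_bar K s \<mu> \<eta> (\<lambda>_. 1) y))
            \<le> ennreal (C1 * \<kappa> + far_modulus s \<alpha> M 1 (4 * c) * tail_const s \<alpha> \<Lambda>)
              + ennreal D * potential s \<mu> (5 * \<delta>) y"
          unfolding C1_def D_def
          by (rule cnorm_T_bar_le_potential[OF K assms(6) \<mu>(3) \<eta> c(1,2) \<delta>(1) \<kappa> x0 charged])
        also have "\<dots> \<le> ennreal (\<epsilon> / 2) + ennreal D * potential s \<mu> (\<phi> * r) y"
          unfolding \<delta>(3) using \<kappa>_le c(3) by (intro add_mono ennreal_leI) auto
        finally show ?thesis using True by simp
      qed simp
      have [measurable]: "potential s \<mu> (\<phi> * r) \<in> borel_measurable borel"
      proof -
        have "potential s \<mu> (\<phi> * r) \<in> borel_measurable \<mu>"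
          unfolding potential_eq[abs_def] by measurable
        then show ?thesis by (simp add: measurable_cong_sets[OF sets_mu refl])
      qed
      \<comment> \<open>After integration the constant part gives \<open>\<epsilon> / 2\<close>
        times the volume and the potential at most as much again, against the strict inequality
        assumed.\<close>
      have "(\<integral>\<^sup>+y\<in>ball x r. ennreal (cnorm n (T_bar K s \<mu> \<eta> (\<lambda>_. 1) y)) \<partial>lborel)
          \<le> (\<integral>\<^sup>+y. ennreal (\<epsilon> / 2) * indicator (ball x r) y
            + ennreal D * (potential s \<mu> (\<phi> * r) y * indicator (ball x r) y) \<partial>lborel)"
        by (intro nn_integral_mono pw)
      also have "\<dots> = ennreal (\<epsilon> / 2) * emeasure lborel (ball x r)
          + ennreal D * (\<integral>\<^sup>+y\<in>ball x r. potential s \<mu> (\<phi> * r) y \<partial>lborel)"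
        by (subst nn_integral_add) (simp_all add: nn_integral_cmult nn_integral_cmult_indicator)
      also have "\<dots> \<le> ennreal (\<epsilon> / 2) * emeasure lborel (ball x r)
          + ennreal D * (ennreal (G * (\<phi> * r / r) powr (?d - s)) * emeasure lborel (ball x r))"
        unfolding G_def using nn_integral_potential_le[of "\<phi> * r" r x] \<phi> r assms
        by (intro add_left_mono mult_left_mono) (auto simp: mult_le_cancel_right1)
      also have "\<dots> = (ennreal (\<epsilon> / 2) + ennreal (D * (G * \<phi> powr (?d - s)))) * emeasure lborel (ball x r)"
        using D r by (simp add: distrib_right ennreal_mult' mult.assoc)
      also have "\<dots> \<le> (ennreal (\<epsilon> / 2) + ennreal (\<epsilon> / 2)) * emeasure lborel (ball x r)"
        using \<phi>_le by (intro mult_right_mono add_left_mono ennreal_leI) auto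
      also have "ennreal (\<epsilon> / 2) + ennreal (\<epsilon> / 2) = ennreal \<epsilon>"
        using assms by (simp flip: ennreal_plus)
      finally show False using big by simp
    qed
  qed
qed

end
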